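(* Let $(\mathcal A,\delta)$ be a $C^*$-dynamical system and let $J$ be an ideal in $\mathcal A$ having zero intersection with the kernel of $\delta$. If $(\pi,U,H)$ is a covariant representation of $(\mathcal A,\delta)$ associated with $J$, then the relations $$(\pi\times U)(a)=\pi(a),\quad a\in\mathcal A,\qquad(\pi\times U)(\hat u)=U$$ determine in a unique way an epimorphism $\pi\times U:C^*(\mathcal A,\delta,J)\to C^*(\pi(\mathcal A),U)$. Moreover, $\pi\times U$ is an isomorphism if and only if $(\pi,U,H)$ possesses property $( * )$.
   Context: A $C^*$-dynamical system $(\mathcal A,\delta)$ is a unital $C^*$-algebra $\mathcal A$ with a $*$-endomorphism $\delta:\mathcal A\to\mathcal A$ (not assumed unital or injective). A covariant representation of $(\mathcal A,\delta)$ is a triple $(\pi,U,H)$ where $\pi:\mathcal A\to\mathcal B(H)$ is a non-degenerate faithful $*$-representation on a Hilbert space $H$ and $U\in\mathcal B(H)$ is a partial isometry with $U\pi(a)U^*=\pi(\delta(a))$ for all $a\in\mathcal A$ and $U^*U\in\pi(\mathcal A)'$ (the commutant). Ideals are closed and two-sided. A covariant representation $(\pi,U,H)$ is associated with an ideal $J$ (where $J\cap\operatorname{Ker}\delta=\{0\}$) if $J=\{a\in\mathcal A: U^*U\pi(a)=\pi(a)\}$. $C^*(\pi(\mathcal A),U)$ is the $C^*$-subalgebra of $\mathcal B(H)$ generated by $\pi(\mathcal A)$ and $U$. $\mathbb N=\{0,1,2,\dots\}$. $\mathcal M(\mathcal A)$ is the set of infinite matrices $\{a_{ij}\}_{i,j\in\mathbb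 N}$ with $a_{ij}\in\delta^i(1)\mathcal A\delta^j(1)$ and only finitely many non-zero entries. It is a $*$-algebra under entrywise addition and scalar multiplication, involution $(a^* )_{m,n}=a_{n,m}^*$, and multiplication $a\star b=a\cdot\sum_{j=0}^\infty\Lambda^j(b)+\sum_{j=1}^\infty\Lambda^j(a)\cdot b$, where $\cdot$ is the usual matrix product and $\Lambda(a)_{ij}=\delta(a_{i-1,j-1})$ for $i,j\ge1$, $\Lambda(a)_{ij}=0$ otherwise. An element $a\in\mathcal A$ is identified with the matrix whose $(0,0)$ entry is $a$ and whose other entries are $0$; $u\in\mathcal M(\mathcal A)$ is the matrix with $u_{01}=\delta(1)$ and all other entries $0$. For $k\in\mathbb Z$, $n\in\mathbb N$ write $a_n^{(k)}=a_{n,n+k}$ if $k\ge0$ and $a_n^{(k)}=a_{n-k,n}$ if $k<0$. Property $( * )$ for $(\pi,U,H)$: for every $\{a_{m,n}\}\in\mathcal M(\mathcal A)$, $$\Big\|\sum_{m\in\mathbb N}U^{*m}\pi(a_{m,m})U^m\Big\|\le\Big\|\sum_{m,n\in\mathbb N}U^{*m}\pi(a_{m,n})U^n\Big\|.$$ Crossed product: let $I=\operatorname{Ker}\delta$, let $d(x,K)=\inf_{b\in K}\|x-b\|$, and for $a\in\mathcal M(\mathcal A)$ put $$|||a|||_J=\sum_{k\in\mathbb Z}\lim_{n\to\infty}\max\Big\{\max_{i=0,\dots,n} d\Big(\sum_{j=0}^i\delta^{i-j}(a_j^{(k)}),J\Big),\ d\Big(\sum_{j=0}^n\delta^{n-j}(a_j^{(k)}),I\Big)\Big\}.$$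 This is a $*$-invariant submultiplicative seminorm on $\mathcal M(\mathcal A)$. The crossed product $C^*(\mathcal A,\delta,J)$ of $\mathcal A$ by $\delta$ associated with $J$ is the enveloping $C^*$-algebra of the normed $*$-algebra $\mathcal M(\mathcal A)/|||\cdot|||_J$, the quotient of $\mathcal M(\mathcal A)$ by $\{a:|||a|||_J=0\}$. The algebra $\mathcal A$ embeds in $C^*(\mathcal A,\delta,J)$ via $\mathcal A\subset\mathcal M(\mathcal A)$ and the canonical map, and is identified with its image; $\hat u\in C^*(\mathcal A,\delta,J)$ denotes the image of $u$. *)

theory Defs
  imports "HOL-Analysis.Analysis"
begin

section \<open>Complex normed spaces, Hilbert spaces and unital C*-algebras\<close>

class complex_normed_vector = real_normed_vector +
  fixes scaleC :: "complex \<Rightarrow> 'a \<Rightarrow> 'a"  (infixr \<open>*\<^sub>C\<close> 75)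
  assumes scaleC_of_real: "of_real r *\<^sub>C x = r *\<^sub>R x"
    and scaleC_add_right: "c *\<^sub>C (x + y) = c *\<^sub>C x + c *\<^sub>C y"
    and scaleC_add_left: "(c + d) *\<^sub>C x = c *\<^sub>C x + d *\<^sub>C x"
    and scaleC_scaleC: "c *\<^sub>C (d *\<^sub>C x) = (c * d) *\<^sub>C x"
    and norm_scaleC: "norm (c *\<^sub>C x) = cmod c * norm x"

text \<open>The inner product is linear in the first argument. The zero space is allowed.\<close>

class chilbert_space = complex_normed_vector + banach +
  fixes cinner :: "'a \<Rightarrow> 'a \<Rightarrow> complex"
  assumes cinner_add_left: "cinner (x + y) z = cinner x z + cinner y z"
    and cinner_scaleC_left: "cinner (c *\<^sub>C x) y = c * cinner x y"
    and cinner_commute: "cinner y x = cnj (cinner x y)"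
    and cinner_self: "cinner x x = of_real ((norm x)\<^sup>2)"

text \<open>The unit comes from \<^class>\<open>monoid_mult\<close> rather than \<^class>\<open>real_normed_algebra_1\<close>,
  so that the zero algebra is not excluded.\<close>

class unital_cstar_algebra = complex_normed_vector + banach + real_normed_algebra + monoid_mult +
  fixes star :: "'a \<Rightarrow> 'a"
  assumes mult_scaleC_left: "(c *\<^sub>C x) * y = c *\<^sub>C (x * y)"
    and mult_scaleC_right: "x * (c *\<^sub>C y) = c *\<^sub>C (x * y)"
    and star_add: "star (x + y) = star x + star y"
    and star_scaleC: "star (c *\<^sub>C x) = cnj c *\<^sub>C star x"
    and star_mult: "star (x * y) = star y * star x"
    and star_star: "star (star x) = x"
    and cstar_identity: "norm (star x * x) = (norm x)\<^sup>2"


section \<open>Carrier-based *-algebras and *-homomorphisms\<close>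

text \<open>The crossed product depends on the terms \<open>\<delta>\<close> and \<open>J\<close>, hence cannot be a type;
  all algebras are therefore presented as records whose operations matter on the carrier only.
  Algebras need not be unital and *-homomorphisms need not preserve units.\<close>

record 'x star_algebra =
  alg_carrier :: "'x set"
  alg_add :: "'x \<Rightarrow> 'x \<Rightarrow> 'x"
  alg_mult :: "'x \<Rightarrow> 'x \<Rightarrow> 'x"
  alg_scale :: "complex \<Rightarrow> 'x \<Rightarrow> 'x"
  alg_star :: "'x \<Rightarrow> 'x"
  alg_norm :: "'x \<Rightarrow> real"

definition alg_diff :: "'x star_algebra \<Rightarrow> 'x \<Rightarrow> 'x \<Rightarrow> 'x" where
  "alg_diff B x y = alg_add B x (alg_scale B (-1) y)"

definition star_hom :: "'x star_algebra \<Rightarrow> 'y star_algebra \<Rightarrow> ('x \<Rightarrow> 'y) \<Rightarrow> bool" where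
  "star_hom B C f \<longleftrightarrow>
     f \<in> alg_carrier B \<rightarrow> alg_carrier C \<and>
     (\<forall>x\<in>alg_carrier B. \<forall>y\<in>alg_carrier B. f (alg_add B x y) = alg_add C (f x) (f y)) \<and>
     (\<forall>x\<in>alg_carrier B. \<forall>y\<in>alg_carrier B. f (alg_mult B x y) = alg_mult C (f x) (f y)) \<and>
     (\<forall>c. \<forall>x\<in>alg_carrier B. f (alg_scale B c x) = alg_scale C c (f x)) \<and>
     (\<forall>x\<in>alg_carrier B. f (alg_star B x) = alg_star C (f x))"

definition star_epimorphism :: "'x star_algebra \<Rightarrow> 'y star_algebra \<Rightarrow> ('x \<Rightarrow> 'y) \<Rightarrow> bool" where
  "star_epimorphism B C f \<longleftrightarrow> star_hom B C f \<and> f ` alg_carrier B = alg_carrier C"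

definition star_isomorphism :: "'x star_algebra \<Rightarrow> 'y star_algebra \<Rightarrow> ('x \<Rightarrow> 'y) \<Rightarrow> bool" where
  "star_isomorphism B C f \<longleftrightarrow> star_hom B C f \<and> bij_betw f (alg_carrier B) (alg_carrier C)"

definition type_algebra :: "('a::unital_cstar_algebra) star_algebra" where
  "type_algebra = \<lparr>alg_carrier = UNIV, alg_add = (+), alg_mult = (*), alg_scale = scaleC,
     alg_star = star, alg_norm = norm\<rparr>"


section \<open>Enveloping C*-algebras\<close>

text \<open>C*-seminorms dominated by the given norm. These are precisely the functions
  \<open>x \<mapsto> \<parallel>\<rho>(x)\<parallel>\<close> for continuous *-representations \<open>\<rho>\<close> (a continuous representation of a
  normed *-algebra is automatically contractive), so their supremum is the norm of the enveloping
  C*-algebra; formulated this way it does not range over Hilbert spaces of arbitrary type.\<close>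

definition cstar_seminorm_on :: "'x star_algebra \<Rightarrow> ('x \<Rightarrow> real) \<Rightarrow> bool" where
  "cstar_seminorm_on B p \<longleftrightarrow>
     (\<forall>x\<in>alg_carrier B. 0 \<le> p x) \<and>
     (\<forall>x\<in>alg_carrier B. \<forall>y\<in>alg_carrier B. p (alg_add B x y) \<le> p x + p y) \<and>
     (\<forall>c. \<forall>x\<in>alg_carrier B. p (alg_scale B c x) = cmod c * p x) \<and>
     (\<forall>x\<in>alg_carrier B. \<forall>y\<in>alg_carrier B. p (alg_mult B x y) \<le> p x * p y) \<and>
     (\<forall>x\<in>alg_carrier B. p (alg_mult B (alg_star B x) x) = (p x)\<^sup>2)"

definition enveloping_seminorm :: "'x star_algebra \<Rightarrow> 'x \<Rightarrow> real" where
  "enveloping_seminorm B x =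
     (SUP p \<in> {p. cstar_seminorm_on B p \<and> (\<forall>y\<in>alg_carrier B. p y \<le> alg_norm B y)}. p x)"

definition env_cauchy :: "'x star_algebra \<Rightarrow> (nat \<Rightarrow> 'x) set" where
  "env_cauchy B = {X. (\<forall>n. X n \<in> alg_carrier B) \<and>
     (\<forall>e>0. \<exists>N. \<forall>m\<ge>N. \<forall>n\<ge>N. enveloping_seminorm B (alg_diff B (X m) (X n)) < e)}"

definition env_rel :: "'x star_algebra \<Rightarrow> ((nat \<Rightarrow> 'x) \<times> (nat \<Rightarrow> 'x)) set" where
  "env_rel B = {(X, Y). X \<in> env_cauchy B \<and> Y \<in> env_cauchy B \<and>
     (\<lambda>n. enveloping_seminorm B (alg_diff B (X n) (Y n))) \<longlonglongrightarrow> 0}"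

text \<open>The Hausdorff completion by Cauchy sequences. If \<open>alg_norm B\<close> is merely a seminorm, this
  is the enveloping C*-algebra of the normed *-algebra obtained by dividing out its null space:
  the dominated C*-seminorms vanish on that null space, so both quotients are taken in one step.
  The unions below are over equal sets, since the operations respect the relation.\<close>

definition enveloping_cstar :: "'x star_algebra \<Rightarrow> (nat \<Rightarrow> 'x) set star_algebra" where
  "enveloping_cstar B =
     \<lparr>alg_carrier = env_cauchy B // env_rel B,
      alg_add = (\<lambda>C D. \<Union>X\<in>C. \<Union>Y\<in>D. env_rel B `` {\<lambda>n. alg_add B (X n) (Y n)}),
      alg_mult = (\<lambda>C D. \<Union>X\<in>C. \<Union>Y\<in>D. env_rel B `` {\<lambda>n. alg_mult B (X n) (Y n)}),
      alg_scale = (\<lambda>c C. \<Union>X\<in>C. env_rel B `` {\<lambda>n. alg_scale B c (X n)}),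
      alg_star = (\<lambda>C. \<Union>X\<in>C. env_rel B `` {\<lambda>n. alg_star B (X n)}),
      alg_norm = (\<lambda>C. the_elem ((\<lambda>X. lim (\<lambda>n. enveloping_seminorm B (X n))) ` C))\<rparr>"

definition canonical_map :: "'x star_algebra \<Rightarrow> 'x \<Rightarrow> (nat \<Rightarrow> 'x) set" where
  "canonical_map B x = env_rel B `` {\<lambda>n. x}"


section \<open>The crossed product\<close>

definition cstar_dynamical_system :: "('a::unital_cstar_algebra \<Rightarrow> 'a) \<Rightarrow> bool" where
  "cstar_dynamical_system \<delta> \<longleftrightarrow> star_hom type_algebra type_algebra \<delta>"

definition closed_ideal :: "('a::unital_cstar_algebra) set \<Rightarrow> bool" where
  "closed_ideal J \<longleftrightarrow> closed J \<and> 0 \<in> J \<and> (\<forall>x\<in>J. \<forall>y\<in>J. x + y \<in> J) \<and>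
     (\<forall>c. \<forall>x\<in>J. c *\<^sub>C x \<in> J) \<and> (\<forall>a. \<forall>x\<in>J. a * x \<in> J \<and> x * a \<in> J)"

definition Ker :: "('a \<Rightarrow> 'b::zero) \<Rightarrow> 'a set" where
  "Ker f = {x. f x = 0}"

type_synonym 'a inf_matrix = "nat \<Rightarrow> nat \<Rightarrow> 'a"

definition matrices :: "('a::unital_cstar_algebra \<Rightarrow> 'a) \<Rightarrow> 'a inf_matrix set" where
  "matrices \<delta> = {a. finite {(i, j). a i j \<noteq> 0} \<and>
     (\<forall>i j. a i j \<in> {(\<delta> ^^ i) 1 * x * (\<delta> ^^ j) 1 | x. True})}"

definition Lam :: "('a \<Rightarrow> 'a) \<Rightarrow> ('a::unital_cstar_algebra) inf_matrix \<Rightarrow> 'a inf_matrix" where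
  "Lam \<delta> a = (\<lambda>i j. if 1 \<le> i \<and> 1 \<le> j then \<delta> (a (i - 1) (j - 1)) else 0)"

text \<open>All series of matrix entries below have only finitely many non-zero terms when the matrices
  come from \<^const>\<open>matrices\<close>.\<close>

definition mat_times :: "('a::unital_cstar_algebra) inf_matrix \<Rightarrow> 'a inf_matrix \<Rightarrow> 'a inf_matrix" where
  "mat_times a b = (\<lambda>m n. \<Sum>k. a m k * b k n)"

definition mat_star_mult ::
  "('a \<Rightarrow> 'a) \<Rightarrow> ('a::unital_cstar_algebra) inf_matrix \<Rightarrow> 'a inf_matrix \<Rightarrow> 'a inf_matrix" where
  "mat_star_mult \<delta> a b = (\<lambda>m n.
     mat_times a (\<lambda>i k. \<Sum>j. (Lam \<delta> ^^ j) b i k) m n +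
     mat_times (\<lambda>i k. \<Sum>j. (Lam \<delta> ^^ Suc j) a i k) b m n)"

definition diag_entry :: "'a inf_matrix \<Rightarrow> int \<Rightarrow> nat \<Rightarrow> 'a" where
  "diag_entry a k n = (if 0 \<le> k then a n (n + nat k) else a (n + nat (- k)) n)"

text \<open>For a matrix with finite support only finitely many \<open>k\<close> contribute, and for each of them
  the limit exists.\<close>

definition mat_seminorm ::
  "('a::unital_cstar_algebra \<Rightarrow> 'a) \<Rightarrow> 'a set \<Rightarrow> 'a inf_matrix \<Rightarrow> real" where
  "mat_seminorm \<delta> J a = (\<Sum>\<^sub>\<infinity>k\<in>UNIV. lim (\<lambda>n.
     max (Max ((\<lambda>i. infdist (\<Sum>j\<le>i. (\<delta> ^^ (i - j)) (diag_entry a k j)) J) ` {0..n}))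
         (infdist (\<Sum>j\<le>n. (\<delta> ^^ (n - j)) (diag_entry a k j)) (Ker \<delta>))))"

definition matrix_algebra ::
  "('a::unital_cstar_algebra \<Rightarrow> 'a) \<Rightarrow> 'a set \<Rightarrow> 'a inf_matrix star_algebra" where
  "matrix_algebra \<delta> J =
     \<lparr>alg_carrier = matrices \<delta>,
      alg_add = (\<lambda>a b i j. a i j + b i j),
      alg_mult = mat_star_mult \<delta>,
      alg_scale = (\<lambda>c a i j. c *\<^sub>C a i j),
      alg_star = (\<lambda>a m n. star (a n m)),
      alg_norm = mat_seminorm \<delta> J\<rparr>"

definition crossed_product ::
  "('a::unital_cstar_algebra \<Rightarrow> 'a) \<Rightarrow> 'a set \<Rightarrow> (nat \<Rightarrow> 'a inf_matrix) set star_algebra" where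
  "crossed_product \<delta> J = enveloping_cstar (matrix_algebra \<delta> J)"

definition mat_embed :: "('a::zero) \<Rightarrow> 'a inf_matrix" where
  "mat_embed a = (\<lambda>i j. if i = 0 \<and> j = 0 then a else 0)"

definition mat_u :: "('a::unital_cstar_algebra \<Rightarrow> 'a) \<Rightarrow> 'a inf_matrix" where
  "mat_u \<delta> = (\<lambda>i j. if i = 0 \<and> j = 1 then \<delta> 1 else 0)"

definition cp_embed ::
  "('a::unital_cstar_algebra \<Rightarrow> 'a) \<Rightarrow> 'a set \<Rightarrow> 'a \<Rightarrow> (nat \<Rightarrow> 'a inf_matrix) set" where
  "cp_embed \<delta> J a = canonical_map (matrix_algebra \<delta> J) (mat_embed a)"

definition u_hat ::
  "('a::unital_cstar_algebra \<Rightarrow> 'a) \<Rightarrow> 'a set \<Rightarrow> (nat \<Rightarrow> 'a inf_matrix) set" where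
  "u_hat \<delta> J = canonical_map (matrix_algebra \<delta> J) (mat_u \<delta>)"


section \<open>Bounded operators and covariant representations\<close>

text \<open>\<open>'h \<Rightarrow>\<^sub>L 'h\<close> consists of the real-linear bounded operators; \<open>B(H)\<close> is the set of
  complex-linear ones, with the operator norm.\<close>

definition bounded_ops :: "('h::chilbert_space \<Rightarrow>\<^sub>L 'h) set" where
  "bounded_ops = {T. \<forall>c x. blinfun_apply T (c *\<^sub>C x) = c *\<^sub>C blinfun_apply T x}"

definition adj :: "('h::chilbert_space \<Rightarrow>\<^sub>L 'h) \<Rightarrow> ('h \<Rightarrow>\<^sub>L 'h)" where
  "adj T = (THE S. \<forall>x y. cinner (blinfun_apply T x) y = cinner x (blinfun_apply S y))"

definition scale_op :: "complex \<Rightarrow> ('h::chilbert_space \<Rightarrow>\<^sub>L 'h) \<Rightarrow> ('h \<Rightarrow>\<^sub>L 'h)" where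
  "scale_op c T = Blinfun (\<lambda>x. c *\<^sub>C blinfun_apply T x)"

definition op_power :: "('h::chilbert_space \<Rightarrow>\<^sub>L 'h) \<Rightarrow> nat \<Rightarrow> ('h \<Rightarrow>\<^sub>L 'h)" where
  "op_power T n = ((\<lambda>S. T o\<^sub>L S) ^^ n) id_blinfun"

definition op_algebra :: "('h::chilbert_space \<Rightarrow>\<^sub>L 'h) set \<Rightarrow> ('h \<Rightarrow>\<^sub>L 'h) star_algebra" where
  "op_algebra S = \<lparr>alg_carrier = S, alg_add = (+), alg_mult = (o\<^sub>L), alg_scale = scale_op,
     alg_star = adj, alg_norm = norm\<rparr>"

definition cstar_subalgebra :: "('h::chilbert_space \<Rightarrow>\<^sub>L 'h) set \<Rightarrow> bool" where
  "cstar_subalgebra S \<longleftrightarrow> S \<subseteq> bounded_ops \<and> closed S \<and> 0 \<in> S \<and>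
     (\<forall>T\<in>S. \<forall>R\<in>S. T + R \<in> S \<and> T o\<^sub>L R \<in> S) \<and>
     (\<forall>c. \<forall>T\<in>S. scale_op c T \<in> S) \<and> (\<forall>T\<in>S. adj T \<in> S)"

definition generated_cstar :: "('h::chilbert_space \<Rightarrow>\<^sub>L 'h) set \<Rightarrow> ('h \<Rightarrow>\<^sub>L 'h) set" where
  "generated_cstar G = \<Inter>{S. cstar_subalgebra S \<and> G \<subseteq> S}"

definition partial_isometry :: "('h::chilbert_space \<Rightarrow>\<^sub>L 'h) \<Rightarrow> bool" where
  "partial_isometry U \<longleftrightarrow> U \<in> bounded_ops \<and> U o\<^sub>L adj U o\<^sub>L U = U"

text \<open>Non-degeneracy uses the real span, which equals the complex one because the range of a
  complex-linear \<open>\<pi>\<close> is closed under complex scalars.\<close>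

definition covariant_rep ::
  "('a::unital_cstar_algebra \<Rightarrow> 'a) \<Rightarrow> ('a \<Rightarrow> ('h::chilbert_space \<Rightarrow>\<^sub>L 'h)) \<Rightarrow> ('h \<Rightarrow>\<^sub>L 'h) \<Rightarrow> bool" where
  "covariant_rep \<delta> \<pi> U \<longleftrightarrow>
     star_hom type_algebra (op_algebra bounded_ops) \<pi> \<and>
     inj \<pi> \<and>
     closure (span {blinfun_apply (\<pi> a) h | a h. True}) = UNIV \<and>
     partial_isometry U \<and>
     (\<forall>a. U o\<^sub>L \<pi> a o\<^sub>L adj U = \<pi> (\<delta> a)) \<and>
     (\<forall>a. (adj U o\<^sub>L U) o\<^sub>L \<pi> a = \<pi> a o\<^sub>L (adj U o\<^sub>L U))"

definition associated_with ::
  "('a::unital_cstar_algebra \<Rightarrow> ('h::chilbert_space \<Rightarrow>\<^sub>L 'h)) \<Rightarrow> ('h \<Rightarrow>\<^sub>L 'h) \<Rightarrow> 'a set \<Rightarrow> bool" where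
  "associated_with \<pi> U J \<longleftrightarrow> J = {a. adj U o\<^sub>L U o\<^sub>L \<pi> a = \<pi> a}"

definition property_star ::
  "('a::unital_cstar_algebra \<Rightarrow> 'a) \<Rightarrow> ('a \<Rightarrow> ('h::chilbert_space \<Rightarrow>\<^sub>L 'h)) \<Rightarrow> ('h \<Rightarrow>\<^sub>L 'h) \<Rightarrow> bool" where
  "property_star \<delta> \<pi> U \<longleftrightarrow> (\<forall>a\<in>matrices \<delta>.
     norm (\<Sum>m. op_power (adj U) m o\<^sub>L \<pi> (a m m) o\<^sub>L op_power U m)
     \<le> norm (\<Sum>m. \<Sum>n. op_power (adj U) m o\<^sub>L \<pi> (a m n) o\<^sub>L op_power U n))"

end

theory Submission
  imports Defs "HOL-Computational_Algebra.Polynomial" "HOL-Library.Function_Algebras"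
begin

text \<open>
  Write \<open>M\<close> for the matrix algebra and put \<open>Phi a = (\<Sum>m n. U*^m \<pi>(a m n) U^n)\<close>. This is a *-representation of
  \<open>M\<close>, and the theorem compares the C*-seminorm \<open>norm (Phi a)\<close> with the largest C*-seminorm \<open>P\<close> that is
  dominated by the given seminorm on \<open>M\<close>; the crossed product is the completion of \<open>M\<close> for \<open>P\<close>.

  The comparison rests on an exact formula for diagonal elements. Since \<open>Q = U*U\<close> is a projection
  commuting with \<open>\<pi>(A)\<close>, the norm of an operator \<open>T\<close> that commutes with \<open>Q\<close> is the maximum of
  \<open>norm ((1 - Q) T)\<close> and \<open>norm (U T U*)\<close>. Applied to a diagonal sum, the first number is the distance of
  its zeroth entry to \<open>J\<close>, and the second is the norm of a diagonal sum that is one term shorter. By induction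
  the norm is exactly the maximum of distances that defines the seminorm (\<open>norm_diag_op\<close>). Hence \<open>Phi\<close> is
  dominated by the seminorm, so it extends to the completion, and \<open>P a = norm (Phi a)\<close> for diagonal \<open>a\<close>.

  If property (*) holds, write \<open>a\<close> as the sum of its diagonals \<open>c_k\<close>, of which there are at most
  \<open>2N + 1\<close>. Each product \<open>c_k* c_k\<close> is diagonal, so \<open>P c_k = norm (Phi c_k)\<close>, and (*) applied to
  \<open>a a*\<close> gives \<open>norm (Phi c_k) \<le> norm (Phi a)\<close>. Thus \<open>P a \<le> (2N + 1) norm (Phi a)\<close>, and since
  the number of diagonals of the powers \<open>(a* a)^(2^n)\<close> grows only linearly in the exponent, the factor disappears
  after taking roots (\<open>P_le_norm_Phi\<close>). Conversely, the diagonal part is an average of the gauge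
  automorphisms \<open>a m n \<mapsto> z^(n-m) a m n\<close> with \<open>z\<close> a root of unity; these preserve \<open>P\<close>, so the
  diagonal part is always a \<open>P\<close>-contraction (\<open>P_diag_part_le\<close>), and (*) follows as soon as \<open>Phi\<close> is
  isometric for \<open>P\<close>.

  Four standard facts are needed along the way: the distance to the kernel of a *-homomorphism is the norm of the
  image, injective *-homomorphisms are isometric, the range of a *-homomorphism is closed, and
  *-homomorphisms are contractive. The first three are consequences of one lifting statement
  (\<open>approximate_lifting\<close>): if \<open>p\<close> and \<open>q\<close> are C*-seminorms and \<open>q x < r\<close>, then there is a
  \<open>p\<close>-Cauchy sequence of norm at most \<open>r\<close> which \<open>q\<close> cannot distinguish in the limit from \<open>x\<close>.
  It is obtained by cutting \<open>x\<close> off with polynomials in \<open>x* x\<close>, so it only needs the bound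
  \<open>p (g h) \<le> sup |g|\<close> for real polynomials \<open>g\<close> and self-adjoint \<open>h\<close>. That bound comes
  from an expansion in Chebyshev polynomials. The fourth fact follows from the
  geometric series and the observation that a self-adjoint operator \<open>T\<close> has \<open>(norm T)^2\<close> in the
  spectrum of \<open>T^2\<close> (\<open>no_left_inverse_at_norm\<close>).
\<close>

section \<open>Real polynomials in a self-adjoint element\<close>

text \<open>The power trick: for a C*-seminorm, a bound with a factor growing polynomially in the exponent improves to the
  bound without the factor, because \<open>2^n\<close>-th roots of the factor tend to 1.\<close>

lemma power_trick_le:
  fixes a K C D :: real
  assumes "0 \<le> a" "0 \<le> K"
    and growth: "\<And>n. a ^ (2 ^ n) \<le> (C * 2 ^ n + D) * K ^ (2 ^ n)"
  shows "a \<le> K"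
proof (rule ccontr)
  assume "\<not> a \<le> K"
  then have "K < a" and "0 < a" using assms by auto
  define x where "x = K / a"
  have x: "0 \<le> x" "x < 1" using \<open>K < a\<close> \<open>0 < a\<close> \<open>0 \<le> K\<close> by (auto simp: x_def)
  have "(\<lambda>n. C * (real n * x ^ n) + D * x ^ n) \<longlonglongrightarrow> C * 0 + D * 0"
    using x powser_times_n_limit_0[of x] LIMSEQ_power_zero[of x]
    by (intro tendsto_intros) auto
  then have "(\<lambda>n. (C * real n + D) * x ^ n) \<longlonglongrightarrow> 0"
    by (simp add: algebra_simps)
  from LIMSEQ_subseq_LIMSEQ[OF this, of "\<lambda>n. 2 ^ n"]
  have lim: "(\<lambda>n. (C * 2 ^ n + D) * x ^ (2 ^ n)) \<longlonglongrightarrow> 0"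
    by (simp add: strict_mono_def o_def)
  have "1 \<le> (C * 2 ^ n + D) * x ^ (2 ^ n)" for n
    using growth[of n] \<open>0 < a\<close> by (simp add: x_def power_divide field_simps)
  then have "(1::real) \<le> 0"
    using tendsto_lowerbound[OF lim, of 1] by simp
  then show False by simp
qed

lemma squeeze_to_0:
  fixes f g :: "nat \<Rightarrow> real"
  assumes "\<And>n. 0 \<le> f n" "\<And>n. f n \<le> g n" "g \<longlonglongrightarrow> 0"
  shows "f \<longlonglongrightarrow> 0"
  using assms by (intro tendsto_sandwich[OF _ _ tendsto_const[of 0] assms(3)] always_eventually) auto

lemma sum_cis_roots_of_unity:
  fixes m :: int
  assumes "0 < M"
  shows "(\<Sum>l<M. cis (2 * pi * of_int m * real l / real M)) = (if int M dvd m then of_nat M else 0)"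
proof -
  define z where "z = cis (2 * pi * of_int m / real M)"
  have pow: "cis (2 * pi * of_int m * real l / real M) = z ^ l" for l
    unfolding z_def Complex.DeMoivre by (rule arg_cong[where f = cis]) simp
  have zM: "z ^ M = 1"
    using assms cis_multiple_2pi[of "real_of_int m"] by (simp add: z_def Complex.DeMoivre mult.assoc)
  show ?thesis
  proof (cases "int M dvd m")
    case True
    then obtain q where "m = int M * q" by blast
    then have "z = 1" using assms cis_multiple_2pi[of "real_of_int q"] by (simp add: z_def mult.assoc)
    then show ?thesis using True by (simp add: pow)
  next
    case False
    have "z \<noteq> 1"
    proof
      assume "z = 1"
      then have "cos (2 * pi * of_int m / real M) = 1" by (simp add: z_def complex_eq_iff)
      then obtain q :: int where "2 * pi * of_int m / real M = of_int q * 2 * pi"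
        using cos_one_2pi_int by metis
      then have "of_int m = (of_int q * of_nat M :: real)" using assms by (simp add: field_simps)
      then have "m = q * int M"
        by (metis of_int_eq_iff of_int_mult of_int_of_nat_eq)
      with False show False by simp
    qed
    then show ?thesis using False zM by (simp add: pow geometric_sum)
  qed
qed

fun cheb :: "nat \<Rightarrow> real poly" where
  "cheb 0 = 1"
| "cheb (Suc 0) = [:0, 1:]"
| "cheb (Suc (Suc k)) = smult 2 ([:0, 1:] * cheb (Suc k)) - cheb k"

lemma poly_cheb_cos: "poly (cheb k) (cos x) = cos (real k * x)"
proof (induction k rule: cheb.induct)
  case (3 k)
  have "cos (real (Suc (Suc k)) * x) + cos (real k * x) = 2 * (cos x * cos (real (Suc k) * x))"
    using cos_times_cos[of x "real (Suc k) * x"] cos_minus[of "real k * x"]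
    by (simp add: algebra_simps)
  with 3 show ?case by simp
qed auto

lemma coeff_cheb: "(\<forall>i>k. coeff (cheb k) i = 0) \<and> 0 < coeff (cheb k) k"
proof (induction k rule: cheb.induct)
  case (3 k)
  then show ?case by (auto simp: coeff_pCons split: nat.split)
qed (auto simp: coeff_pCons split: nat.split)

lemma cheb_expansion: "degree g \<le> d \<Longrightarrow> \<exists>c. g = (\<Sum>k\<le>d. smult (c k) (cheb k))"
proof (induction d arbitrary: g)
  case 0
  then obtain a where "g = [:a:]" by (metis degree_0_id le_zero_eq)
  then show ?case by (intro exI[of _ "\<lambda>_. a"]) simp
next
  case (Suc d)
  define b where "b = coeff g (Suc d) / coeff (cheb (Suc d)) (Suc d)"
  have "degree (g - smult b (cheb (Suc d))) \<le> d"
  proof (rule degree_le, intro allI impI)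
    fix i assume "d < i"
    show "coeff (g - smult b (cheb (Suc d))) i = 0"
    proof (cases "i = Suc d")
      case True
      then show ?thesis using coeff_cheb[of "Suc d"] by (simp add: b_def)
    next
      case False
      then show ?thesis using coeff_cheb[of "Suc d"] \<open>d < i\<close> Suc.prems by (simp add: coeff_eq_0)
    qed
  qed
  from Suc.IH[OF this] obtain c where c: "g - smult b (cheb (Suc d)) = (\<Sum>k\<le>d. smult (c k) (cheb k))"
    by blast
  have "g = (\<Sum>k\<le>Suc d. smult ((c(Suc d := b)) k) (cheb k))"
    using c by (simp add: algebra_simps)
  then show ?case by blast
qed

text \<open>Substituting \<open>s = cos x\<close> turns the expansion into a cosine sum. Its coefficients are recovered by
  averaging over the \<open>M\<close>-th roots of unity, and \<open>M = 2 d + 1\<close> points suffice to separate the frequencies up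
  to \<open>d\<close>.\<close>

lemma cheb_coefficient_bound:
  assumes g: "g = (\<Sum>k\<le>d. smult (c k) (cheb k))"
    and K: "\<And>s. \<bar>s\<bar> \<le> 1 \<Longrightarrow> \<bar>poly g s\<bar> \<le> K"
    and k: "k \<le> d"
  shows "\<bar>c k\<bar> \<le> 2 * K"
proof -
  define M where "M = 2 * d + 1"
  have M: "0 < M" "2 * d < M" by (auto simp: M_def)
  define th where "th l = 2 * pi * real l / real M" for l
  have sumcos: "(\<Sum>l<M. cos (of_int m * th l)) = (if int M dvd m then real M else 0)" for m :: int
  proof -
    have "(\<Sum>l<M. cos (of_int m * th l)) = Re (\<Sum>l<M. cis (2 * pi * of_int m * real l / real M))"
      by (simp add: th_def mult.assoc) (simp add: algebra_simps)
    then show ?thesis using sum_cis_roots_of_unity[OF M(1), of m] by simp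
  qed
  have cc: "(\<Sum>l<M. cos (real j * th l) * cos (real k * th l))
      = ((if int M dvd (int j - int k) then real M else 0) + (if int M dvd (int j + int k) then real M else 0)) / 2" for j
  proof -
    have "cos (real j * th l) * cos (real k * th l)
        = (cos (of_int (int j - int k) * th l) + cos (of_int (int j + int k) * th l)) / 2" for l
      by (simp add: cos_times_cos algebra_simps)
    then show ?thesis
      by (simp only: sum_divide_distrib[symmetric] sum.distrib sumcos)
  qed
  have ortho: "(\<Sum>l<M. cos (real j * th l) * cos (real k * th l)) = 0" if "j \<le> d" "j \<noteq> k" for j
  proof -
    have "\<not> int M dvd (int j - int k)"
      using that k M zdvd_not_zless[of "int j - int k" "int M"] zdvd_not_zless[of "int k - int j" "int M"]
        dvd_diff_commute[of "int M" "int j" "int k"] by (cases "j < k") auto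
    moreover have "\<not> int M dvd (int j + int k)"
      using that k M zdvd_not_zless[of "int j + int k" "int M"] by auto
    ultimately show ?thesis by (simp add: cc)
  qed
  have diag: "real M / 2 \<le> (\<Sum>l<M. cos (real k * th l) * cos (real k * th l))"
    by (simp add: cc)
  have "(\<Sum>l<M. poly g (cos (th l)) * cos (real k * th l))
      = (\<Sum>l<M. \<Sum>j\<le>d. c j * (cos (real j * th l) * cos (real k * th l)))"
    by (simp add: g poly_sum poly_cheb_cos sum_distrib_right mult.assoc)
  also have "\<dots> = (\<Sum>j\<le>d. c j * (\<Sum>l<M. cos (real j * th l) * cos (real k * th l)))"
    by (subst sum.swap) (simp add: sum_distrib_left)
  also have "\<dots> = (\<Sum>j\<in>{k}. c j * (\<Sum>l<M. cos (real j * th l) * cos (real k * th l)))"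
    using k ortho by (intro sum.mono_neutral_right) auto
  finally have eq: "c k * (\<Sum>l<M. cos (real k * th l) * cos (real k * th l))
      = (\<Sum>l<M. poly g (cos (th l)) * cos (real k * th l))" by simp
  have "\<bar>c k\<bar> * (real M / 2) \<le> \<bar>c k\<bar> * (\<Sum>l<M. cos (real k * th l) * cos (real k * th l))"
    using diag by (intro mult_left_mono) auto
  also have "\<dots> = \<bar>\<Sum>l<M. poly g (cos (th l)) * cos (real k * th l)\<bar>"
    using diag by (simp add: eq[symmetric] abs_mult)
  also have "\<dots> \<le> (\<Sum>l<M. K * 1)"
  proof (intro order.trans[OF sum_abs] sum_mono)
    fix l
    have "\<bar>poly g (cos (th l))\<bar> * \<bar>cos (real k * th l)\<bar> \<le> K * 1"
      using K[of 0] by (intro mult_mono K) auto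
    then show "\<bar>poly g (cos (th l)) * cos (real k * th l)\<bar> \<le> K * 1" by (simp add: abs_mult)
  qed
  finally show ?thesis using M by (simp add: field_simps)
qed

text \<open>The polynomials \<open>1 - sqrt_iter n\<close> approximate \<open>sqrt (1 - t\<^sup>2)\<close>: a fixed point \<open>y\<close> of
  the iteration satisfies \<open>(1 - y)\<^sup>2 = 1 - t\<^sup>2\<close>. All coefficients of \<open>sqrt_iter n\<close> are non-negative and
  increase with \<open>n\<close>, so a seminorm with \<open>N t \<le> 1\<close> is controlled by values at the single point 1.\<close>

fun sqrt_iter :: "nat \<Rightarrow> real poly" where
  "sqrt_iter 0 = 0"
| "sqrt_iter (Suc n) = smult (1/2) ([:0, 1:] * [:0, 1:] + sqrt_iter n * sqrt_iter n)"

lemma nonneg_coeff_mult: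
  fixes f g :: "real poly"
  assumes "\<And>i. 0 \<le> coeff f i" "\<And>i. 0 \<le> coeff g i"
  shows "0 \<le> coeff (f * g) i"
  using assms by (auto simp: coeff_mult intro!: sum_nonneg)

lemma coeff_sqrt_iter_nonneg: "0 \<le> coeff (sqrt_iter n) i"
proof (induction n arbitrary: i)
  case (Suc n)
  have "0 \<le> coeff ([:0, 1:] * [:0, 1::real:]) i"
    by (intro nonneg_coeff_mult) (auto simp: coeff_pCons split: nat.split)
  moreover have "0 \<le> coeff (sqrt_iter n * sqrt_iter n) i"
    using Suc by (intro nonneg_coeff_mult)
  ultimately show ?case by (simp del: mult_pCons_left mult_pCons_right)
qed simp

lemma coeff_sqrt_iter_mono: "0 \<le> coeff (sqrt_iter (Suc n) - sqrt_iter n) i"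
proof (induction n arbitrary: i)
  case 0
  then show ?case using coeff_sqrt_iter_nonneg[of "Suc 0" i] by simp
next
  case (Suc n)
  have "sqrt_iter (Suc (Suc n)) - sqrt_iter (Suc n)
      = smult (1/2) ((sqrt_iter (Suc n) - sqrt_iter n) * (sqrt_iter (Suc n) + sqrt_iter n))"
    unfolding sqrt_iter.simps(2)[of "Suc n"]
    by (subst (4) sqrt_iter.simps(2)) (simp add: algebra_simps smult_diff_right[symmetric] smult_add_right[symmetric])
  then show ?case
    using nonneg_coeff_mult[of "sqrt_iter (Suc n) - sqrt_iter n" "sqrt_iter (Suc n) + sqrt_iter n" i]
      Suc.IH coeff_sqrt_iter_nonneg by (simp del: sqrt_iter.simps)
qed

lemma sqrt_iter_at_1: "0 \<le> poly (sqrt_iter n) 1 \<and> poly (sqrt_iter n) 1 \<le> 1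
    \<and> poly (sqrt_iter n) 1 \<le> poly (sqrt_iter (Suc n)) 1"
proof (induction n)
  case (Suc n)
  let ?r = "poly (sqrt_iter n) 1"
  have "?r * ?r \<le> 1" using Suc by (simp add: mult_le_one)
  moreover have "?r * ?r \<le> poly (sqrt_iter (Suc n)) 1 * poly (sqrt_iter (Suc n)) 1"
    using Suc by (intro mult_mono) auto
  ultimately show ?case using Suc by simp
qed simp

lemma sqrt_iter_gap_tendsto_0:
  "(\<lambda>n. poly (sqrt_iter (Suc n) - sqrt_iter n) 1) \<longlonglongrightarrow> 0"
proof -
  have "incseq (\<lambda>n. poly (sqrt_iter n) 1)" using sqrt_iter_at_1 by (intro incseq_SucI) blast
  then obtain L where L: "(\<lambda>n. poly (sqrt_iter n) 1) \<longlonglongrightarrow> L"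
    using incseq_convergent[of "\<lambda>n. poly (sqrt_iter n) 1" 1] sqrt_iter_at_1 by blast
  show ?thesis
    using tendsto_diff[OF LIMSEQ_Suc[OF L] L] by (simp del: sqrt_iter.simps)
qed

text \<open>Real and imaginary part of \<open>(t + \<i> s) ^ k\<close>.\<close>

primrec cpow :: "real poly \<Rightarrow> nat \<Rightarrow> real poly \<times> real poly" where
  "cpow s 0 = (1, 0)"
| "cpow s (Suc k) = ([:0, 1:] * fst (cpow s k) - s * snd (cpow s k), s * fst (cpow s k) + [:0, 1:] * snd (cpow s k))"

lemma cpow_modulus:
  "fst (cpow s k) * fst (cpow s k) + snd (cpow s k) * snd (cpow s k) = ([:0, 1:] * [:0, 1:] + s * s) ^ k"
proof (induction k)
  case (Suc k)
  have alg: "(t * a - s * b) * (t * a - s * b) + (s * a + t * b) * (s * a + t * b) = (t * t + s * s) * (a * a + b * b)"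
    for t a b :: "real poly" by (simp add: algebra_simps)
  show ?case unfolding cpow.simps fst_conv snd_conv alg Suc power_Suc by (simp only:)
qed simp

lemma fst_cpow_Suc_Suc:
  "fst (cpow s (Suc (Suc k))) = smult 2 ([:0, 1:] * fst (cpow s (Suc k))) - ([:0, 1:] * [:0, 1:] + s * s) * fst (cpow s k)"
proof -
  have alg: "t * (t * a - s * b) - s * (s * a + t * b) = (t * (t * a - s * b) + t * (t * a - s * b)) - (t * t + s * s) * a"
    for t a b :: "real poly" by (simp add: algebra_simps)
  have two: "smult 2 p = p + p" for p :: "real poly" by (simp only: poly_eq_iff coeff_smult coeff_add) simp
  show ?thesis unfolding cpow.simps fst_conv snd_conv alg two by (simp only:)
qed

text \<open>The properties of \<open>g \<mapsto> p (g h)\<close> for a C*-seminorm \<open>p\<close> and a self-adjoint \<open>h\<close>. The last one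
  carries the complex structure: on real polynomials it replaces \<open>p (f h) \<le> p (f h + \<i> g h)\<close>. Without it,
  evaluation at the complex number \<open>\<i>\<close> would be an example that violates the bound by the supremum.\<close>

locale real_poly_cstar_seminorm =
  fixes N :: "real poly \<Rightarrow> real"
  assumes N_nonneg: "0 \<le> N f"
    and N_add: "N (f + g) \<le> N f + N g"
    and N_smult: "N (smult c f) = \<bar>c\<bar> * N f"
    and N_mult: "N (f * g) \<le> N f * N g"
    and N_square: "N (f * f) = (N f)\<^sup>2"
    and N_sum_squares: "(N f)\<^sup>2 \<le> N (f * f + g * g)"
begin

lemma N_diff: "N (f - g) \<le> N f + N g"
  using N_add[of f "smult (-1) g"] N_smult[of "-1" g] by simp

lemma N_one: "N 1 \<le> 1"
proof -
  have "N 1 = N 1 * N 1" using N_square[of 1] by (simp add: power2_eq_square)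
  then show ?thesis by (metis mult_cancel_left1 order_refl zero_le_one)
qed

lemma N_zero: "N 0 = 0"
  using N_smult[of 0 0] by simp

lemma N_power: "N f \<le> K \<Longrightarrow> N (f ^ k) \<le> K ^ k"
proof (induction k)
  case (Suc k)
  then show ?case using N_mult[of f "f ^ k"] N_nonneg
    by (auto intro: order.trans[OF _ mult_mono] simp: order.trans[OF N_nonneg])
qed (simp add: N_one)

lemma N_square_power: "N (f ^ (2 ^ n)) = N f ^ (2 ^ n)"
proof (induction n)
  case (Suc n)
  have "f ^ (2 ^ Suc n) = f ^ (2 ^ n) * f ^ (2 ^ n)"
    by (simp add: power_add mult_2)
  then show ?case using Suc by (simp add: N_square power2_eq_square power_add mult_2)
qed simp

lemma N_le_poly_1:
  assumes "N [:0, 1:] \<le> 1" "\<And>i. 0 \<le> coeff f i"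
  shows "N f \<le> poly f 1"
  using assms(2)
proof (induction f)
  case 0
  then show ?case by (simp add: N_zero)
next
  case (pCons a q)
  have a: "0 \<le> a" using pCons.prems[of 0] by simp
  have q: "N q \<le> poly q 1" using pCons.IH pCons.prems[of "Suc _"] by simp
  have eq: "pCons a q = smult a 1 + [:0, 1:] * q" by simp
  have "N (pCons a q) \<le> \<bar>a\<bar> * N 1 + N [:0, 1:] * N q"
    unfolding eq N_smult[symmetric] by (rule order.trans[OF N_add add_left_mono[OF N_mult]])
  also have "\<dots> \<le> \<bar>a\<bar> * 1 + 1 * N q"
    using assms(1) N_one N_nonneg by (intro add_mono mult_mono) auto
  finally show ?case using a q by simp
qed

text \<open>With \<open>s = sqrt (1 - t\<^sup>2)\<close> the element \<open>t + \<i> s\<close> is unitary and the \<open>k\<close>-th Chebyshev polynomial is the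
  real part of its \<open>k\<close>-th power, whence the bound. As \<open>s\<close> is only available as a limit of polynomials, the
  argument is carried out for \<open>s = 1 - sqrt_iter n\<close>, where \<open>t\<^sup>2 + s\<^sup>2 = 1 + D n\<close> with an
  error \<open>D n\<close> that tends to 0.\<close>

lemma N_cheb_le_1:
  assumes t: "N [:0, 1:] \<le> 1"
  shows "N (cheb k) \<le> 1"
proof -
  define D where "D n = smult 2 (sqrt_iter (Suc n) - sqrt_iter n)" for n
  define e where "e n = poly (D n) 1" for n
  have e0: "e \<longlonglongrightarrow> 0"
    unfolding e_def D_def using tendsto_mult_left[OF sqrt_iter_gap_tendsto_0, of 2] by simp
  have ND: "N (D n) \<le> e n" for n
    unfolding e_def by (rule N_le_poly_1[OF t]) (use coeff_sqrt_iter_mono in \<open>simp add: D_def del: sqrt_iter.simps\<close>)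
  have e_nonneg: "0 \<le> e n" for n using ND[of n] N_nonneg[of "D n"] by linarith
  define V where "V n k = fst (cpow (1 - sqrt_iter n) k)" for n k
  have circle: "[:0, 1:] * [:0, 1:] + (1 - sqrt_iter n) * (1 - sqrt_iter n) = 1 + D n" for n
  proof -
    have "smult 2 (sqrt_iter (Suc n)) = [:0, 1:] * [:0, 1:] + sqrt_iter n * sqrt_iter n" by simp
    moreover have "smult 2 p = p + p" for p :: "real poly" by (simp only: poly_eq_iff coeff_smult coeff_add) simp
    ultimately show ?thesis unfolding D_def smult_diff_right by (simp add: algebra_simps)
  qed
  have NV: "N (V n k) \<le> sqrt ((1 + e n) ^ k)" for n k
  proof (rule real_le_rsqrt)
    have "(N (V n k))\<^sup>2 \<le> N ((1 + D n) ^ k)"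
      using N_sum_squares[of "fst (cpow (1 - sqrt_iter n) k)" "snd (cpow (1 - sqrt_iter n) k)"]
      unfolding V_def cpow_modulus circle by blast
    also have "\<dots> \<le> (1 + e n) ^ k"
      using N_add[of 1 "D n"] N_one ND[of n] by (intro N_power) linarith
    finally show "(N (V n k))\<^sup>2 \<le> (1 + e n) ^ k" .
  qed
  have NV_lim: "(\<lambda>n. sqrt ((1 + e n) ^ k)) \<longlonglongrightarrow> 1" for k
    using tendsto_real_sqrt[OF tendsto_power[OF tendsto_add[OF tendsto_const[of 1] e0]], of k] by simp
  have conv: "(\<lambda>n. N (cheb k - V n k)) \<longlonglongrightarrow> 0" for k
  proof (induction k rule: cheb.induct)
    case 1
    then show ?case by (simp add: V_def N_zero)
  next
    case 2
    then show ?case by (simp add: V_def N_zero)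
  next
    case (3 k)
    have rec: "V n (Suc (Suc k)) = smult 2 ([:0, 1:] * V n (Suc k)) - (1 + D n) * V n k" for n
      unfolding V_def fst_cpow_Suc_Suc circle ..
    have "N (cheb (Suc (Suc k)) - V n (Suc (Suc k)))
        \<le> 2 * N (cheb (Suc k) - V n (Suc k)) + N (cheb k - V n k) + e n * sqrt ((1 + e n) ^ k)" for n
    proof -
      have eq: "cheb (Suc (Suc k)) - V n (Suc (Suc k))
          = smult 2 ([:0, 1:] * (cheb (Suc k) - V n (Suc k))) - (cheb k - V n k) + D n * V n k"
        unfolding rec cheb.simps(3) smult_diff_right right_diff_distrib by (simp add: algebra_simps)
      have "N (cheb (Suc (Suc k)) - V n (Suc (Suc k)))
          \<le> N (smult 2 ([:0, 1:] * (cheb (Suc k) - V n (Suc k)))) + N (cheb k - V n k) + N (D n * V n k)"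
        unfolding eq by (rule order.trans[OF N_add add_right_mono[OF N_diff]])
      also have "N (smult 2 ([:0, 1:] * (cheb (Suc k) - V n (Suc k)))) = 2 * N ([:0, 1:] * (cheb (Suc k) - V n (Suc k)))"
        by (simp only: N_smult abs_numeral)
      also have "2 * N ([:0, 1:] * (cheb (Suc k) - V n (Suc k))) + N (cheb k - V n k) + N (D n * V n k)
          \<le> 2 * N (cheb (Suc k) - V n (Suc k)) + N (cheb k - V n k) + e n * sqrt ((1 + e n) ^ k)"
      proof (intro add_mono mult_left_mono order_refl)
        show "N ([:0, 1:] * (cheb (Suc k) - V n (Suc k))) \<le> N (cheb (Suc k) - V n (Suc k))"
          using order.trans[OF N_mult mult_right_mono[OF t N_nonneg]] by (metis mult_1_left)
        show "N (D n * V n k) \<le> e n * sqrt ((1 + e n) ^ k)"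
          using N_mult[of "D n" "V n k"] ND NV N_nonneg e_nonneg by (meson mult_mono order.trans)
      qed simp
      finally show ?thesis .
    qed
    note bound = this
    have "(\<lambda>n. 2 * N (cheb (Suc k) - V n (Suc k)) + N (cheb k - V n k) + e n * sqrt ((1 + e n) ^ k))
        \<longlonglongrightarrow> 2 * 0 + 0 + 0 * 1"
      by (intro tendsto_add tendsto_mult tendsto_const 3 e0 NV_lim)
    then have lim: "(\<lambda>n. 2 * N (cheb (Suc k) - V n (Suc k)) + N (cheb k - V n k) + e n * sqrt ((1 + e n) ^ k))
        \<longlonglongrightarrow> 0" by (simp only: mult_zero_right mult_zero_left add_0)
    show ?case by (rule squeeze_to_0[OF N_nonneg bound lim])
  qed
  have "N (cheb k) \<le> N (cheb k - V n k) + sqrt ((1 + e n) ^ k)" for n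
    using N_add[of "cheb k - V n k" "V n k"] NV[of n k] by simp
  moreover have "(\<lambda>n. N (cheb k - V n k) + sqrt ((1 + e n) ^ k)) \<longlonglongrightarrow> 0 + 1"
    by (intro tendsto_intros conv NV_lim)
  ultimately show ?thesis using LIMSEQ_le_const by fastforce
qed

lemma N_sum: "N (\<Sum>k\<in>A. f k) \<le> (\<Sum>k\<in>A. N (f k))"
proof (induction A rule: infinite_finite_induct)
  case (insert x A)
  then show ?case using N_add[of "f x" "\<Sum>k\<in>A. f k"] by simp
qed (auto simp: N_zero)

lemma N_le_degree_sup:
  assumes t: "N [:0, 1:] \<le> 1" and d: "degree g \<le> d"
    and K: "\<And>s. \<bar>s\<bar> \<le> 1 \<Longrightarrow> \<bar>poly g s\<bar> \<le> K"
  shows "N g \<le> (2 * real d + 2) * K"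
proof -
  from cheb_expansion[OF d] obtain c where c: "g = (\<Sum>k\<le>d. smult (c k) (cheb k))" by blast
  have "N g \<le> (\<Sum>k\<le>d. N (smult (c k) (cheb k)))" unfolding c by (rule N_sum)
  also have "\<dots> \<le> (\<Sum>k\<le>d. 2 * K * 1)"
    unfolding N_smult using cheb_coefficient_bound[OF c K] N_cheb_le_1[OF t]
    using K[of 0] by (intro sum_mono mult_mono) (auto simp: N_nonneg)
  also have "\<dots> = (2 * real d + 2) * K" by (simp add: algebra_simps)
  finally show ?thesis .
qed

text \<open>The Chebyshev expansion gives the bound up to a factor linear in the degree, which the power trick removes.\<close>

theorem N_le_sup:
  assumes t: "N [:0, 1:] \<le> 1"
    and K: "\<And>s. \<bar>s\<bar> \<le> 1 \<Longrightarrow> \<bar>poly g s\<bar> \<le> K"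
  shows "N g \<le> K"
proof (rule power_trick_le[where C = "2 * real (degree g)" and D = 2])
  show "0 \<le> K" using K[of 0] by simp
  fix n
  have "N (g ^ (2 ^ n)) \<le> (2 * real (degree g * 2 ^ n) + 2) * K ^ (2 ^ n)"
    by (rule N_le_degree_sup[OF t degree_power_le]) (auto simp: poly_power power_abs intro!: power_mono K)
  then show "N g ^ (2 ^ n) \<le> (2 * real (degree g) * 2 ^ n + 2) * K ^ (2 ^ n)"
    by (simp add: N_square_power algebra_simps)
qed (rule N_nonneg)

end

section \<open>Unital *-algebras with a C*-seminorm\<close>

text \<open>The underlying type carries the additive group, so that the vector space laws hold for all elements of the type
  and only the other laws are restricted to the carrier. Both instances below, C*-algebras and finitely supported matrices, live in such a type.\<close>

locale unital_star_algebra =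
  fixes B :: "('x::ab_group_add) star_algebra" and e :: 'x
  assumes add_eq_plus: "alg_add B = (+)"
    and zero_closed: "0 \<in> alg_carrier B"
    and plus_closed: "x \<in> alg_carrier B \<Longrightarrow> y \<in> alg_carrier B \<Longrightarrow> x + y \<in> alg_carrier B"
    and scale_closed: "x \<in> alg_carrier B \<Longrightarrow> alg_scale B c x \<in> alg_carrier B"
    and mult_closed: "x \<in> alg_carrier B \<Longrightarrow> y \<in> alg_carrier B \<Longrightarrow> alg_mult B x y \<in> alg_carrier B"
    and star_closed: "x \<in> alg_carrier B \<Longrightarrow> alg_star B x \<in> alg_carrier B"
    and unit_closed: "e \<in> alg_carrier B"
    and scale_add: "alg_scale B c (x + y) = alg_scale B c x + alg_scale B c y"
    and add_scale: "alg_scale B (c + d) x = alg_scale B c x + alg_scale B d x"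
    and scale_scale: "alg_scale B c (alg_scale B d x) = alg_scale B (c * d) x"
    and scale_1: "alg_scale B 1 x = x"
    and mult_assoc: "x \<in> alg_carrier B \<Longrightarrow> y \<in> alg_carrier B \<Longrightarrow> z \<in> alg_carrier B \<Longrightarrow>
      alg_mult B (alg_mult B x y) z = alg_mult B x (alg_mult B y z)"
    and mult_add_left: "x \<in> alg_carrier B \<Longrightarrow> y \<in> alg_carrier B \<Longrightarrow> z \<in> alg_carrier B \<Longrightarrow>
      alg_mult B (x + y) z = alg_mult B x z + alg_mult B y z"
    and mult_add_right: "x \<in> alg_carrier B \<Longrightarrow> y \<in> alg_carrier B \<Longrightarrow> z \<in> alg_carrier B \<Longrightarrow>
      alg_mult B z (x + y) = alg_mult B z x + alg_mult B z y"
    and mult_scale_left: "x \<in> alg_carrier B \<Longrightarrow> y \<in> alg_carrier B \<Longrightarrow>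
      alg_mult B (alg_scale B c x) y = alg_scale B c (alg_mult B x y)"
    and mult_scale_right: "x \<in> alg_carrier B \<Longrightarrow> y \<in> alg_carrier B \<Longrightarrow>
      alg_mult B x (alg_scale B c y) = alg_scale B c (alg_mult B x y)"
    and star_plus: "x \<in> alg_carrier B \<Longrightarrow> y \<in> alg_carrier B \<Longrightarrow>
      alg_star B (x + y) = alg_star B x + alg_star B y"
    and star_scale: "x \<in> alg_carrier B \<Longrightarrow> alg_star B (alg_scale B c x) = alg_scale B (cnj c) (alg_star B x)"
    and star_times: "x \<in> alg_carrier B \<Longrightarrow> y \<in> alg_carrier B \<Longrightarrow>
      alg_star B (alg_mult B x y) = alg_mult B (alg_star B y) (alg_star B x)"
    and star_involutive: "x \<in> alg_carrier B \<Longrightarrow> alg_star B (alg_star B x) = x"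
    and unit_left: "x \<in> alg_carrier B \<Longrightarrow> alg_mult B e x = x"
    and unit_right: "x \<in> alg_carrier B \<Longrightarrow> alg_mult B x e = x"
begin

abbreviation carr :: "'x set" where "carr \<equiv> alg_carrier B"
abbreviation mul :: "'x \<Rightarrow> 'x \<Rightarrow> 'x" (infixl \<open>\<odot>\<close> 70) where "x \<odot> y \<equiv> alg_mult B x y"
abbreviation scl :: "complex \<Rightarrow> 'x \<Rightarrow> 'x" where "scl c x \<equiv> alg_scale B c x"
abbreviation invol :: "'x \<Rightarrow> 'x" where "invol x \<equiv> alg_star B x"

lemma scale_zero_left [simp]: "scl 0 x = 0"
  using add_scale[of 0 0 x] by simp

lemma scale_zero_right [simp]: "scl c 0 = 0"
  using scale_add[of c 0 0] by simp

lemma scale_minus_one: "scl (-1) x = - x"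
  using add_scale[of 1 "-1" x] by (simp add: scale_1 eq_neg_iff_add_eq_0 add.commute)

lemma alg_diff_eq_minus: "alg_diff B x y = x - y"
  by (simp add: alg_diff_def add_eq_plus scale_minus_one)

lemma scale_minus_right: "scl c (- x) = - scl c x"
  using scale_add[of c x "- x"] by (simp add: eq_neg_iff_add_eq_0 add.commute)

lemma scale_diff: "scl c (x - y) = scl c x - scl c y"
  using scale_add[of c x "- y"] by (simp add: scale_minus_right)

lemma minus_closed: "x \<in> carr \<Longrightarrow> - x \<in> carr"
  using scale_closed[of x "-1"] by (simp add: scale_minus_one)

lemma diff_closed: "x \<in> carr \<Longrightarrow> y \<in> carr \<Longrightarrow> x - y \<in> carr"
  using plus_closed[of x "- y"] by (simp add: minus_closed)

lemmas closed = zero_closed plus_closed scale_closed mult_closed star_closed unit_closed minus_closed diff_closed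

lemma mult_zero_left: "x \<in> carr \<Longrightarrow> 0 \<odot> x = 0"
  using mult_scale_left[of 0 x 0] by (simp add: zero_closed)

lemma mult_zero_right: "x \<in> carr \<Longrightarrow> x \<odot> 0 = 0"
  using mult_scale_right[of x 0 0] by (simp add: zero_closed)

lemma mult_minus_left: "x \<in> carr \<Longrightarrow> y \<in> carr \<Longrightarrow> (- x) \<odot> y = - (x \<odot> y)"
  using mult_scale_left[of x y "-1"] by (simp add: scale_minus_one)

lemma mult_minus_right: "x \<in> carr \<Longrightarrow> y \<in> carr \<Longrightarrow> x \<odot> (- y) = - (x \<odot> y)"
  using mult_scale_right[of x y "-1"] by (simp add: scale_minus_one)

lemma mult_diff_left: "x \<in> carr \<Longrightarrow> y \<in> carr \<Longrightarrow> z \<in> carr \<Longrightarrow> (x - y) \<odot> z = x \<odot> z - y \<odot> z"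
  using mult_add_left[of x "- y" z] by (simp add: closed mult_minus_left)

lemma mult_diff_right: "x \<in> carr \<Longrightarrow> y \<in> carr \<Longrightarrow> z \<in> carr \<Longrightarrow> z \<odot> (x - y) = z \<odot> x - z \<odot> y"
  using mult_add_right[of x "- y" z] by (simp add: closed mult_minus_right)

lemma star_zero: "invol 0 = 0"
  using star_scale[of 0 0] by (simp add: zero_closed)

lemma star_minus: "x \<in> carr \<Longrightarrow> invol (- x) = - invol x"
  using star_scale[of x "-1"] by (simp add: scale_minus_one closed)

lemma star_diff: "x \<in> carr \<Longrightarrow> y \<in> carr \<Longrightarrow> invol (x - y) = invol x - invol y"
  using star_plus[of x "- y"] by (simp add: star_minus closed)

lemma star_unit: "invol e = e"
  using star_times[of e "invol e"] by (simp add: closed star_involutive unit_left unit_right)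

lemmas expand = mult_add_left mult_add_right mult_diff_left mult_diff_right mult_scale_left mult_scale_right
  scale_add scale_diff unit_left unit_right

subsection \<open>Evaluation of real polynomials\<close>

definition ev :: "'x \<Rightarrow> real poly \<Rightarrow> 'x" where
  "ev h g = fold_coeffs (\<lambda>a y. scl (of_real a) e + h \<odot> y) g 0"

lemma ev_0 [simp]: "ev h 0 = 0"
  by (simp add: ev_def)

lemma ev_pCons:
  assumes "h \<in> carr"
  shows "ev h (pCons a g) = scl (of_real a) e + h \<odot> ev h g"
proof (cases "a = 0 \<and> g = 0")
  case True
  then show ?thesis using assms by (simp add: mult_zero_right ev_def)
next
  case False
  then have "fold_coeffs (\<lambda>a y. scl (of_real a) e + h \<odot> y) (pCons a g)
      = (\<lambda>y. scl (of_real a) e + h \<odot> y) \<circ> fold_coeffs (\<lambda>a y. scl (of_real a) e + h \<odot> y) g"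
    by auto
  then show ?thesis by (simp add: ev_def)
qed

lemma ev_closed: "h \<in> carr \<Longrightarrow> ev h g \<in> carr"
  by (induction g) (auto simp: ev_pCons intro!: closed)

lemma ev_one: "h \<in> carr \<Longrightarrow> ev h 1 = e"
  using ev_pCons[of h 1 0] by (simp add: scale_1 mult_zero_right one_pCons)

lemma ev_var: "h \<in> carr \<Longrightarrow> ev h [:0, 1:] = h"
  by (simp add: ev_pCons mult_zero_right scale_1 closed unit_right)

lemma ev_add: "h \<in> carr \<Longrightarrow> ev h (f + g) = ev h f + ev h g"
proof (induction f g rule: poly_induct2)
  case (pCons a p b q)
  then show ?case by (simp add: ev_pCons ev_closed expand closed add_scale algebra_simps)
qed simp

lemma ev_smult: "h \<in> carr \<Longrightarrow> ev h (smult c g) = scl (of_real c) (ev h g)"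
  by (induction g) (auto simp: ev_pCons ev_closed expand closed scale_scale)

lemma ev_diff: "h \<in> carr \<Longrightarrow> ev h (f - g) = ev h f - ev h g"
  using ev_add[of h "f - g" g] by simp

lemma ev_mult: "h \<in> carr \<Longrightarrow> ev h (f * g) = ev h f \<odot> ev h g"
proof (induction f)
  case 0
  then show ?case by (simp add: mult_zero_left ev_closed)
next
  case (pCons a p)
  have "ev h (pCons a p * g) = scl (of_real a) (ev h g) + (0 + h \<odot> (ev h p \<odot> ev h g))"
    using pCons by (simp add: mult_pCons_left ev_add ev_smult ev_pCons)
  also have "\<dots> = ev h (pCons a p) \<odot> ev h g"
    using pCons by (simp add: ev_pCons ev_closed expand closed mult_assoc)
  finally show ?case .
qed

lemma ev_self_adjoint:
  assumes "h \<in> carr" "invol h = h"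
  shows "invol (ev h g) = ev h g"
proof (induction g)
  case 0
  then show ?case by (simp add: star_zero)
next
  case (pCons a p)
  have "ev h p \<odot> h = h \<odot> ev h p"
    using ev_mult[of h p "[:0, 1:]"] ev_mult[of h "[:0, 1:]" p] assms by (simp add: ev_var mult.commute del: mult_pCons_left mult_pCons_right)
  then show ?case
    using pCons assms by (simp add: ev_pCons star_plus star_scale star_times star_unit ev_closed closed)
qed

lemma ev_rescale:
  assumes "h \<in> carr" "r \<noteq> 0"
  shows "ev h g = ev (scl (of_real (1 / r)) h) (pcompose g [:0, r:])"
proof (induction g)
  case (pCons a p)
  let ?k = "scl (of_real (1 / r)) h"
  have k: "?k \<in> carr" using assms by (intro closed)
  have "ev ?k [:0, r:] = scl (of_real r) ?k"
    using ev_smult[OF k, of r "[:0, 1:]"] ev_var[OF k] by simp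
  also have "\<dots> = h" using assms by (simp add: scale_scale scale_1 flip: of_real_mult)
  finally have kr: "ev ?k [:0, r:] = h" .
  have c: "ev ?k [:a:] = scl (of_real a) e" using ev_pCons[OF k, of a 0] mult_zero_right[OF k] by simp
  show ?case
    unfolding pcompose_pCons ev_add[OF k] ev_mult[OF k] kr c
    using pCons assms by (simp add: ev_pCons)
qed simp

end

locale cstar_seminormed_algebra = unital_star_algebra +
  fixes p :: "'a \<Rightarrow> real"
  assumes seminorm: "cstar_seminorm_on B p"
begin

lemma p_nonneg: "x \<in> carr \<Longrightarrow> 0 \<le> p x"
  and p_add: "x \<in> carr \<Longrightarrow> y \<in> carr \<Longrightarrow> p (x + y) \<le> p x + p y"
  and p_scale: "x \<in> carr \<Longrightarrow> p (scl c x) = cmod c * p x"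
  and p_mult: "x \<in> carr \<Longrightarrow> y \<in> carr \<Longrightarrow> p (x \<odot> y) \<le> p x * p y"
  and p_cstar: "x \<in> carr \<Longrightarrow> p (invol x \<odot> x) = (p x)\<^sup>2"
  using seminorm by (simp_all add: cstar_seminorm_on_def add_eq_plus)

lemma p_zero: "p 0 = 0"
  using p_scale[of 0 0] by (simp add: zero_closed)

lemma p_minus: "x \<in> carr \<Longrightarrow> p (- x) = p x"
  using p_scale[of x "-1"] by (simp add: scale_minus_one)

lemma p_diff: "x \<in> carr \<Longrightarrow> y \<in> carr \<Longrightarrow> p (x - y) \<le> p x + p y"
  using p_add[of x "- y"] by (simp add: p_minus closed)

lemma p_diff_commute: "x \<in> carr \<Longrightarrow> y \<in> carr \<Longrightarrow> p (x - y) = p (y - x)"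
  using p_minus[of "x - y"] by (simp add: closed)

lemma p_triangle: "x \<in> carr \<Longrightarrow> y \<in> carr \<Longrightarrow> z \<in> carr \<Longrightarrow> p (x - z) \<le> p (x - y) + p (y - z)"
  using p_add[of "x - y" "y - z"] by (simp add: closed)

lemma p_abs_diff: "x \<in> carr \<Longrightarrow> y \<in> carr \<Longrightarrow> \<bar>p x - p y\<bar> \<le> p (x - y)"
  using p_add[of "x - y" y] p_add[of "y - x" x] p_diff_commute[of x y] by (simp add: closed)

lemma p_star: "x \<in> carr \<Longrightarrow> p (invol x) = p x"
proof -
  have le: "p x \<le> p (invol x)" if "x \<in> carr" for x
  proof (cases "p x = 0")
    case True
    then show ?thesis using that p_nonneg[of "invol x"] by (simp add: closed)
  next
    case False
    then have "0 < p x" using that p_nonneg[of x] by simp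
    moreover have "p x * p x \<le> p (invol x) * p x"
      using p_mult[of "invol x" x] p_cstar[of x] that by (simp add: closed power2_eq_square)
    ultimately show ?thesis by simp
  qed
  show "x \<in> carr \<Longrightarrow> p (invol x) = p x"
    using le[of x] le[of "invol x"] by (simp add: closed star_involutive)
qed

lemma p_unit: "p e \<le> 1"
proof -
  have "p e = (p e)\<^sup>2" using p_cstar[of e] by (simp add: closed star_unit unit_left)
  then show ?thesis by (metis mult_cancel_left1 order_refl power2_eq_square zero_le_one)
qed

lemma p_square_self_adjoint: "x \<in> carr \<Longrightarrow> invol x = x \<Longrightarrow> p (x \<odot> x) = (p x)\<^sup>2"
  using p_cstar[of x] by simp

text \<open>For \<open>w = a + \<i> b\<close> the C*-identity reads \<open>(p w)\<^sup>2 = p (a a + b b)\<close>, and \<open>a\<close> is the average of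
  \<open>w\<close> and its adjoint.\<close>

lemma p_sum_squares:
  assumes a: "a \<in> carr" "invol a = a" and b: "b \<in> carr" "invol b = b" and comm: "a \<odot> b = b \<odot> a"
  shows "(p a)\<^sup>2 \<le> p (a \<odot> a + b \<odot> b)"
proof -
  define w where "w = a + scl \<i> b"
  have w: "w \<in> carr" unfolding w_def using a b by (intro closed)
  have star_w: "invol w = a - scl \<i> b"
    using a b add_scale[of "\<i>" "-\<i>" b] by (simp add: w_def star_plus star_scale closed) (simp add: add_eq_0_iff)
  have "invol w \<odot> w = a \<odot> a + b \<odot> b"
    unfolding star_w unfolding w_def using a b comm
    by (simp add: expand closed scale_scale) (simp add: scale_minus_one)
  then have pw: "(p w)\<^sup>2 = p (a \<odot> a + b \<odot> b)" using p_cstar[OF w] by simp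
  have "w + invol w = scl 2 a" using add_scale[of 1 1 a] unfolding star_w unfolding w_def by (simp add: scale_1)
  then have "2 * p a = p (w + invol w)" using a by (simp add: p_scale)
  also have "\<dots> \<le> 2 * p w" using p_add[of w "invol w"] p_star[OF w] w by (simp add: closed)
  finally have "p a \<le> p w" by simp
  then show ?thesis unfolding pw[symmetric] using a by (intro power_mono p_nonneg)
qed

theorem p_ev_le_sup:
  assumes h: "h \<in> carr" "invol h = h" and r: "0 < r" "p h \<le> r"
    and K: "\<And>s. \<bar>s\<bar> \<le> r \<Longrightarrow> \<bar>poly g s\<bar> \<le> K"
  shows "p (ev h g) \<le> K"
proof -
  define k where "k = scl (of_real (1 / r)) h"
  have k: "k \<in> carr" "invol k = k" using h by (auto simp: k_def star_scale intro!: closed)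
  have pk: "p k \<le> 1" using h r by (simp add: k_def p_scale norm_divide)
  interpret N: real_poly_cstar_seminorm "\<lambda>f. p (ev k f)"
  proof
    fix f g c
    show "(p (ev k f))\<^sup>2 \<le> p (ev k (f * f + g * g))"
      unfolding ev_add[OF k(1)] ev_mult[OF k(1)]
      by (rule p_sum_squares) (auto simp: ev_closed k ev_self_adjoint ev_mult[symmetric] mult.commute)
    show "p (ev k (f * f)) = (p (ev k f))\<^sup>2"
      by (simp add: ev_mult k p_square_self_adjoint ev_closed ev_self_adjoint)
  qed (auto simp: k ev_add ev_smult ev_mult p_nonneg p_add p_scale p_mult ev_closed)
  have "p (ev k (pcompose g [:0, r:])) \<le> K"
  proof (rule N.N_le_sup)
    show "p (ev k [:0, 1:]) \<le> 1" using pk by (simp add: ev_var k)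
    fix s :: real assume "\<bar>s\<bar> \<le> 1"
    then have "\<bar>r * s\<bar> \<le> r" using r by (simp add: abs_mult)
    then show "\<bar>poly (pcompose g [:0, r:]) s\<bar> \<le> K" using K[of "r * s"] by (simp add: poly_pcompose mult.commute)
  qed
  then show ?thesis using ev_rescale[of h r g] h r by (simp add: k_def)
qed

text \<open>By the C*-identity, the square of the left-hand side is the seminorm of the polynomial \<open>t (g t)\<^sup>2\<close> in
  \<open>x* x\<close>.\<close>

lemma p_mult_ev_le_sup:
  assumes x: "x \<in> carr" and r: "0 < r" "(p x)\<^sup>2 \<le> r"
    and K: "0 \<le> K" "\<And>s. \<bar>s\<bar> \<le> r \<Longrightarrow> \<bar>s\<bar> * (poly g s)\<^sup>2 \<le> K\<^sup>2"
  shows "p (x \<odot> ev (invol x \<odot> x) g) \<le> K"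
proof -
  let ?h = "invol x \<odot> x"
  have h: "?h \<in> carr" "invol ?h = ?h" using x by (auto simp: star_times star_involutive closed)
  have "invol (x \<odot> ev ?h g) \<odot> (x \<odot> ev ?h g) = ev ?h (g * [:0, 1:] * g)"
    unfolding ev_mult[OF h(1)] ev_var[OF h(1)]
    using x h by (simp add: star_times ev_self_adjoint ev_closed closed mult_assoc)
  then have "(p (x \<odot> ev ?h g))\<^sup>2 = p (ev ?h (g * [:0, 1:] * g))"
    using p_cstar[of "x \<odot> ev ?h g"] x h by (simp add: ev_closed closed)
  also have "\<dots> \<le> K\<^sup>2"
  proof (rule p_ev_le_sup[OF h r(1)])
    show "p ?h \<le> r" using r by (simp add: p_cstar x)
    fix s assume "\<bar>s\<bar> \<le> r"
    then show "\<bar>poly (g * [:0, 1:] * g) s\<bar> \<le> K\<^sup>2"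
      using K(2)[of s] by (simp add: abs_mult power2_eq_square mult.assoc mult.left_commute)
  qed
  finally show ?thesis using K(1) by (rule power2_le_imp_le)
qed

definition p_cauchy :: "(nat \<Rightarrow> 'a) \<Rightarrow> bool" where
  "p_cauchy X \<longleftrightarrow> (\<forall>n. X n \<in> carr) \<and> (\<forall>\<epsilon>>0. \<exists>N. \<forall>m\<ge>N. \<forall>n\<ge>N. p (X m - X n) < \<epsilon>)"

lemma p_cauchyI:
  assumes "\<And>n. X n \<in> carr" and "\<And>m n. m \<le> n \<Longrightarrow> p (X m - X n) \<le> b m" and "b \<longlonglongrightarrow> (0::real)"
  shows "p_cauchy X"
  unfolding p_cauchy_def
proof (intro conjI allI impI assms(1))
  fix \<epsilon> :: real assume "0 < \<epsilon>"
  then obtain N where N: "\<And>n. n \<ge> N \<Longrightarrow> b n < \<epsilon>"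
    using order_tendstoD(2)[OF assms(3)] by (auto simp: eventually_sequentially)
  have "p (X m - X n) < \<epsilon>" if "m \<ge> N" "n \<ge> N" for m n
    using assms(2)[of m n] assms(2)[of n m] N[OF that(1)] N[OF that(2)] p_diff_commute[of "X m" "X n"] assms(1)
    by (cases "m \<le> n") auto
  then show "\<exists>N. \<forall>m\<ge>N. \<forall>n\<ge>N. p (X m - X n) < \<epsilon>" by blast
qed

subsection \<open>Geometric series and lifting\<close>

text \<open>This inverts \<open>e - X\<close> in the completion, where \<open>X\<close> stands for the element that the Cauchy sequence
  \<open>X n\<close> represents. The diagonal sequence \<open>Z n = (\<Sum>j\<le>n. X n ^ j)\<close> is Cauchy by the resolvent
  identity \<open>Z m - Z n = Z m (X m - X n) Z n\<close>, which holds up to the remainders \<open>R n = X n ^ (n + 1)\<close>.\<close>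

lemma geometric_partial_sums:
  assumes X: "p_cauchy X" and rho: "\<And>n. p (X n) \<le> \<rho>" "\<rho> < 1"
  obtains Z where "p_cauchy Z" "(\<lambda>n. p (Z n \<odot> (e - X n) - e)) \<longlonglongrightarrow> 0"
proof -
  have Xc: "X n \<in> carr" for n using X by (simp add: p_cauchy_def)
  have rho0: "0 \<le> \<rho>" using order.trans[OF p_nonneg[OF Xc] rho(1)] .
  define gp where "gp n = (\<Sum>j\<le>n. [:0, 1::real:] ^ j)" for n
  have gp: "(1 - [:0, 1:]) * gp n = 1 - [:0, 1:] ^ Suc n" for n
    unfolding gp_def one_diff_power_eq lessThan_Suc_atMost ..
  define Z where "Z n = ev (X n) (gp n)" for n
  define R where "R n = ev (X n) ([:0, 1:] ^ Suc n)" for n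
  have Zc: "Z n \<in> carr" and Rc: "R n \<in> carr" for n by (auto simp: Z_def R_def Xc ev_closed)
  have monom_bound: "p (ev (X n) ([:0, 1:] ^ j)) \<le> \<rho> ^ j" for n j
  proof (induction j)
    case 0
    then show ?case using p_unit by (simp add: Xc ev_one)
  next
    case (Suc j)
    have "p (X n \<odot> ev (X n) ([:0, 1:] ^ j)) \<le> \<rho> * \<rho> ^ j"
      using p_mult[of "X n" "ev (X n) ([:0, 1:] ^ j)"] Suc rho(1)[of n] rho0
      by (auto simp: Xc ev_closed p_nonneg intro: order.trans[OF _ mult_mono])
    then show ?case unfolding power_Suc ev_mult[OF Xc] ev_var[OF Xc] .
  qed
  have Rp: "p (R n) \<le> \<rho> ^ n" for n
    using monom_bound[of n "Suc n"] rho0 rho(2) mult_left_le_one_le[of "\<rho> ^ n" \<rho>] by (auto simp: R_def)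
  define C where "C = 1 / (1 - \<rho>)"
  have C: "0 \<le> C" using rho(2) by (simp add: C_def)
  have Zp: "p (Z n) \<le> C" for n
  proof -
    have "p (ev (X n) (\<Sum>j\<le>k. [:0, 1:] ^ j)) \<le> (\<Sum>j\<le>k. \<rho> ^ j)" for k
    proof (induction k)
      case 0
      then show ?case using monom_bound[of n 0] by simp
    next
      case (Suc k)
      then show ?case using monom_bound[of n "Suc k"]
          p_add[of "ev (X n) (\<Sum>j\<le>k. [:0, 1:] ^ j)" "ev (X n) ([:0, 1:] ^ Suc k)"]
        by (simp add: ev_add Xc ev_closed del: power_Suc)
    qed
    moreover have "(\<Sum>j\<le>n. \<rho> ^ j) \<le> C"
      using sum_gp[of \<rho> 0 n] rho0 rho(2)
      by (simp add: C_def sum_gp_basic divide_simps atMost_atLeast0[symmetric])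
    ultimately show ?thesis unfolding Z_def gp_def by (meson order.trans)
  qed
  have Z1: "Z n \<odot> (e - X n) = e - R n" and Z2: "(e - X n) \<odot> Z n = e - R n" for n
  proof -
    have f: "ev (X n) (1 - [:0, 1:]) = e - X n"
      unfolding ev_diff[OF Xc] ev_one[OF Xc] ev_var[OF Xc] ..
    have g: "ev (X n) (1 - [:0, 1:] ^ Suc n) = e - R n"
      unfolding ev_diff[OF Xc] ev_one[OF Xc] R_def ..
    show "Z n \<odot> (e - X n) = e - R n"
      using ev_mult[OF Xc, of n "gp n" "1 - [:0, 1:]"] unfolding mult.commute[of "gp n"] gp f g Z_def by simp
    show "(e - X n) \<odot> Z n = e - R n"
      using ev_mult[OF Xc, of n "1 - [:0, 1:]" "gp n"] unfolding gp f g Z_def by simp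
  qed
  have pow0: "(\<lambda>n. \<rho> ^ n) \<longlonglongrightarrow> 0" using LIMSEQ_power_zero[of \<rho>] rho0 rho(2) by simp
  have resolvent: "p (Z m - Z n) \<le> C * C * p (X m - X n) + C * (\<rho> ^ m + \<rho> ^ n)" for m n
  proof -
    have "Z m \<odot> (X m - X n) \<odot> Z n = Z m \<odot> ((e - X n) \<odot> Z n) - Z m \<odot> (e - X m) \<odot> Z n"
      by (simp add: expand closed Xc Zc mult_assoc algebra_simps)
    also have "\<dots> = (Z m - Z n) - Z m \<odot> R n + R m \<odot> Z n"
      unfolding Z1 Z2 by (simp add: expand closed Rc Zc)
    finally have "Z m - Z n = Z m \<odot> (X m - X n) \<odot> Z n + (Z m \<odot> R n - R m \<odot> Z n)"
      by (simp add: algebra_simps)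
    then have "p (Z m - Z n) \<le> p (Z m \<odot> (X m - X n) \<odot> Z n) + (p (Z m \<odot> R n) + p (R m \<odot> Z n))"
      using p_add[of "Z m \<odot> (X m - X n) \<odot> Z n" "Z m \<odot> R n - R m \<odot> Z n"] p_diff[of "Z m \<odot> R n" "R m \<odot> Z n"]
      by (simp add: closed Xc Zc Rc)
    also have "p (Z m \<odot> (X m - X n) \<odot> Z n) \<le> C * p (X m - X n) * C"
      using p_mult[of "Z m \<odot> (X m - X n)" "Z n"] p_mult[of "Z m" "X m - X n"]
        mult_mono[OF mult_mono[OF Zp[of m] order_refl C p_nonneg[OF diff_closed[OF Xc Xc]]] Zp[of n], of m n]
        mult_right_mono[OF p_mult[of "Z m" "X m - X n"], of "p (Z n)"]
      by (fastforce simp: closed Xc Zc p_nonneg C)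
    also have "p (Z m \<odot> R n) \<le> C * \<rho> ^ n"
      using order.trans[OF p_mult[OF Zc Rc] mult_mono[OF Zp Rp C p_nonneg[OF Rc]]] .
    also have "p (R m \<odot> Z n) \<le> \<rho> ^ m * C"
      using order.trans[OF p_mult[OF Rc Zc] mult_mono[OF Rp Zp _ p_nonneg[OF Zc]]] rho0 by simp
    finally show ?thesis by (simp add: algebra_simps)
  qed
  have "p_cauchy Z"
    unfolding p_cauchy_def
  proof (intro conjI allI impI Zc)
    fix \<epsilon> :: real assume "0 < \<epsilon>"
    have "0 < \<epsilon> / (2 * (C * C + 1))" "0 < \<epsilon> / (4 * (C + 1))"
      using \<open>0 < \<epsilon>\<close> C by (auto intro!: divide_pos_pos add_nonneg_pos)
    then obtain N1 N2 where N1: "\<And>m n. m \<ge> N1 \<Longrightarrow> n \<ge> N1 \<Longrightarrow> p (X m - X n) < \<epsilon> / (2 * (C * C + 1))"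
      and N2: "\<And>n. n \<ge> N2 \<Longrightarrow> \<rho> ^ n < \<epsilon> / (4 * (C + 1))"
      using X order_tendstoD(2)[OF pow0] unfolding p_cauchy_def eventually_sequentially by metis
    have "p (Z m - Z n) < \<epsilon>" if "m \<ge> max N1 N2" "n \<ge> max N1 N2" for m n
    proof -
      have "C * C * p (X m - X n) \<le> C * C * (\<epsilon> / (2 * (C * C + 1)))"
        using N1[of m n] that C by (intro mult_left_mono) auto
      also have "\<dots> < \<epsilon> / 2" using \<open>0 < \<epsilon>\<close> C by (simp add: field_simps add_pos_nonneg)
      finally have 1: "C * C * p (X m - X n) < \<epsilon> / 2" .
      have "C * (\<rho> ^ m + \<rho> ^ n) \<le> C * (\<epsilon> / (4 * (C + 1)) + \<epsilon> / (4 * (C + 1)))"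
        using N2[of m] N2[of n] that C by (intro mult_left_mono) auto
      also have "\<dots> = \<epsilon> / 2 * (C / (C + 1))" using C by (simp add: divide_simps)
      also have "\<dots> \<le> \<epsilon> / 2 * 1" using \<open>0 < \<epsilon>\<close> C by (intro mult_left_mono) auto
      finally show ?thesis using resolvent[of m n] 1 by linarith
    qed
    then show "\<exists>N. \<forall>m\<ge>N. \<forall>n\<ge>N. p (Z m - Z n) < \<epsilon>" by blast
  qed
  moreover have "p (Z n \<odot> (e - X n) - e) = p (R n)" for n
    unfolding Z1 using p_minus[OF Rc, of n] by simp
  then have "(\<lambda>n. p (Z n \<odot> (e - X n) - e)) \<longlonglongrightarrow> 0"
    using Rp pow0 by (intro squeeze_to_0[OF _ _ pow0]) (auto simp: p_nonneg Rc)
  ultimately show thesis by (rule that)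
qed

text \<open>If \<open>q\<close> comes from a *-homomorphism \<open>f\<close>, then in the limit \<open>y n\<close> is a preimage of \<open>f x\<close> whose norm is at
  most \<open>r\<close>. For \<open>h = x* x\<close> the sequence consists of approximations to \<open>x (g h)\<close>, where \<open>g s = r0 / max r0 (sqrt |s|)\<close>
  scales \<open>x\<close> down to norm at most \<open>r0\<close>: since \<open>|s| (g s)\<^sup>2 \<le> r0\<^sup>2\<close>, the seminorm \<open>p\<close> becomes
  small enough, and since \<open>g = 1\<close> on \<open>[-r0\<^sup>2, r0\<^sup>2]\<close>, where \<open>q\<close> sees \<open>h\<close>, nothing changes for
  \<open>q\<close>. The absolute value enters because \<open>p_ev_le_sup\<close> takes suprema over intervals symmetric about 0.\<close>

theorem approximate_lifting:
  assumes q: "cstar_seminorm_on B q" and x: "x \<in> carr" and r: "q x < r"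
  obtains y where "p_cauchy y" "(\<lambda>n. q (y n - x)) \<longlonglongrightarrow> 0" "\<forall>\<^sub>F n in sequentially. p (y n) \<le> r"
proof -
  interpret q: cstar_seminormed_algebra B e q
    by unfold_locales (rule q)
  define h where "h = invol x \<odot> x"
  have h: "h \<in> carr" using x by (simp add: h_def closed)
  define r0 where "r0 = (q x + r) / 2"
  have r0: "q x < r0" "r0 < r" "0 < r0" using r q.p_nonneg[OF x] by (auto simp: r0_def)
  define R where "R = (p x)\<^sup>2 + 1"
  have R: "0 < R" "(p x)\<^sup>2 \<le> R" by (auto simp: R_def add_nonneg_pos)
  \<comment> \<open>The approximation of \<open>g\<close> has to hold on both \<open>[-R, R]\<close>, for \<open>p\<close>, and \<open>[-r0\<^sup>2, r0\<^sup>2]\<close>, for \<open>q\<close>.\<close>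
  define R' where "R' = max R (r0\<^sup>2)"
  define g where "g s = r0 / max r0 (sqrt \<bar>s\<bar>)" for s :: real
  have g01: "0 \<le> g s" "g s \<le> 1" for s using r0 by (auto simp: g_def divide_simps)
  have "\<exists>G :: real poly. \<forall>s. \<bar>s\<bar> \<le> R' \<longrightarrow> \<bar>poly G s - g s\<bar> \<le> inverse (real (Suc n))" for n
  proof -
    have cont: "continuous_on {-R'..R'} g"
      unfolding g_def using r0 by (intro continuous_intros) (auto simp: max_def)
    obtain f where f: "real_polynomial_function f" "\<And>s. s \<in> {-R'..R'} \<Longrightarrow> \<bar>g s - f s\<bar> < inverse (real (Suc n))"
      using Stone_Weierstrass_real_polynomial_function[OF compact_Icc cont, of "inverse (real (Suc n))"] by auto
    obtain a m where "f = (\<lambda>s. \<Sum>i\<le>m. a i * s ^ i)"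
      using f(1) real_polynomial_function_iff_sum by blast
    then have "poly (\<Sum>i\<le>m. monom (a i) i) s = f s" for s by (simp add: poly_sum poly_monom)
    moreover have "\<bar>f s - g s\<bar> \<le> inverse (real (Suc n))" if "\<bar>s\<bar> \<le> R'" for s
      using f(2)[of s] that unfolding abs_minus_commute[of "f s"] atLeastAtMost_iff abs_le_iff by linarith
    ultimately show ?thesis by (intro exI[of _ "\<Sum>i\<le>m. monom (a i) i"]) simp
  qed
  then obtain G :: "nat \<Rightarrow> real poly" where G: "\<And>n s. \<bar>s\<bar> \<le> R' \<Longrightarrow> \<bar>poly (G n) s - g s\<bar> \<le> inverse (real (Suc n))"
    by metis
  define \<delta> where "\<delta> n = inverse (real (Suc n))" for n
  have \<delta>: "0 \<le> \<delta> n" "m \<le> n \<Longrightarrow> \<delta> n \<le> \<delta> m" for m n by (auto simp: \<delta>_def divide_simps)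
  have G_le: "\<bar>poly (G n) s - g s\<bar> \<le> \<delta> n" if "\<bar>s\<bar> \<le> R'" for n s
    using G[OF that, of n] by (simp only: \<delta>_def)
  have \<delta>0: "\<delta> \<longlonglongrightarrow> 0" unfolding \<delta>_def by (rule LIMSEQ_inverse_real_of_nat)
  define y where "y n = x \<odot> ev h (G n)" for n
  have yc: "y n \<in> carr" for n using x h by (simp add: y_def closed ev_closed)
  have "p (y m - y n) \<le> 2 * sqrt R * \<delta> m" if "m \<le> n" for m n
  proof -
    have "y m - y n = x \<odot> ev h (G m - G n)"
      using x h by (simp add: y_def ev_diff expand ev_closed)
    also have "p \<dots> \<le> 2 * sqrt R * \<delta> m"
      unfolding h_def
    proof (rule p_mult_ev_le_sup[OF x R])
      fix s assume s: "\<bar>s\<bar> \<le> R"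
      have "\<bar>poly (G m - G n) s\<bar> \<le> 2 * \<delta> m"
        using G_le[of s m] G_le[of s n] s \<delta>(2)[OF that] by (simp add: R'_def) linarith
      then have "(poly (G m - G n) s)\<^sup>2 \<le> (2 * \<delta> m)\<^sup>2"
        using abs_le_square_iff \<delta>(1)[of m] by fastforce
      then have "\<bar>s\<bar> * (poly (G m - G n) s)\<^sup>2 \<le> R * (2 * \<delta> m)\<^sup>2"
        using s by (intro mult_mono) auto
      then show "\<bar>s\<bar> * (poly (G m - G n) s)\<^sup>2 \<le> (2 * sqrt R * \<delta> m)\<^sup>2"
        using R by (simp add: power_mult_distrib)
    qed (use R \<delta> in auto)
    finally show ?thesis .
  qed
  then have "p_cauchy y"
    by (rule p_cauchyI[OF yc]) (use tendsto_mult_left[OF \<delta>0, of "2 * sqrt R"] in auto)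
  moreover
  have "q (y n - x) \<le> r0 * \<delta> n" for n
  proof -
    have "y n - x = x \<odot> ev h (G n - 1)"
      using x h by (simp add: y_def ev_diff ev_one expand ev_closed closed)
    also have "q \<dots> \<le> r0 * \<delta> n"
      unfolding h_def
    proof (rule q.p_mult_ev_le_sup[OF x, of "r0\<^sup>2"])
      show "(q x)\<^sup>2 \<le> r0\<^sup>2" using r0 q.p_nonneg[OF x] by (intro power_mono) auto
      fix s assume s: "\<bar>s\<bar> \<le> r0\<^sup>2"
      then have "sqrt \<bar>s\<bar> \<le> r0" using r0 real_le_lsqrt by fastforce
      then have "g s = 1" using r0 by (simp add: g_def max_def)
      then have "\<bar>poly (G n - 1) s\<bar> \<le> \<delta> n" using G_le[of s n] s by (simp add: R'_def)
      then have "(poly (G n - 1) s)\<^sup>2 \<le> (\<delta> n)\<^sup>2" using abs_le_square_iff \<delta>(1)[of n] by fastforce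
      then have "\<bar>s\<bar> * (poly (G n - 1) s)\<^sup>2 \<le> r0\<^sup>2 * (\<delta> n)\<^sup>2" using s by (intro mult_mono) auto
      then show "\<bar>s\<bar> * (poly (G n - 1) s)\<^sup>2 \<le> (r0 * \<delta> n)\<^sup>2" by (simp add: power_mult_distrib)
    qed (use r0 \<delta> in auto)
    finally show ?thesis .
  qed
  note q_le = this
  have lim: "(\<lambda>n. r0 * \<delta> n) \<longlonglongrightarrow> 0" using tendsto_mult_left[OF \<delta>0, of r0] by simp
  have "(\<lambda>n. q (y n - x)) \<longlonglongrightarrow> 0"
    by (rule squeeze_to_0[OF _ q_le lim]) (simp add: q.p_nonneg diff_closed x yc)
  moreover have "p (y n) \<le> r0 + sqrt R * \<delta> n" for n
    unfolding y_def h_def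
  proof (rule p_mult_ev_le_sup[OF x R])
    fix s assume s: "\<bar>s\<bar> \<le> R"
    have 1: "sqrt \<bar>s\<bar> * g s \<le> r0" using r0 by (simp add: g_def max_def field_simps)
    have 2: "\<bar>poly (G n) s\<bar> \<le> g s + \<delta> n" using G_le[of s n] s g01[of s] by (simp add: R'_def) linarith
    have "sqrt \<bar>s\<bar> * \<bar>poly (G n) s\<bar> \<le> sqrt \<bar>s\<bar> * (g s + \<delta> n)" using 2 by (intro mult_left_mono) auto
    also have "\<dots> \<le> r0 + sqrt R * \<delta> n"
      using 1 mult_right_mono[of "sqrt \<bar>s\<bar>" "sqrt R" "\<delta> n"] s \<delta>(1)[of n] by (simp add: distrib_left)
    finally have "(sqrt \<bar>s\<bar> * \<bar>poly (G n) s\<bar>)\<^sup>2 \<le> (r0 + sqrt R * \<delta> n)\<^sup>2"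
      by (intro power_mono) auto
    then show "\<bar>s\<bar> * (poly (G n) s)\<^sup>2 \<le> (r0 + sqrt R * \<delta> n)\<^sup>2" by (simp add: power_mult_distrib)
  qed (use r0 R \<delta> in auto)
  then have "\<forall>\<^sub>F n in sequentially. p (y n) \<le> r"
  proof -
    have "(\<lambda>n. r0 + sqrt R * \<delta> n) \<longlonglongrightarrow> r0 + sqrt R * 0" by (intro tendsto_intros \<delta>0)
    then have "\<forall>\<^sub>F n in sequentially. r0 + sqrt R * \<delta> n < r" using r0 by (intro order_tendstoD(2)) auto
    then show ?thesis using \<open>\<And>n. p (y n) \<le> r0 + sqrt R * \<delta> n\<close>
      by (auto elim!: eventually_mono intro: order.trans less_imp_le)
  qed
  ultimately show thesis by (rule that)
qed

end

section \<open>The enveloping C*-algebra\<close>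

context cstar_seminormed_algebra
begin

lemma p_cauchy_carrier: "p_cauchy X \<Longrightarrow> X n \<in> carr"
  by (simp add: p_cauchy_def)

lemma p_cauchy_const: "x \<in> carr \<Longrightarrow> p_cauchy (\<lambda>n. x)"
  by (simp add: p_cauchy_def p_zero)

lemma p_cauchy_bounded:
  assumes "p_cauchy X"
  obtains C where "0 < C" "\<And>n. p (X n) \<le> C"
proof -
  obtain N where N: "\<And>m n. m \<ge> N \<Longrightarrow> n \<ge> N \<Longrightarrow> p (X m - X n) < 1"
    using assms unfolding p_cauchy_def by (meson zero_less_one)
  define C where "C = Max ((\<lambda>n. p (X n)) ` {..N}) + 1"
  have C: "p (X n) \<le> C - 1" if "n \<le> N" for n
    using that by (auto simp: C_def intro!: Max_ge)
  have "p (X n) \<le> C" for n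
  proof (cases "n \<le> N")
    case False
    then have "p (X n - X N) < 1" using N[of n N] by simp
    then show ?thesis using C[of N] p_abs_diff[of "X n" "X N"] p_cauchy_carrier[OF assms] by simp
  qed (use C in force)
  moreover have "0 < C" using C[of 0] p_nonneg[OF p_cauchy_carrier[OF assms], of 0] by simp
  ultimately show thesis using that by blast
qed

lemma p_cauchy_dominated:
  assumes X: "p_cauchy X" and Y: "p_cauchy Y" and Z: "\<And>n. Z n \<in> carr" and C: "0 < C" "0 < D"
    and le: "\<And>m n. p (Z m - Z n) \<le> C * p (X m - X n) + D * p (Y m - Y n)"
  shows "p_cauchy Z"
  unfolding p_cauchy_def
proof (intro conjI allI impI Z)
  fix \<epsilon> :: real assume "0 < \<epsilon>"
  then have "0 < \<epsilon> / (2 * C)" "0 < \<epsilon> / (2 * D)" using C by auto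
  then obtain N1 N2 where N1: "\<And>m n. m \<ge> N1 \<Longrightarrow> n \<ge> N1 \<Longrightarrow> p (X m - X n) < \<epsilon> / (2 * C)"
    and N2: "\<And>m n. m \<ge> N2 \<Longrightarrow> n \<ge> N2 \<Longrightarrow> p (Y m - Y n) < \<epsilon> / (2 * D)"
    using X Y unfolding p_cauchy_def by metis
  have "p (Z m - Z n) < \<epsilon>" if "m \<ge> max N1 N2" "n \<ge> max N1 N2" for m n
  proof -
    have "C * p (X m - X n) < \<epsilon> / 2" "D * p (Y m - Y n) < \<epsilon> / 2"
      using N1[of m n] N2[of m n] that C by (auto simp: field_simps)
    then show ?thesis using le[of m n] by linarith
  qed
  then show "\<exists>N. \<forall>m\<ge>N. \<forall>n\<ge>N. p (Z m - Z n) < \<epsilon>" by blast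
qed

lemma p_add_diff_le:
  assumes "a \<in> carr" "b \<in> carr" "c \<in> carr" "d \<in> carr"
  shows "p (a + b - (c + d)) \<le> p (a - c) + p (b - d)"
  using p_add[of "a - c" "b - d"] assms by (simp add: closed algebra_simps)

lemma p_mult_diff_le:
  assumes "a \<in> carr" "b \<in> carr" "c \<in> carr" "d \<in> carr" "p b \<le> D" "p c \<le> C"
  shows "p (a \<odot> b - c \<odot> d) \<le> D * p (a - c) + C * p (b - d)"
proof -
  have "a \<odot> b - c \<odot> d = (a - c) \<odot> b + c \<odot> (b - d)"
    using assms by (simp add: expand closed)
  then have "p (a \<odot> b - c \<odot> d) \<le> p (a - c) * p b + p c * p (b - d)"
    using p_add[of "(a - c) \<odot> b" "c \<odot> (b - d)"] p_mult[of "a - c" b] p_mult[of c "b - d"] assms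
    by (simp add: closed)
  also have "\<dots> \<le> p (a - c) * D + C * p (b - d)"
    using assms by (intro add_mono mult_left_mono mult_right_mono p_nonneg closed)
  finally show ?thesis by (simp add: mult.commute)
qed

lemma p_cauchy_add: "p_cauchy X \<Longrightarrow> p_cauchy Y \<Longrightarrow> p_cauchy (\<lambda>n. X n + Y n)"
  by (rule p_cauchy_dominated[of X Y _ 1 1]) (auto simp: p_cauchy_carrier closed p_add_diff_le)

lemma p_cauchy_scale: "p_cauchy X \<Longrightarrow> p_cauchy (\<lambda>n. scl c (X n))"
  by (rule p_cauchy_dominated[of X X _ "cmod c + 1" 1])
    (auto simp: p_cauchy_carrier closed p_scale p_nonneg algebra_simps add_pos_nonneg simp flip: scale_diff)

lemma p_cauchy_star: "p_cauchy X \<Longrightarrow> p_cauchy (\<lambda>n. invol (X n))"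
  by (rule p_cauchy_dominated[of X X _ 1 1])
    (auto simp: p_cauchy_carrier closed p_star p_nonneg simp flip: star_diff)

lemma p_cauchy_mult:
  assumes "p_cauchy X" "p_cauchy Y"
  shows "p_cauchy (\<lambda>n. X n \<odot> Y n)"
proof -
  obtain C D where "0 < C" "\<And>n. p (X n) \<le> C" "0 < D" "\<And>n. p (Y n) \<le> D"
    using p_cauchy_bounded assms by metis
  note CD = this
  have c: "X n \<in> carr" "Y n \<in> carr" for n using assms by (auto simp: p_cauchy_carrier)
  show ?thesis
    by (rule p_cauchy_dominated[OF assms mult_closed[OF c] CD(3,1) p_mult_diff_le[OF c c CD(4,2)]])
qed

lemma p_cauchy_diff: "p_cauchy X \<Longrightarrow> p_cauchy Y \<Longrightarrow> p_cauchy (\<lambda>n. X n - Y n)"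
  using p_cauchy_add[of X "\<lambda>n. scl (-1) (Y n)"] p_cauchy_scale[of Y "-1"] by (simp add: scale_minus_one)

lemma p_cauchy_shift: "p_cauchy X \<Longrightarrow> p_cauchy (\<lambda>n. X (n + k))"
  unfolding p_cauchy_def by (metis le_add1 order.trans add.commute trans_le_add1)

end

text \<open>Non-negativity of the given norm makes the zero seminorm dominated, so that the supremum defining the
  enveloping seminorm ranges over a non-empty set.\<close>

locale enveloping = unital_star_algebra +
  assumes alg_norm_nonneg: "x \<in> alg_carrier B \<Longrightarrow> 0 \<le> alg_norm B x"
begin

abbreviation dominated_seminorms :: "('a \<Rightarrow> real) set" where
  "dominated_seminorms \<equiv> {q. cstar_seminorm_on B q \<and> (\<forall>y\<in>carr. q y \<le> alg_norm B y)}"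

lemma enveloping_seminorm_upper:
  assumes "q \<in> dominated_seminorms" "x \<in> carr"
  shows "q x \<le> enveloping_seminorm B x"
  unfolding enveloping_seminorm_def
  using assms by (intro cSUP_upper bdd_aboveI2[where M = "alg_norm B x"]) auto

lemma zero_dominated: "(\<lambda>x. 0) \<in> dominated_seminorms"
  by (simp add: cstar_seminorm_on_def alg_norm_nonneg)

lemma enveloping_seminorm_least:
  assumes "\<And>q. q \<in> dominated_seminorms \<Longrightarrow> q x \<le> c"
  shows "enveloping_seminorm B x \<le> c"
  unfolding enveloping_seminorm_def using assms zero_dominated by (intro cSUP_least) auto

lemma enveloping_seminorm_le_norm: "x \<in> carr \<Longrightarrow> enveloping_seminorm B x \<le> alg_norm B x"
  by (rule enveloping_seminorm_least) auto

lemma cstar_seminorm_enveloping: "cstar_seminorm_on B (enveloping_seminorm B)"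
proof -
  let ?P = "enveloping_seminorm B"
  have nonneg: "0 \<le> ?P x" if "x \<in> carr" for x
    using enveloping_seminorm_upper[OF zero_dominated that] .
  have up: "q x \<le> ?P x" and q0: "0 \<le> q x" if "q \<in> dominated_seminorms" "x \<in> carr" for q x
    using enveloping_seminorm_upper[OF that] that by (auto simp: cstar_seminorm_on_def)
  have scale_le: "?P (scl c x) \<le> cmod c * ?P x" if x: "x \<in> carr" for c x
  proof (rule enveloping_seminorm_least)
    fix q assume q: "q \<in> dominated_seminorms"
    then have "q (scl c x) = cmod c * q x" using x by (simp add: cstar_seminorm_on_def)
    then show "q (scl c x) \<le> cmod c * ?P x" using up[OF q x] by (simp add: mult_left_mono)
  qed
  show ?thesis
    unfolding cstar_seminorm_on_def
  proof (intro conjI ballI allI)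
    fix x y assume x: "x \<in> carr" and y: "y \<in> carr"
    show "?P (alg_add B x y) \<le> ?P x + ?P y"
    proof (rule enveloping_seminorm_least)
      fix q assume q: "q \<in> dominated_seminorms"
      then have "q (alg_add B x y) \<le> q x + q y" using x y by (simp add: cstar_seminorm_on_def)
      then show "q (alg_add B x y) \<le> ?P x + ?P y" using up[OF q x] up[OF q y] by linarith
    qed
    show "?P (x \<odot> y) \<le> ?P x * ?P y"
    proof (rule enveloping_seminorm_least)
      fix q assume q: "q \<in> dominated_seminorms"
      then have "q (x \<odot> y) \<le> q x * q y" using x y by (simp add: cstar_seminorm_on_def)
      also have "\<dots> \<le> ?P x * ?P y" using up[OF q x] up[OF q y] q0[OF q y] nonneg[OF x] by (intro mult_mono)
      finally show "q (x \<odot> y) \<le> ?P x * ?P y" .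
    qed
  next
    fix c x assume x: "x \<in> carr"
    show "?P (scl c x) = cmod c * ?P x"
    proof (cases "c = 0")
      case True
      then show ?thesis using scale_le[OF x, of 0] nonneg[OF zero_closed] by simp
    next
      case False
      have "?P x \<le> cmod (1 / c) * ?P (scl c x)"
        using scale_le[OF scale_closed[OF x], of "1 / c" c] False by (simp add: scale_scale scale_1)
      then have "cmod c * ?P x \<le> ?P (scl c x)" using False by (simp add: norm_divide field_simps)
      then show ?thesis using scale_le[OF x, of c] by simp
    qed
  next
    fix x assume x: "x \<in> carr"
    have sq: "q (invol x \<odot> x) = (q x)\<^sup>2" if "q \<in> dominated_seminorms" for q
      using that x by (simp add: cstar_seminorm_on_def)
    show "?P (invol x \<odot> x) = (?P x)\<^sup>2"
    proof (rule antisym)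
      show "?P (invol x \<odot> x) \<le> (?P x)\<^sup>2"
      proof (rule enveloping_seminorm_least)
        fix q assume q: "q \<in> dominated_seminorms"
        show "q (invol x \<odot> x) \<le> (?P x)\<^sup>2"
          unfolding sq[OF q] by (rule power_mono[OF up[OF q x] q0[OF q x]])
      qed
      have "?P x \<le> sqrt (?P (invol x \<odot> x))"
      proof (rule enveloping_seminorm_least, rule real_le_rsqrt)
        fix q assume q: "q \<in> dominated_seminorms"
        show "(q x)\<^sup>2 \<le> ?P (invol x \<odot> x)"
          using up[OF q, of "invol x \<odot> x"] x sq[OF q] by (simp add: closed)
      qed
      then have "(?P x)\<^sup>2 \<le> (sqrt (?P (invol x \<odot> x)))\<^sup>2"
        using nonneg[OF x] by (rule power_mono)
      then show "(?P x)\<^sup>2 \<le> ?P (invol x \<odot> x)"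
        using x by (simp add: nonneg closed)
    qed
  qed (use nonneg in auto)
qed

sublocale cstar_seminormed_algebra B e "enveloping_seminorm B"
  by unfold_locales (rule cstar_seminorm_enveloping)

abbreviation P where "P \<equiv> enveloping_seminorm B"

abbreviation E where "E \<equiv> enveloping_cstar B"

definition cls :: "(nat \<Rightarrow> 'a) \<Rightarrow> (nat \<Rightarrow> 'a) set" where
  "cls X = env_rel B `` {X}"

lemma env_cauchy_eq: "env_cauchy B = Collect p_cauchy"
  by (auto simp: env_cauchy_def p_cauchy_def alg_diff_eq_minus)

lemma env_rel_iff: "(X, Y) \<in> env_rel B \<longleftrightarrow> p_cauchy X \<and> p_cauchy Y \<and> (\<lambda>n. P (X n - Y n)) \<longlonglongrightarrow> 0"
  by (auto simp: env_rel_def env_cauchy_eq alg_diff_eq_minus)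

lemma equiv_env_rel: "equiv (env_cauchy B) (env_rel B)"
proof (rule equivI)
  show "env_rel B \<subseteq> env_cauchy B \<times> env_cauchy B"
    by (auto simp: env_rel_iff env_cauchy_eq)
  show "refl_on (env_cauchy B) (env_rel B)"
    by (auto simp: refl_on_def env_rel_iff env_cauchy_eq p_zero)
  show "sym (env_rel B)"
  proof (rule symI)
    fix X Y assume XY: "(X, Y) \<in> env_rel B"
    then have "P (X n - Y n) = P (Y n - X n)" for n
      by (auto simp: env_rel_iff p_cauchy_carrier intro: p_diff_commute)
    then show "(Y, X) \<in> env_rel B" using XY by (simp add: env_rel_iff)
  qed
  show "trans (env_rel B)"
  proof (rule transI)
    fix X Y Z assume *: "(X, Y) \<in> env_rel B" "(Y, Z) \<in> env_rel B"
    have "(\<lambda>n. P (X n - Y n) + P (Y n - Z n)) \<longlonglongrightarrow> 0"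
      using tendsto_add[of "\<lambda>n. P (X n - Y n)" 0 sequentially "\<lambda>n. P (Y n - Z n)" 0] * by (simp add: env_rel_iff)
    moreover have c: "X n \<in> carr" "Y n \<in> carr" "Z n \<in> carr" for n
      using * by (auto simp: env_rel_iff p_cauchy_carrier)
    ultimately have "(\<lambda>n. P (X n - Z n)) \<longlonglongrightarrow> 0"
      using squeeze_to_0[of "\<lambda>n. P (X n - Z n)" "\<lambda>n. P (X n - Y n) + P (Y n - Z n)"]
      by (simp only: p_nonneg diff_closed c p_triangle)
    then show "(X, Z) \<in> env_rel B" using * by (simp add: env_rel_iff)
  qed
qed

lemma carrier_E: "alg_carrier E = cls ` Collect p_cauchy"
  by (auto simp: enveloping_cstar_def quotient_def cls_def env_cauchy_eq)

lemma cls_in_carrier: "p_cauchy X \<Longrightarrow> cls X \<in> alg_carrier E"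
  by (auto simp: carrier_E)

lemma cls_eq_iff: "p_cauchy X \<Longrightarrow> p_cauchy Y \<Longrightarrow> cls X = cls Y \<longleftrightarrow> (\<lambda>n. P (X n - Y n)) \<longlonglongrightarrow> 0"
  using eq_equiv_class_iff[OF equiv_env_rel, of X Y] by (simp add: cls_def env_cauchy_eq env_rel_iff)

lemma in_cls_iff: "p_cauchy X \<Longrightarrow> Y \<in> cls X \<longleftrightarrow> p_cauchy Y \<and> cls Y = cls X"
proof -
  assume X: "p_cauchy X"
  have "Y \<in> cls X \<longleftrightarrow> (X, Y) \<in> env_rel B" by (simp add: cls_def)
  then show ?thesis using X cls_eq_iff[of X Y] by (auto simp: env_rel_iff)
qed

lemma self_in_cls: "p_cauchy X \<Longrightarrow> X \<in> cls X"
  by (simp add: in_cls_iff)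

text \<open>The operations of the completion are unions over representatives; an operation that respects the relation
  therefore reduces to its value on one representative.\<close>

lemma UN_cls_const:
  assumes "p_cauchy X" "\<And>Y. p_cauchy Y \<Longrightarrow> cls Y = cls X \<Longrightarrow> f Y = f X"
  shows "(\<Union>Y\<in>cls X. f Y) = f X"
proof -
  have "(\<Union>Y\<in>cls X. f Y) = (\<Union>Y\<in>cls X. f X)"
  proof (rule SUP_cong[OF refl])
    fix Y assume "Y \<in> cls X"
    then show "f Y = f X" using in_cls_iff[OF assms(1)] by (intro assms(2)) blast+
  qed
  then show ?thesis using self_in_cls[OF assms(1)] by auto
qed

lemma add_cls:
  assumes X: "p_cauchy X" and Y: "p_cauchy Y"
  shows "alg_add E (cls X) (cls Y) = cls (\<lambda>n. X n + Y n)"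
proof -
  have *: "cls (\<lambda>n. X' n + Y' n) = cls (\<lambda>n. X n + Y n)"
    if "p_cauchy X'" "cls X' = cls X" "p_cauchy Y'" "cls Y' = cls Y" for X' Y'
  proof -
    have "(\<lambda>n. P (X' n - X n) + P (Y' n - Y n)) \<longlonglongrightarrow> 0"
      using tendsto_add[of "\<lambda>n. P (X' n - X n)" 0 sequentially "\<lambda>n. P (Y' n - Y n)" 0] that X Y by (simp add: cls_eq_iff)
    moreover have c: "X n \<in> carr" "Y n \<in> carr" "X' n \<in> carr" "Y' n \<in> carr" for n
      using that X Y by (auto simp: p_cauchy_carrier)
    ultimately have "(\<lambda>n. P (X' n + Y' n - (X n + Y n))) \<longlonglongrightarrow> 0"
      using squeeze_to_0[of "\<lambda>n. P (X' n + Y' n - (X n + Y n))" "\<lambda>n. P (X' n - X n) + P (Y' n - Y n)"]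
      by (simp only: p_nonneg closed c p_add_diff_le)
    then show ?thesis using that X Y by (simp add: cls_eq_iff p_cauchy_add)
  qed
  have inner: "(\<Union>Y'\<in>cls Y. cls (\<lambda>n. X' n + Y' n)) = cls (\<lambda>n. X n + Y n)"
    if "p_cauchy X'" "cls X' = cls X" for X'
  proof -
    have "(\<Union>Y'\<in>cls Y. cls (\<lambda>n. X' n + Y' n)) = cls (\<lambda>n. X' n + Y n)"
    proof (rule UN_cls_const[OF Y])
      fix Y' assume "p_cauchy Y'" "cls Y' = cls Y"
      then show "cls (\<lambda>n. X' n + Y' n) = cls (\<lambda>n. X' n + Y n)"
        using *[OF that, of Y'] *[OF that Y refl] by (simp only:)
    qed
    then show ?thesis using *[OF that Y refl] by (simp only:)
  qed
  have "(\<Union>X'\<in>cls X. \<Union>Y'\<in>cls Y. cls (\<lambda>n. X' n + Y' n)) = (\<Union>Y'\<in>cls Y. cls (\<lambda>n. X n + Y' n))"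
  proof (rule UN_cls_const[OF X])
    fix X' assume "p_cauchy X'" "cls X' = cls X"
    then show "(\<Union>Y'\<in>cls Y. cls (\<lambda>n. X' n + Y' n)) = (\<Union>Y'\<in>cls Y. cls (\<lambda>n. X n + Y' n))"
      using inner[of X'] inner[OF X refl] by (simp only:)
  qed
  then have "(\<Union>X'\<in>cls X. \<Union>Y'\<in>cls Y. cls (\<lambda>n. X' n + Y' n)) = cls (\<lambda>n. X n + Y n)"
    using inner[OF X refl] by (simp only:)
  then show ?thesis by (simp add: enveloping_cstar_def add_eq_plus cls_def)
qed

lemma mult_cls:
  assumes X: "p_cauchy X" and Y: "p_cauchy Y"
  shows "alg_mult E (cls X) (cls Y) = cls (\<lambda>n. X n \<odot> Y n)"
proof -
  have *: "cls (\<lambda>n. X' n \<odot> Y' n) = cls (\<lambda>n. X n \<odot> Y n)"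
    if "p_cauchy X'" "cls X' = cls X" "p_cauchy Y'" "cls Y' = cls Y" for X' Y'
  proof -
    note Y' = that(3)
    obtain C D where CD: "\<And>n. P (X n) \<le> C" "\<And>n. P (Y' n) \<le> D"
      using p_cauchy_bounded[OF X] p_cauchy_bounded[OF Y'] by metis
    have "(\<lambda>n. D * P (X' n - X n) + C * P (Y' n - Y n)) \<longlonglongrightarrow> 0"
      using tendsto_add[OF tendsto_mult_left[of "\<lambda>n. P (X' n - X n)" 0 sequentially D] tendsto_mult_left[of "\<lambda>n. P (Y' n - Y n)" 0 sequentially C]] that X Y by (simp add: cls_eq_iff)
    moreover have c: "X n \<in> carr" "Y n \<in> carr" "X' n \<in> carr" "Y' n \<in> carr" for n
      using that X Y by (auto simp: p_cauchy_carrier)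
    ultimately have "(\<lambda>n. P (X' n \<odot> Y' n - X n \<odot> Y n)) \<longlonglongrightarrow> 0"
      using squeeze_to_0[of "\<lambda>n. P (X' n \<odot> Y' n - X n \<odot> Y n)" "\<lambda>n. D * P (X' n - X n) + C * P (Y' n - Y n)"]
      by (simp only: p_nonneg closed c p_mult_diff_le CD)
    then show ?thesis using that X Y by (simp add: cls_eq_iff p_cauchy_mult)
  qed
  have inner: "(\<Union>Y'\<in>cls Y. cls (\<lambda>n. X' n \<odot> Y' n)) = cls (\<lambda>n. X n \<odot> Y n)"
    if "p_cauchy X'" "cls X' = cls X" for X'
  proof -
    have "(\<Union>Y'\<in>cls Y. cls (\<lambda>n. X' n \<odot> Y' n)) = cls (\<lambda>n. X' n \<odot> Y n)"
    proof (rule UN_cls_const[OF Y])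
      fix Y' assume "p_cauchy Y'" "cls Y' = cls Y"
      then show "cls (\<lambda>n. X' n \<odot> Y' n) = cls (\<lambda>n. X' n \<odot> Y n)"
        using *[OF that, of Y'] *[OF that Y refl] by (simp only:)
    qed
    then show ?thesis using *[OF that Y refl] by (simp only:)
  qed
  have "(\<Union>X'\<in>cls X. \<Union>Y'\<in>cls Y. cls (\<lambda>n. X' n \<odot> Y' n)) = (\<Union>Y'\<in>cls Y. cls (\<lambda>n. X n \<odot> Y' n))"
  proof (rule UN_cls_const[OF X])
    fix X' assume "p_cauchy X'" "cls X' = cls X"
    then show "(\<Union>Y'\<in>cls Y. cls (\<lambda>n. X' n \<odot> Y' n)) = (\<Union>Y'\<in>cls Y. cls (\<lambda>n. X n \<odot> Y' n))"
      using inner[of X'] inner[OF X refl] by (simp only:)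
  qed
  then have "(\<Union>X'\<in>cls X. \<Union>Y'\<in>cls Y. cls (\<lambda>n. X' n \<odot> Y' n)) = cls (\<lambda>n. X n \<odot> Y n)"
    using inner[OF X refl] by (simp only:)
  then show ?thesis by (simp add: enveloping_cstar_def cls_def)
qed

lemma scale_cls:
  assumes X: "p_cauchy X"
  shows "alg_scale E c (cls X) = cls (\<lambda>n. scl c (X n))"
proof -
  have "cls (\<lambda>n. scl c (X' n)) = cls (\<lambda>n. scl c (X n))" if "p_cauchy X'" "cls X' = cls X" for X'
    using tendsto_mult_left[of "\<lambda>n. P (X' n - X n)" 0 sequentially "cmod c"] that X
    by (simp add: cls_eq_iff p_cauchy_scale p_scale closed p_cauchy_carrier flip: scale_diff)
  then have "(\<Union>X'\<in>cls X. cls (\<lambda>n. scl c (X' n))) = cls (\<lambda>n. scl c (X n))"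
    by (intro UN_cls_const[OF X]) auto
  then show ?thesis by (simp add: enveloping_cstar_def cls_def)
qed

lemma star_cls:
  assumes X: "p_cauchy X"
  shows "alg_star E (cls X) = cls (\<lambda>n. invol (X n))"
proof -
  have "cls (\<lambda>n. invol (X' n)) = cls (\<lambda>n. invol (X n))" if "p_cauchy X'" "cls X' = cls X" for X'
    using that X by (simp add: cls_eq_iff p_cauchy_star p_star closed p_cauchy_carrier flip: star_diff)
  then have "(\<Union>X'\<in>cls X. cls (\<lambda>n. invol (X' n))) = cls (\<lambda>n. invol (X n))"
    by (intro UN_cls_const[OF X]) auto
  then show ?thesis by (simp add: enveloping_cstar_def cls_def)
qed

lemma canonical_map_eq_cls: "canonical_map B x = cls (\<lambda>n. x)"
  by (simp add: canonical_map_def cls_def)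

text \<open>The continuous extension of a contractive additive map to the completion.\<close>

definition ext :: "('a \<Rightarrow> 'b::banach) \<Rightarrow> (nat \<Rightarrow> 'a) set \<Rightarrow> 'b" where
  "ext f C = lim (\<lambda>n. f ((SOME X. X \<in> C) n))"

lemma ext_tendsto:
  fixes f :: "'a \<Rightarrow> 'b::banach"
  assumes diff: "\<And>x y. x \<in> carr \<Longrightarrow> y \<in> carr \<Longrightarrow> f (x - y) = f x - f y"
    and bound: "\<And>x. x \<in> carr \<Longrightarrow> norm (f x) \<le> P x"
    and X: "p_cauchy X"
  shows "(\<lambda>n. f (X n)) \<longlonglongrightarrow> ext f (cls X)"
proof -
  have dist: "dist (f x) (f y) \<le> P (x - y)" if "x \<in> carr" "y \<in> carr" for x y
    using bound[of "x - y"] diff[OF that] that by (simp add: dist_norm closed)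
  define Y where "Y = (SOME Y. Y \<in> cls X)"
  have "Y \<in> cls X" unfolding Y_def using self_in_cls[OF X] by (rule someI[of "\<lambda>Y. Y \<in> cls X"])
  then have Y: "p_cauchy Y" "cls Y = cls X" using X by (auto simp: in_cls_iff)
  have "Cauchy (\<lambda>n. f (Y n))"
    unfolding Cauchy_def
  proof (intro allI impI)
    fix \<epsilon> :: real assume "0 < \<epsilon>"
    then obtain N where "\<And>m n. m \<ge> N \<Longrightarrow> n \<ge> N \<Longrightarrow> P (Y m - Y n) < \<epsilon>"
      using Y(1) unfolding p_cauchy_def by meson
    then show "\<exists>M. \<forall>m\<ge>M. \<forall>n\<ge>M. dist (f (Y m)) (f (Y n)) < \<epsilon>"
      using dist p_cauchy_carrier[OF Y(1)] by (meson order.strict_trans1)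
  qed
  then have "(\<lambda>n. f (Y n)) \<longlonglongrightarrow> ext f (cls X)"
    unfolding ext_def Y_def[symmetric] by (simp add: Cauchy_convergent_iff convergent_LIMSEQ_iff)
  moreover have "(\<lambda>n. f (X n) - f (Y n)) \<longlonglongrightarrow> 0"
  proof (rule tendsto_norm_zero_cancel, rule squeeze_to_0)
    show "(\<lambda>n. P (X n - Y n)) \<longlonglongrightarrow> 0" using X Y cls_eq_iff[of X Y] by simp
    show "norm (f (X n) - f (Y n)) \<le> P (X n - Y n)" for n
      using dist[of "X n" "Y n"] X Y by (simp add: dist_norm p_cauchy_carrier)
  qed simp
  ultimately show ?thesis using Lim_transform by fastforce
qed

end

section \<open>Operators on a Hilbert space\<close>

lemma scaleC_zero_left [simp]: "0 *\<^sub>C x = (0::'h::complex_normed_vector)"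
  using scaleC_add_left[of 0 0 x] by simp

lemma scaleC_zero_right [simp]: "c *\<^sub>C (0::'h::complex_normed_vector) = 0"
  using scaleC_add_right[of c 0 0] by simp

lemma scaleC_one [simp]: "1 *\<^sub>C x = (x::'h::complex_normed_vector)"
  using scaleC_of_real[of 1 x] by simp

lemma scaleC_minus_one: "(-1) *\<^sub>C x = - (x::'h::complex_normed_vector)"
  using scaleC_of_real[of "-1" x] by simp

lemma scaleC_minus_right: "c *\<^sub>C (- x) = - (c *\<^sub>C (x::'h::complex_normed_vector))"
  using scaleC_add_right[of c x "- x"] by (simp add: eq_neg_iff_add_eq_0 add.commute)

lemma scaleC_diff_right: "c *\<^sub>C (x - y) = c *\<^sub>C x - c *\<^sub>C (y::'h::complex_normed_vector)"
  using scaleC_add_right[of c x "- y"] by (simp add: scaleC_minus_right)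

lemma scaleC_scaleR: "c *\<^sub>C (r *\<^sub>R x) = r *\<^sub>R (c *\<^sub>C (x::'h::complex_normed_vector))"
  by (simp add: scaleC_scaleC mult.commute flip: scaleC_of_real)

lemma cinner_zero_left [simp]: "cinner 0 y = 0"
  using cinner_add_left[of 0 0 y] by simp

lemma cinner_minus_left: "cinner (- x) y = - cinner x y"
  using cinner_add_left[of x "- x" y] by (simp add: add_eq_0_iff)

lemma cinner_diff_left: "cinner (x - y) z = cinner x z - cinner y z"
  using cinner_add_left[of x "- y" z] by (simp add: cinner_minus_left)

lemma cinner_add_right: "cinner z (x + y) = cinner z x + cinner z y"
  using cinner_add_left[of x y z] by (metis cinner_commute complex_cnj_add)

lemma cinner_zero_right [simp]: "cinner y 0 = 0"
  using cinner_add_right[of y 0 0] by simp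

lemma cinner_minus_right: "cinner z (- x) = - cinner z x"
  using cinner_add_right[of z x "- x"] by (simp add: add_eq_0_iff)

lemma cinner_diff_right: "cinner z (x - y) = cinner z x - cinner z y"
  using cinner_add_right[of z x "- y"] by (simp add: cinner_minus_right)

lemma cinner_scaleC_right: "cinner x (c *\<^sub>C y) = cnj c * cinner x y"
  by (metis cinner_commute cinner_scaleC_left complex_cnj_mult)

lemma norm_eq_cinner: "(norm x)\<^sup>2 = Re (cinner x x)"
  by (simp add: cinner_self)

lemma cinner_eq_zero_imp: "(\<And>x. cinner x y = 0) \<Longrightarrow> y = 0"
  using cinner_self[of y] by simp

lemma cinner_left_eqI: "(\<And>x. cinner x y = cinner x z) \<Longrightarrow> y = z"
  using cinner_eq_zero_imp[of "y - z"] by (simp add: cinner_diff_right)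

lemma norm_add_square: "(norm (x + y))\<^sup>2 = (norm x)\<^sup>2 + 2 * Re (cinner x y) + (norm y)\<^sup>2"
  using cinner_commute[of y x] by (simp add: norm_eq_cinner cinner_add_left cinner_add_right)

lemma norm_diff_square: "(norm (x - y))\<^sup>2 = (norm x)\<^sup>2 - 2 * Re (cinner x y) + (norm y)\<^sup>2"
  using norm_add_square[of x "- y"] by (simp add: cinner_minus_right)

lemma parallelogram:
  fixes x y :: "'h::chilbert_space"
  shows "(norm (x + y))\<^sup>2 + (norm (x - y))\<^sup>2 = 2 * (norm x)\<^sup>2 + 2 * (norm y)\<^sup>2"
  by (simp add: norm_add_square norm_diff_square)

lemma cinner_scaleR_left: "cinner (r *\<^sub>R x) y = of_real r * cinner x y"
  by (simp add: cinner_scaleC_left flip: scaleC_of_real)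

lemma cinner_scaleR_right: "cinner x (r *\<^sub>R y) = of_real r * cinner x y"
  by (simp add: cinner_scaleC_right flip: scaleC_of_real)

lemma Re_cinner_le: "Re (cinner x y) \<le> norm x * norm y"
proof (cases "norm x = 0 \<or> norm y = 0")
  case True
  then show ?thesis by auto
next
  case False
  then have pos: "0 < norm x" "0 < norm y" by auto
  have "0 \<le> (norm (norm y *\<^sub>R x - norm x *\<^sub>R y))\<^sup>2" by simp
  also have "\<dots> = 2 * (norm x * norm y) * (norm x * norm y) - 2 * (norm x * norm y) * Re (cinner x y)"
    unfolding norm_diff_square by (simp add: cinner_scaleR_left cinner_scaleR_right power2_eq_square)
  finally have "(norm x * norm y) * Re (cinner x y) \<le> (norm x * norm y) * (norm x * norm y)" by simp
  then show ?thesis using pos by (simp add: mult_le_cancel_left_pos)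
qed

lemma cmod_cinner_le: "cmod (cinner x y) \<le> norm x * norm y"
proof (cases "cinner x y = 0")
  case False
  define c where "c = cnj (sgn (cinner x y))"
  have c: "cmod c = 1" using False by (simp add: c_def norm_sgn)
  have "c * cinner x y = of_real (cmod (cinner x y))"
    using False by (simp add: c_def sgn_eq complex_norm_square[symmetric] power2_eq_square mult.commute[of "cnj _"])
  then have "cmod (cinner x y) = Re (cinner (c *\<^sub>C x) y)" by (simp add: cinner_scaleC_left)
  also have "\<dots> \<le> norm (c *\<^sub>C x) * norm y" by (rule Re_cinner_le)
  finally show ?thesis by (simp add: norm_scaleC c)
qed simp

text \<open>The minimiser of \<open>x \<mapsto> (norm x)\<^sup>2 - 2 * Re (f x)\<close> represents \<open>f\<close>; minimising sequences
  are Cauchy by the parallelogram identity.\<close>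

lemma riesz_representation:
  fixes f :: "'h::chilbert_space \<Rightarrow> complex"
  assumes add: "\<And>x y. f (x + y) = f x + f y" and scale: "\<And>c x. f (c *\<^sub>C x) = c * f x"
    and bound: "\<And>x. cmod (f x) \<le> K * norm x"
  shows "\<exists>y. \<forall>x. f x = cinner x y"
proof -
  define F where "F x = (norm x)\<^sup>2 - 2 * Re (f x)" for x
  have scaleR: "f (r *\<^sub>R x) = of_real r * f x" for r x
    using scale[of "of_real r" x] by (simp add: scaleC_of_real)
  have lower: "- K\<^sup>2 \<le> F x" for x
  proof -
    have "Re (f x) \<le> K * norm x" using bound[of x] complex_Re_le_cmod order.trans by blast
    moreover have "0 \<le> (norm x - K)\<^sup>2" by simp
    ultimately show ?thesis by (simp add: F_def power2_eq_square algebra_simps)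
  qed
  define m where "m = Inf (range F)"
  have bdd: "bdd_below (range F)" using lower by (intro bdd_belowI2)
  have m_le: "m \<le> F x" for x unfolding m_def by (intro cInf_lower bdd) auto
  have "\<exists>x. F x < m + inverse (real (Suc n))" for n
  proof -
    have "\<exists>v\<in>range F. v < m + inverse (real (Suc n))"
      unfolding m_def by (rule cInf_lessD[OF _ less_add_same_cancel1[THEN iffD2]]) (auto simp: m_def)
    then show ?thesis by auto
  qed
  then obtain x where x: "\<And>n. F (x n) < m + inverse (real (Suc n))" by metis
  \<comment> \<open>The value of \<open>F\<close> at the midpoint of \<open>a\<close> and \<open>b\<close> is at least \<open>m\<close>.\<close>
  have mid: "(norm (a - b))\<^sup>2 \<le> 2 * (F a - m) + 2 * (F b - m)" for a b
  proof -
    define c where "c = (1/2) *\<^sub>R (a + b)"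
    have "(norm c)\<^sup>2 = (norm (a + b))\<^sup>2 / 4" by (simp add: c_def power_divide)
    moreover have "Re (f c) = (Re (f a) + Re (f b)) / 2" by (simp add: c_def scaleR add)
    ultimately show ?thesis
      using m_le[of c] parallelogram[of a b] by (simp add: F_def field_simps)
  qed
  have "Cauchy x"
  proof (rule CauchyI)
    fix \<epsilon> :: real assume "0 < \<epsilon>"
    then have "0 < \<epsilon>\<^sup>2 / 4" by simp
    then obtain N where N: "inverse (real (Suc N)) < \<epsilon>\<^sup>2 / 4" using reals_Archimedean by blast
    have "norm (x i - x j) < \<epsilon>" if "i \<ge> N" "j \<ge> N" for i j
    proof -
      have "F (x k) < m + inverse (real (Suc N))" if "k \<ge> N" for k
        by (rule order.strict_trans2[OF x]) (use that in simp)
      then have "F (x i) - m < \<epsilon>\<^sup>2 / 4" "F (x j) - m < \<epsilon>\<^sup>2 / 4" using that N by force+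
      then have "2 * (F (x i) - m) + 2 * (F (x j) - m) < \<epsilon>\<^sup>2" by simp
      then have "(norm (x i - x j))\<^sup>2 < \<epsilon>\<^sup>2" by (rule order.strict_trans1[OF mid])
      then show ?thesis using \<open>0 < \<epsilon>\<close> by (simp add: power2_less_imp_less)
    qed
    then show "\<exists>M. \<forall>m\<ge>M. \<forall>n\<ge>M. norm (x m - x n) < \<epsilon>" by blast
  qed
  then obtain y where y: "x \<longlonglongrightarrow> y" using Cauchy_convergent_iff convergent_def by blast
  have f_minus: "f (a - b) = f a - f b" for a b
    using add[of "a - b" b] by simp
  have f_lim: "(\<lambda>n. f (x n)) \<longlonglongrightarrow> f y"
  proof (rule Lim_null[THEN iffD2], rule tendsto_norm_zero_cancel, rule squeeze_to_0)
    show "cmod (f (x n) - f y) \<le> K * norm (x n - y)" for n using bound[of "x n - y"] by (simp add: f_minus)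
    show "(\<lambda>n. K * norm (x n - y)) \<longlonglongrightarrow> 0"
      using tendsto_mult_left[OF tendsto_norm_zero[OF LIM_zero[OF y]], of K] by simp
  qed simp
  have "(\<lambda>n. F (x n)) \<longlonglongrightarrow> F y" unfolding F_def by (intro tendsto_intros y f_lim)
  moreover have "(\<lambda>n. m + inverse (real (Suc n))) \<longlonglongrightarrow> m + 0"
    by (intro tendsto_intros LIMSEQ_inverse_real_of_nat)
  ultimately have Fy: "F y \<le> m" using x by (intro LIMSEQ_le[of "\<lambda>n. F (x n)"]) (auto intro: less_imp_le)
  have re: "Re (f z) = Re (cinner z y)" for z
  proof (rule ccontr)
    assume ne: "Re (f z) \<noteq> Re (cinner z y)"
    define D where "D = Re (cinner y z) - Re (f z)"
    have D: "D \<noteq> 0" using ne cinner_commute[of z y] by (simp add: D_def)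
    define t where "t = - D / ((norm z)\<^sup>2 + 1)"
    have pos: "0 < (norm z)\<^sup>2 + 1" by (simp add: add_nonneg_pos)
    have "F (y + t *\<^sub>R z) = F y + 2 * t * D + t\<^sup>2 * (norm z)\<^sup>2"
      by (simp add: F_def norm_add_square add scaleR cinner_scaleR_right D_def power_mult_distrib algebra_simps)
    moreover have "F y \<le> F (y + t *\<^sub>R z)" using Fy m_le[of "y + t *\<^sub>R z"] by linarith
    ultimately have "0 \<le> 2 * t * D + t\<^sup>2 * (norm z)\<^sup>2" by linarith
    also have "\<dots> \<le> 2 * t * D + t\<^sup>2 * ((norm z)\<^sup>2 + 1)" by (simp add: algebra_simps)
    also have "\<dots> = 2 * t * D + t * (t * ((norm z)\<^sup>2 + 1))"
      by (simp only: power2_eq_square[of t] mult.assoc)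
    also have "t * ((norm z)\<^sup>2 + 1) = - D" using pos by (simp add: t_def)
    also have "2 * t * D + t * (- D) = - (D\<^sup>2 / ((norm z)\<^sup>2 + 1))"
      by (simp add: t_def power2_eq_square)
    finally have "D\<^sup>2 / ((norm z)\<^sup>2 + 1) \<le> 0" by simp
    moreover have "0 < D\<^sup>2 / ((norm z)\<^sup>2 + 1)" using D pos by simp
    ultimately show False by linarith
  qed
  have "f z = cinner z y" for z
    using re[of z] re[of "\<i> *\<^sub>C z"] by (simp add: scale cinner_scaleC_left complex_eq_iff)
  then show ?thesis by blast
qed

abbreviation ap where "ap \<equiv> blinfun_apply"

lemma bounded_opsD: "T \<in> bounded_ops \<Longrightarrow> ap T (c *\<^sub>C x) = c *\<^sub>C ap T x"
  by (simp add: bounded_ops_def)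

lemma ap_add: "ap T (x + y) = ap T x + ap T y"
  and ap_diff: "ap T (x - y) = ap T x - ap T y"
  and ap_scaleR: "ap T (r *\<^sub>R x) = r *\<^sub>R ap T x"
  by (simp_all add: blinfun.bilinear_simps)

lemma adjoint_exists:
  fixes T :: "'h::chilbert_space \<Rightarrow>\<^sub>L 'h"
  assumes T: "T \<in> bounded_ops"
  shows "\<exists>S\<in>bounded_ops. \<forall>x y. cinner (ap T x) y = cinner x (ap S y)"
proof -
  have "\<exists>z. \<forall>x. cinner (ap T x) y = cinner x z" for y
  proof (rule riesz_representation)
    show "cmod (cinner (ap T x) y) \<le> (norm T * norm y) * norm x" for x
      using cmod_cinner_le[of "ap T x" y] norm_blinfun[of T x] mult_right_mono[of "norm (ap T x)" "norm T * norm x" "norm y"]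
      by (simp add: mult.commute mult.left_commute order.trans)
  qed (simp_all add: ap_add cinner_add_left bounded_opsD[OF T] cinner_scaleC_left)
  then obtain S where S: "\<And>x y. cinner (ap T x) y = cinner x (S y)" by metis
  have add: "S (y + z) = S y + S z" for y z
    by (rule cinner_left_eqI) (simp add: S[symmetric] cinner_add_right)
  have scaleC: "S (c *\<^sub>C y) = c *\<^sub>C S y" for c y
    by (rule cinner_left_eqI) (simp add: S[symmetric] cinner_scaleC_right)
  have bound: "norm (S y) \<le> norm y * norm T" for y
  proof (cases "norm (S y) = 0")
    case False
    have "norm (S y) * norm (S y) = Re (cinner (ap T (S y)) y)"
      using norm_eq_cinner[of "S y"] by (simp add: S power2_eq_square)
    also have "\<dots> \<le> norm (ap T (S y)) * norm y" by (rule Re_cinner_le)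
    also have "\<dots> \<le> (norm T * norm (S y)) * norm y" by (intro mult_right_mono norm_blinfun) auto
    finally have "norm (S y) * norm (S y) \<le> norm (S y) * (norm y * norm T)" by (simp add: algebra_simps)
    then show ?thesis using False by (simp add: mult_le_cancel_left_pos)
  qed simp
  have "bounded_linear S"
    by (rule bounded_linear_intro[of S "norm T"]) (simp_all add: add bound scaleC flip: scaleC_of_real)
  then have "ap (Blinfun S) = S" by (rule bounded_linear_Blinfun_apply)
  then show ?thesis using S scaleC by (intro bexI[of _ "Blinfun S"]) (auto simp: bounded_ops_def)
qed

lemma adj_unique:
  assumes "\<And>x y. cinner (ap T x) y = cinner x (ap S y)"
  shows "adj T = S"
  unfolding adj_def
proof (rule the_equality)
  fix S' assume S': "\<forall>x y. cinner (ap T x) y = cinner x (ap S' y)"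
  show "S' = S"
  proof (rule blinfun_eqI, rule cinner_left_eqI)
    fix x y show "cinner x (ap S' y) = cinner x (ap S y)" using S' assms by metis
  qed
qed (use assms in blast)

lemma
  assumes "T \<in> bounded_ops"
  shows adj_closed: "adj T \<in> bounded_ops"
    and cinner_adj_right: "cinner x (ap (adj T) y) = cinner (ap T x) y"
proof -
  obtain S where S: "S \<in> bounded_ops" "\<forall>x y. cinner (ap T x) y = cinner x (ap S y)"
    using adjoint_exists[OF assms] by blast
  then have "adj T = S" by (intro adj_unique) blast
  then show "adj T \<in> bounded_ops" "cinner x (ap (adj T) y) = cinner (ap T x) y" using S by auto
qed

lemma cinner_adj_left:
  assumes "T \<in> bounded_ops"
  shows "cinner (ap (adj T) x) y = cinner x (ap T y)"
  using cinner_adj_right[OF assms, of y x] by (metis cinner_commute)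

lemma ap_comp [simp]: "ap (S o\<^sub>L T) x = ap S (ap T x)"
  by simp

lemma ap_scale_op: 
  shows "ap (scale_op c T) x = c *\<^sub>C ap T (x::'h::chilbert_space)"
proof -
  have "bounded_linear (\<lambda>x. c *\<^sub>C ap T x)"
  proof (rule bounded_linear_intro[of _ "cmod c * norm T"])
    show "norm (c *\<^sub>C ap T x) \<le> norm x * (cmod c * norm T)" for x
      using mult_left_mono[OF norm_blinfun[of T x], of "cmod c"] by (simp add: norm_scaleC algebra_simps)
  qed (simp_all add: ap_add ap_scaleR scaleC_add_right scaleC_scaleR)
  then show ?thesis by (simp add: scale_op_def bounded_linear_Blinfun_apply)
qed

lemma scale_op_of_real: "scale_op (of_real r) T = r *\<^sub>R (T :: 'h::chilbert_space \<Rightarrow>\<^sub>L 'h)"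
  by (rule blinfun_eqI) (simp only: ap_scale_op scaleC_of_real scaleR_blinfun.rep_eq)

lemma bounded_ops_closed:
  shows "0 \<in> bounded_ops"
    and "id_blinfun \<in> bounded_ops"
    and "S \<in> bounded_ops \<Longrightarrow> T \<in> bounded_ops \<Longrightarrow> S + T \<in> bounded_ops"
    and "S \<in> bounded_ops \<Longrightarrow> T \<in> bounded_ops \<Longrightarrow> S - T \<in> bounded_ops"
    and "S \<in> bounded_ops \<Longrightarrow> T \<in> bounded_ops \<Longrightarrow> S o\<^sub>L T \<in> bounded_ops"
    and "T \<in> bounded_ops \<Longrightarrow> scale_op c T \<in> bounded_ops"
  by (simp_all add: bounded_ops_def blinfun.bilinear_simps scaleC_add_right scaleC_diff_right ap_scale_op
      scaleC_scaleC mult.commute)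

lemma op_sum_closed: "(\<And>i. i \<in> A \<Longrightarrow> T i \<in> bounded_ops) \<Longrightarrow> (\<Sum>i\<in>A. T i) \<in> bounded_ops"
  by (induction A rule: infinite_finite_induct) (auto simp: bounded_ops_closed)

lemmas op_closed = bounded_ops_closed adj_closed

lemma adj_adj: "T \<in> bounded_ops \<Longrightarrow> adj (adj T) = T"
  by (rule adj_unique) (simp add: cinner_adj_left)

lemma adj_comp: "S \<in> bounded_ops \<Longrightarrow> T \<in> bounded_ops \<Longrightarrow> adj (S o\<^sub>L T) = adj T o\<^sub>L adj S"
  by (rule adj_unique) (simp add: cinner_adj_right)

lemma adj_add: "S \<in> bounded_ops \<Longrightarrow> T \<in> bounded_ops \<Longrightarrow> adj (S + T) = adj S + adj T"
  by (rule adj_unique) (simp add: cinner_adj_right blinfun.bilinear_simps cinner_add_left cinner_add_right)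

lemma adj_diff: "S \<in> bounded_ops \<Longrightarrow> T \<in> bounded_ops \<Longrightarrow> adj (S - T) = adj S - adj T"
  by (rule adj_unique) (simp add: cinner_adj_right blinfun.bilinear_simps cinner_diff_left cinner_diff_right)

lemma adj_id: "adj id_blinfun = id_blinfun"
  by (rule adj_unique) simp

lemma adj_zero: "adj 0 = 0"
  by (rule adj_unique) simp

lemma norm_ap_le: "norm (ap T x) \<le> norm T * norm x"
  by (rule norm_blinfun)

lemma op_norm_le: "0 \<le> K \<Longrightarrow> (\<And>x. norm (ap T x) \<le> K * norm x) \<Longrightarrow> norm T \<le> K"
  by (rule norm_blinfun_bound)

lemma norm_comp_le: "norm (S o\<^sub>L T) \<le> norm S * norm T"
  by (rule norm_blinfun_compose)

lemma norm_scale_op: "norm (scale_op c T) = cmod c * norm (T :: 'h::chilbert_space \<Rightarrow>\<^sub>L 'h)"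
proof -
  have le: "norm (scale_op c T) \<le> cmod c * norm T" for c :: complex and T :: "'h \<Rightarrow>\<^sub>L 'h"
  proof (rule op_norm_le)
    show "norm (ap (scale_op c T) x) \<le> cmod c * norm T * norm x" for x
      using mult_left_mono[OF norm_ap_le[of T x], of "cmod c"] by (simp add: ap_scale_op norm_scaleC mult.assoc)
  qed simp
  show ?thesis
  proof (cases "c = 0")
    case True
    then show ?thesis using le[of 0 T] by simp
  next
    case False
    have "scale_op (1 / c) (scale_op c T) = T"
      using False by (intro blinfun_eqI) (simp add: ap_scale_op scaleC_scaleC)
    then have "norm T \<le> cmod (1 / c) * norm (scale_op c T)" using le[of "1 / c" "scale_op c T"] by simp
    then have "cmod c * norm T \<le> norm (scale_op c T)" using False by (simp add: norm_divide field_simps)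
    then show ?thesis using le[of c T] by simp
  qed
qed

lemma norm_ap_square_le: "T \<in> bounded_ops \<Longrightarrow> (norm (ap T x))\<^sup>2 \<le> norm (adj T o\<^sub>L T) * (norm x)\<^sup>2"
proof -
  assume T: "T \<in> bounded_ops"
  have "(norm (ap T x))\<^sup>2 = Re (cinner (ap (adj T o\<^sub>L T) x) x)"
    using T by (simp add: norm_eq_cinner cinner_adj_left)
  also have "\<dots> \<le> norm (ap (adj T o\<^sub>L T) x) * norm x" by (rule Re_cinner_le)
  also have "\<dots> \<le> (norm (adj T o\<^sub>L T) * norm x) * norm x" by (intro mult_right_mono norm_ap_le) simp
  finally show ?thesis by (simp add: power2_eq_square mult.assoc)
qed

lemma norm_le_of_adj_comp: "T \<in> bounded_ops \<Longrightarrow> (norm T)\<^sup>2 \<le> norm (adj T o\<^sub>L T)"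
proof -
  assume T: "T \<in> bounded_ops"
  have "norm T \<le> sqrt (norm (adj T o\<^sub>L T))"
  proof (rule op_norm_le)
    show "norm (ap T x) \<le> sqrt (norm (adj T o\<^sub>L T)) * norm x" for x
      using real_le_rsqrt[OF norm_ap_square_le[OF T, of x]] by (simp add: real_sqrt_mult)
  qed simp
  then have "(norm T)\<^sup>2 \<le> (sqrt (norm (adj T o\<^sub>L T)))\<^sup>2" by (intro power_mono) auto
  then show ?thesis by simp
qed

lemma norm_adj: "T \<in> bounded_ops \<Longrightarrow> norm (adj T) = norm T"
proof -
  have le: "norm T \<le> norm (adj T)" if T: "T \<in> bounded_ops" for T :: "'a \<Rightarrow>\<^sub>L 'a"
  proof (cases "norm T = 0")
    case False
    have "norm T * norm T \<le> norm (adj T) * norm T"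
      using norm_le_of_adj_comp[OF T] norm_comp_le[of "adj T" T] by (simp add: power2_eq_square)
    then show ?thesis using False by (simp add: mult_le_cancel_right_pos)
  qed simp
  then show "T \<in> bounded_ops \<Longrightarrow> norm (adj T) = norm T"
    using le[of T] le[of "adj T"] by (intro antisym) (simp_all add: adj_adj adj_closed)
qed

lemma norm_adj_comp: "T \<in> bounded_ops \<Longrightarrow> norm (adj T o\<^sub>L T) = (norm T)\<^sup>2"
  using norm_le_of_adj_comp[of T] norm_comp_le[of "adj T" T] by (simp add: norm_adj power2_eq_square)

lemma adj_tendsto:
  assumes "\<And>n. T n \<in> bounded_ops" "S \<in> bounded_ops" "T \<longlonglongrightarrow> S"
  shows "(\<lambda>n. adj (T n)) \<longlonglongrightarrow> adj S"
proof -
  have "norm (adj (T n) - adj S) = norm (T n - S)" for n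
    using assms by (simp add: norm_adj op_closed flip: adj_diff)
  then show ?thesis using assms(3) by (simp add: tendsto_iff dist_norm)
qed

lemma scale_op_tendsto:
  fixes T :: "nat \<Rightarrow> 'h::chilbert_space \<Rightarrow>\<^sub>L 'h"
  assumes "T \<longlonglongrightarrow> S"
  shows "(\<lambda>n. scale_op c (T n)) \<longlonglongrightarrow> scale_op c S"
proof -
  have "scale_op c (T n) - scale_op c S = scale_op c (T n - S)" for n
    by (rule blinfun_eqI) (simp add: ap_scale_op blinfun.bilinear_simps scaleC_diff_right)
  then have eq: "norm (scale_op c (T n) - scale_op c S) = cmod c * norm (T n - S)" for n
    by (simp add: norm_scale_op)
  have "(\<lambda>n. cmod c * norm (T n - S)) \<longlonglongrightarrow> cmod c * 0"
    by (intro tendsto_mult tendsto_const tendsto_norm_zero LIM_zero assms)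
  then have "(\<lambda>n. norm (scale_op c (T n) - scale_op c S)) \<longlonglongrightarrow> 0" by (simp only: eq mult_zero_right)
  then show ?thesis by (rule LIM_zero_cancel[OF tendsto_norm_zero_cancel])
qed

lemma comp_tendsto: "S \<longlonglongrightarrow> S' \<Longrightarrow> T \<longlonglongrightarrow> T' \<Longrightarrow> (\<lambda>n. S n o\<^sub>L T n) \<longlonglongrightarrow> (S' o\<^sub>L T')"
  by (intro tendsto_intros)

lemma closed_bounded_ops: "closed (bounded_ops :: ('h::chilbert_space \<Rightarrow>\<^sub>L 'h) set)"
  unfolding closed_sequential_limits
proof (intro allI impI, elim conjE)
  fix T :: "nat \<Rightarrow> 'h \<Rightarrow>\<^sub>L 'h" and S assume T: "\<forall>n. T n \<in> bounded_ops" "T \<longlonglongrightarrow> S"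
  show "S \<in> bounded_ops"
    unfolding bounded_ops_def
  proof (intro CollectI allI)
    fix c x
    have "(\<lambda>n. ap (T n) (c *\<^sub>C x)) \<longlonglongrightarrow> ap S (c *\<^sub>C x)" by (intro tendsto_intros T)
    moreover have "(\<lambda>n. ap (scale_op c (T n)) x) \<longlonglongrightarrow> ap (scale_op c S) x"
      by (intro tendsto_intros scale_op_tendsto T)
    moreover have "ap (scale_op c (T n)) x = ap (T n) (c *\<^sub>C x)" for n
      using T by (simp add: ap_scale_op bounded_opsD)
    ultimately show "ap S (c *\<^sub>C x) = c *\<^sub>C ap S x"
      using LIMSEQ_unique by (simp add: ap_scale_op) blast
  qed
qed

text \<open>The number \<open>(norm T)\<^sup>2\<close> is an approximate eigenvalue of \<open>T T\<close>: if \<open>norm (T x)\<close> is nearly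
  \<open>norm T * norm x\<close>, then \<open>l\<^sup>2 x - T (T x)\<close> is nearly 0, as expanding the square shows. A left inverse
  \<open>W\<close> excludes this and would give \<open>(norm T)\<^sup>2 \<le> l\<^sup>2 - d\<close> with a positive \<open>d\<close> that depends on \<open>W\<close>.\<close>

lemma no_left_inverse_at_norm:
  fixes T :: "'h::chilbert_space \<Rightarrow>\<^sub>L 'h"
  assumes T: "T \<in> bounded_ops" "adj T = T" and pos: "0 < norm T"
    and W: "W o\<^sub>L (id_blinfun - scale_op (of_real (1 / (norm T)\<^sup>2)) (T o\<^sub>L T)) = id_blinfun"
  shows False
proof -
  define l where "l = norm T"
  have l: "0 < l" using pos by (simp add: l_def)
  have TT: "norm (ap T (ap T x)) \<le> l * norm (ap T x)" "norm (ap T x) \<le> l * norm x" for x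
    by (auto simp: l_def norm_ap_le)
  have key: "(norm (l\<^sup>2 *\<^sub>R x - ap T (ap T x)))\<^sup>2 \<le> 2 * l\<^sup>2 * (l\<^sup>2 * (norm x)\<^sup>2 - (norm (ap T x))\<^sup>2)" for x
  proof -
    have "Re (cinner x (ap T (ap T x))) = (norm (ap T x))\<^sup>2"
      using cinner_adj_right[OF T(1), of x "ap T x"] by (simp add: T(2) norm_eq_cinner)
    then have "(norm (l\<^sup>2 *\<^sub>R x - ap T (ap T x)))\<^sup>2
        = l\<^sup>2 * (l\<^sup>2 * (norm x)\<^sup>2) - 2 * (l\<^sup>2 * (norm (ap T x))\<^sup>2) + (norm (ap T (ap T x)))\<^sup>2"
      by (simp add: norm_diff_square cinner_scaleR_left power_mult_distrib)
    moreover have "(norm (ap T (ap T x)))\<^sup>2 \<le> (l * (l * norm x))\<^sup>2"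
      using TT[of x] l by (intro power_mono order.trans[OF TT(1) mult_left_mono]) auto
    then have "(norm (ap T (ap T x)))\<^sup>2 \<le> l\<^sup>2 * (l\<^sup>2 * (norm x)\<^sup>2)"
      by (simp only: power_mult_distrib)
    moreover have "2 * l\<^sup>2 * (l\<^sup>2 * (norm x)\<^sup>2 - (norm (ap T x))\<^sup>2)
        = 2 * (l\<^sup>2 * (l\<^sup>2 * (norm x)\<^sup>2)) - 2 * (l\<^sup>2 * (norm (ap T x))\<^sup>2)"
      by (simp only: right_diff_distrib mult.assoc)
    ultimately show ?thesis by linarith
  qed
  define C where "C = norm W + 1"
  have C: "0 < C" by (simp add: C_def add_nonneg_pos)
  have lowerbd: "l\<^sup>2 * norm x \<le> C * norm (l\<^sup>2 *\<^sub>R x - ap T (ap T x))" for x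
  proof -
    have "ap W (l\<^sup>2 *\<^sub>R x - ap T (ap T x)) = l\<^sup>2 *\<^sub>R ap (W o\<^sub>L (id_blinfun - scale_op (of_real (1 / l\<^sup>2)) (T o\<^sub>L T))) x"
      unfolding scale_op_of_real ap_comp using l by (simp add: blinfun.bilinear_simps scaleR_diff_right)
    also have "\<dots> = l\<^sup>2 *\<^sub>R x" using W by (simp add: l_def)
    finally have "l\<^sup>2 * norm x = norm (ap W (l\<^sup>2 *\<^sub>R x - ap T (ap T x)))" by simp
    also have "\<dots> \<le> norm W * norm (l\<^sup>2 *\<^sub>R x - ap T (ap T x))" by (rule norm_ap_le)
    also have "\<dots> \<le> C * norm (l\<^sup>2 *\<^sub>R x - ap T (ap T x))" by (intro mult_right_mono) (auto simp: C_def)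
    finally show ?thesis .
  qed
  define d where "d = l\<^sup>2 / (2 * C\<^sup>2)"
  have d: "0 < d" using l C by (simp add: d_def)
  have sq: "(norm (ap T x))\<^sup>2 \<le> (l\<^sup>2 - d) * (norm x)\<^sup>2" for x
  proof -
    have "(l\<^sup>2 * norm x)\<^sup>2 \<le> (C * norm (l\<^sup>2 *\<^sub>R x - ap T (ap T x)))\<^sup>2"
      using lowerbd[of x] by (intro power_mono) auto
    also have "\<dots> \<le> C\<^sup>2 * (2 * l\<^sup>2 * (l\<^sup>2 * (norm x)\<^sup>2 - (norm (ap T x))\<^sup>2))"
      unfolding power_mult_distrib using key[of x] by (intro mult_left_mono) auto
    finally have "l\<^sup>2 * (l\<^sup>2 * (norm x)\<^sup>2) \<le> l\<^sup>2 * (2 * C\<^sup>2 * (l\<^sup>2 * (norm x)\<^sup>2 - (norm (ap T x))\<^sup>2))"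
      by (simp add: power_mult_distrib algebra_simps power2_eq_square)
    then have "l\<^sup>2 * (norm x)\<^sup>2 \<le> 2 * C\<^sup>2 * (l\<^sup>2 * (norm x)\<^sup>2 - (norm (ap T x))\<^sup>2)"
      by (rule mult_left_le_imp_le) (use l in simp)
    then show ?thesis using C by (simp add: d_def field_simps)
  qed
  have "0 \<le> l\<^sup>2 - d"
  proof (rule ccontr)
    assume "\<not> 0 \<le> l\<^sup>2 - d"
    then have "(norm (ap T x))\<^sup>2 \<le> 0" for x using sq[of x] by (smt (verit) mult_nonpos_nonneg zero_le_power2)
    then have "ap T x = 0" for x by simp
    then have "T = 0" by (intro blinfun_eqI) simp
    then show False using pos by simp
  qed
  then have "norm T \<le> sqrt (l\<^sup>2 - d)"
    using real_le_rsqrt[OF sq] by (intro op_norm_le) (auto simp: real_sqrt_mult)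
  then have "l\<^sup>2 \<le> (sqrt (l\<^sup>2 - d))\<^sup>2" using l by (intro power_mono) (auto simp: l_def)
  then show False using \<open>0 \<le> l\<^sup>2 - d\<close> d by simp
qed

text \<open>An operator that commutes with a projection \<open>Q\<close> is the orthogonal sum of its restrictions to the ranges of
  \<open>Q\<close> and \<open>1 - Q\<close>.\<close>

lemma norm_max_projection:
  fixes Q T :: "'h::chilbert_space \<Rightarrow>\<^sub>L 'h"
  assumes Q: "Q \<in> bounded_ops" "adj Q = Q" "Q o\<^sub>L Q = Q"
    and T: "T \<in> bounded_ops" and comm: "Q o\<^sub>L T = T o\<^sub>L Q"
  shows "norm T = max (norm ((id_blinfun - Q) o\<^sub>L T)) (norm (Q o\<^sub>L T))"
proof (rule antisym)
  let ?M = "max (norm ((id_blinfun - Q) o\<^sub>L T)) (norm (Q o\<^sub>L T))"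
  have QQ: "ap Q (ap Q x) = ap Q x" and QT: "ap Q (ap T x) = ap T (ap Q x)" for x
    using arg_cong[OF Q(3), of "\<lambda>S. ap S x"] arg_cong[OF comm, of "\<lambda>S. ap S x"] by auto
  have orth: "Re (cinner (x - ap Q x) (ap Q y)) = 0" for x y
    using cinner_adj_right[OF Q(1), of "x - ap Q x" y] by (simp add: Q(2) ap_diff QQ)
  have pyth: "(norm x)\<^sup>2 = (norm (x - ap Q x))\<^sup>2 + (norm (ap Q x))\<^sup>2" for x
    using norm_add_square[of "x - ap Q x" "ap Q x"] orth[of x x] by simp
  have 1: "norm (ap T x - ap Q (ap T x)) \<le> ?M * norm (x - ap Q x)" for x
  proof -
    have "ap T x - ap Q (ap T x) = ap ((id_blinfun - Q) o\<^sub>L T) (x - ap Q x)"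
      by (simp add: blinfun.bilinear_simps QT QQ)
    then have "norm (ap T x - ap Q (ap T x)) \<le> norm ((id_blinfun - Q) o\<^sub>L T) * norm (x - ap Q x)"
      by (metis norm_ap_le)
    also have "\<dots> \<le> ?M * norm (x - ap Q x)" by (intro mult_right_mono) auto
    finally show ?thesis .
  qed
  have 2: "norm (ap Q (ap T x)) \<le> ?M * norm (ap Q x)" for x
  proof -
    have "ap Q (ap T x) = ap (Q o\<^sub>L T) (ap Q x)"
      by (simp add: QT QQ)
    then have "norm (ap Q (ap T x)) \<le> norm (Q o\<^sub>L T) * norm (ap Q x)"
      by (metis norm_ap_le)
    also have "\<dots> \<le> ?M * norm (ap Q x)" by (intro mult_right_mono) auto
    finally show ?thesis .
  qed
  show "norm T \<le> ?M"
  proof (rule op_norm_le)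
    fix x
    have "(norm (ap T x))\<^sup>2 = (norm (ap T x - ap Q (ap T x)))\<^sup>2 + (norm (ap Q (ap T x)))\<^sup>2"
      by (rule pyth)
    also have "\<dots> \<le> (?M * norm (x - ap Q x))\<^sup>2 + (?M * norm (ap Q x))\<^sup>2"
      using 1[of x] 2[of x] by (intro add_mono power_mono) auto
    also have "\<dots> = (?M * norm x)\<^sup>2" unfolding power_mult_distrib pyth[of x] by (simp add: distrib_left)
    finally show "norm (ap T x) \<le> ?M * norm x" by (rule power2_le_imp_le) (simp add: le_max_iff_disj)
  qed (simp add: le_max_iff_disj)
  have contr: "norm (x - ap Q x) \<le> norm x" "norm (ap Q x) \<le> norm x" for x
    by (rule power2_le_imp_le; simp add: pyth[of x])+
  have "norm (ap ((id_blinfun - Q) o\<^sub>L T) x) \<le> norm T * norm x" for x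
    using order.trans[OF contr(1) norm_ap_le, of T x] by (simp add: blinfun.bilinear_simps)
  then have "norm ((id_blinfun - Q) o\<^sub>L T) \<le> norm T" by (intro op_norm_le) auto
  moreover have "norm (ap (Q o\<^sub>L T) x) \<le> norm T * norm x" for x
    using order.trans[OF contr(2) norm_ap_le, of T x] by simp
  then have "norm (Q o\<^sub>L T) \<le> norm T" by (intro op_norm_le) auto
  ultimately show "?M \<le> norm T" by simp
qed

text \<open>Each summand is a positive operator, so the quadratic form of the sum dominates that of the \<open>i\<close>-th one.\<close>

lemma norm_le_norm_sum_adj:
  fixes T :: "'i \<Rightarrow> 'h::chilbert_space \<Rightarrow>\<^sub>L 'h"
  assumes T: "\<And>k. k \<in> A \<Longrightarrow> T k \<in> bounded_ops" and A: "finite A" "i \<in> A"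
  shows "(norm (T i))\<^sup>2 \<le> norm (\<Sum>k\<in>A. T k o\<^sub>L adj (T k))"
proof -
  let ?S = "\<Sum>k\<in>A. T k o\<^sub>L adj (T k)"
  have "(norm (ap (adj (T i)) x))\<^sup>2 \<le> norm ?S * (norm x)\<^sup>2" for x
  proof -
    have eq: "Re (cinner (ap (T k) (ap (adj (T k)) x)) x) = (norm (ap (adj (T k)) x))\<^sup>2" if "k \<in> A" for k
      using cinner_adj_right[OF T[OF that], of "ap (adj (T k)) x" x] by (simp add: norm_eq_cinner)
    have cs: "cinner (\<Sum>k\<in>A. f k) x = (\<Sum>k\<in>A. cinner (f k) x)" for f :: "'i \<Rightarrow> 'h"
      using A(1) by induction (auto simp: cinner_add_left)
    have "(norm (ap (adj (T i)) x))\<^sup>2 \<le> (\<Sum>k\<in>A. (norm (ap (adj (T k)) x))\<^sup>2)"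
      using A by (intro member_le_sum) auto
    also have "\<dots> = Re (cinner (ap ?S x) x)"
      by (simp add: blinfun.sum_left cs eq)
    also have "\<dots> \<le> norm (ap ?S x) * norm x" by (rule Re_cinner_le)
    also have "\<dots> \<le> (norm ?S * norm x) * norm x" by (intro mult_right_mono norm_ap_le) simp
    finally show ?thesis by (simp add: power2_eq_square mult.assoc)
  qed
  note le = this
  have "norm (adj (T i)) \<le> sqrt (norm ?S)"
  proof (rule op_norm_le)
    show "norm (ap (adj (T i)) x) \<le> sqrt (norm ?S) * norm x" for x
      using real_le_rsqrt[OF le[of x]] by (simp only: real_sqrt_mult real_sqrt_abs abs_norm_cancel)
  qed (rule real_sqrt_ge_zero[OF norm_ge_zero])
  then have "(norm (T i))\<^sup>2 \<le> (sqrt (norm ?S))\<^sup>2"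
    unfolding norm_adj[OF T[OF A(2)]] by (rule power_mono) (rule norm_ge_zero)
  then show ?thesis by simp
qed

section \<open>The matrix algebra\<close>

lemma star_zero_type [simp]: "star (0::'a::unital_cstar_algebra) = 0"
  using star_add[of "0::'a" 0] by simp

lemma star_one_type [simp]: "star (1::'a::unital_cstar_algebra) = 1"
  using star_mult[of "star 1" "1::'a"] by (simp add: star_star)

context unital_star_algebra
begin

lemma sum_closed: "(\<And>k. k \<in> A \<Longrightarrow> f k \<in> carr) \<Longrightarrow> (\<Sum>k\<in>A. f k) \<in> carr"
  by (induction A rule: infinite_finite_induct) (auto simp: closed)

lemma mult_sum_left: "(\<And>k. k \<in> A \<Longrightarrow> f k \<in> carr) \<Longrightarrow> y \<in> carr \<Longrightarrow> (\<Sum>k\<in>A. f k) \<odot> y = (\<Sum>k\<in>A. f k \<odot> y)"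
  by (induction A rule: infinite_finite_induct) (auto simp: mult_zero_left mult_add_left sum_closed)

lemma mult_sum_right: "(\<And>k. k \<in> A \<Longrightarrow> f k \<in> carr) \<Longrightarrow> y \<in> carr \<Longrightarrow> y \<odot> (\<Sum>k\<in>A. f k) = (\<Sum>k\<in>A. y \<odot> f k)"
  by (induction A rule: infinite_finite_induct) (auto simp: mult_zero_right mult_add_right sum_closed)

lemma star_sum: "(\<And>k. k \<in> A \<Longrightarrow> f k \<in> carr) \<Longrightarrow> invol (\<Sum>k\<in>A. f k) = (\<Sum>k\<in>A. invol (f k))"
  by (induction A rule: infinite_finite_induct) (auto simp: star_zero star_plus sum_closed)

end

context cstar_seminormed_algebra
begin

lemma p_sum: "(\<And>k. k \<in> A \<Longrightarrow> f k \<in> carr) \<Longrightarrow> p (\<Sum>k\<in>A. f k) \<le> (\<Sum>k\<in>A. p (f k))"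
proof (induction A rule: infinite_finite_induct)
  case (insert k A)
  then show ?case using p_add[of "f k" "\<Sum>k\<in>A. f k"] by (simp add: sum_closed)
qed (simp_all add: p_zero)

end

lemma suminf_single: "(\<And>k. k \<noteq> j \<Longrightarrow> f k = 0) \<Longrightarrow> (\<Sum>k. f k) = (f j :: 'b::{t2_space,comm_monoid_add})"
  using suminf_finite[of "{j}" f] by simp

definition single :: "nat \<Rightarrow> nat \<Rightarrow> 'b \<Rightarrow> ('b::zero) inf_matrix" where
  "single i j x = (\<lambda>m n. if m = i \<and> n = j then x else 0)"

lemma mat_embed_eq_single: "mat_embed a = single 0 0 a"
  by (simp add: mat_embed_def single_def)

lemma mat_u_eq_single: "mat_u \<delta> = single 0 1 (\<delta> 1)"
  by (simp add: mat_u_def single_def)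

text \<open>The entries \<open>(i, j)\<close> with \<open>j - i = k\<close> form the \<open>k\<close>-th diagonal; it corresponds to the power \<open>U^k\<close>.\<close>

definition diags_in :: "int set \<Rightarrow> ('b::zero) inf_matrix \<Rightarrow> bool" where
  "diags_in K a \<longleftrightarrow> (\<forall>i j. a i j \<noteq> 0 \<longrightarrow> int j - int i \<in> K)"

definition diag_part :: "int \<Rightarrow> ('b::zero) inf_matrix \<Rightarrow> 'b inf_matrix" where
  "diag_part k a = (\<lambda>i j. if int j - int i = k then a i j else 0)"

definition gauge :: "complex \<Rightarrow> ('b::complex_normed_vector) inf_matrix \<Rightarrow> 'b inf_matrix" where
  "gauge z a = (\<lambda>i j. (z ^ j * cnj z ^ i) *\<^sub>C a i j)"

locale cstar_dynamics =
  fixes \<delta> :: "'a::unital_cstar_algebra \<Rightarrow> 'a"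
  assumes dynamical_system: "cstar_dynamical_system \<delta>"
begin

lemma endo_add: "\<delta> (x + y) = \<delta> x + \<delta> y"
  and endo_mult: "\<delta> (x * y) = \<delta> x * \<delta> y"
  and endo_scale: "\<delta> (c *\<^sub>C x) = c *\<^sub>C \<delta> x"
  and endo_star: "\<delta> (star x) = star (\<delta> x)"
  using dynamical_system by (simp_all add: cstar_dynamical_system_def star_hom_def type_algebra_def)

lemma endo_zero [simp]: "\<delta> 0 = 0"
  using endo_add[of 0 0] by simp

lemma iter_zero [simp]: "(\<delta> ^^ n) 0 = 0"
  and iter_add: "(\<delta> ^^ n) (x + y) = (\<delta> ^^ n) x + (\<delta> ^^ n) y"
  and iter_mult: "(\<delta> ^^ n) (x * y) = (\<delta> ^^ n) x * (\<delta> ^^ n) y"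
  and iter_scale: "(\<delta> ^^ n) (c *\<^sub>C x) = c *\<^sub>C (\<delta> ^^ n) x"
  and iter_star: "(\<delta> ^^ n) (star x) = star ((\<delta> ^^ n) x)"
  by (induction n) (simp_all add: endo_add endo_mult endo_scale endo_star)

lemma iter_iter: "(\<delta> ^^ m) ((\<delta> ^^ n) x) = (\<delta> ^^ (m + n)) x"
  by (simp add: funpow_add)

abbreviation q where "q n \<equiv> (\<delta> ^^ n) 1"

lemma star_q: "star (q n) = q n"
  using iter_star[of n 1] by simp

lemma q_absorb: "m \<le> n \<Longrightarrow> q m * q n = q n" "m \<le> n \<Longrightarrow> q n * q m = q n"
  using iter_mult[of m 1 "q (n - m)"] iter_mult[of m "q (n - m)" 1] by (simp_all add: iter_iter)

abbreviation M where "M \<equiv> matrices \<delta>"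

definition corner :: "nat \<Rightarrow> nat \<Rightarrow> 'a \<Rightarrow> bool" where
  "corner i j x \<longleftrightarrow> q i * x = x \<and> x * q j = x"

lemma corner_iff: "x \<in> {q i * y * q j | y. True} \<longleftrightarrow> corner i j x"
proof
  assume "x \<in> {q i * y * q j | y. True}"
  then obtain y where "x = q i * y * q j" by blast
  then show "corner i j x"
    by (simp add: corner_def mult.assoc q_absorb) (simp add: q_absorb flip: mult.assoc)
next
  assume "corner i j x"
  then have "x = q i * x * q j" by (simp add: corner_def)
  then show "x \<in> {q i * y * q j | y. True}" by blast
qed

lemma corner_zero: "corner i j 0"
  by (simp add: corner_def)

lemma corner_add: "corner i j x \<Longrightarrow> corner i j y \<Longrightarrow> corner i j (x + y)"
  by (simp add: corner_def distrib_left distrib_right)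

lemma corner_scale: "corner i j x \<Longrightarrow> corner i j (c *\<^sub>C x)"
  by (simp add: corner_def mult_scaleC_left mult_scaleC_right)

lemma corner_star: "corner i j x \<Longrightarrow> corner j i (star x)"
  unfolding corner_def by (metis star_mult star_q)

lemma corner_iter: "corner i j x \<Longrightarrow> corner (n + i) (n + j) ((\<delta> ^^ n) x)"
  unfolding corner_def by (metis iter_iter iter_mult)

lemma corner_mult: "corner i j x \<Longrightarrow> corner k l y \<Longrightarrow> corner i l (x * y)"
  unfolding corner_def by (metis mult.assoc)

lemma corner_mono: "corner i j x \<Longrightarrow> i' \<le> i \<Longrightarrow> j' \<le> j \<Longrightarrow> corner i' j' x"
  unfolding corner_def using q_absorb by (metis mult.assoc)

lemma matrices_iff: "a \<in> M \<longleftrightarrow> finite {(i, j). a i j \<noteq> 0} \<and> (\<forall>i j. corner i j (a i j))"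
  unfolding matrices_def corner_iff by (rule mem_Collect_eq)

lemma M_corner: "a \<in> M \<Longrightarrow> corner i j (a i j)"
  by (simp add: matrices_iff)

lemma M_zero: "0 \<in> M"
  by (simp add: matrices_iff corner_zero)

lemma M_single: "corner i j x \<Longrightarrow> single i j x \<in> M"
  by (auto simp: matrices_iff single_def corner_zero intro: finite_subset[of _ "{(i, j)}"])

lemma M_add: "a \<in> M \<Longrightarrow> b \<in> M \<Longrightarrow> a + b \<in> M"
proof -
  assume a: "a \<in> M" and b: "b \<in> M"
  have "{(i, j). (a + b) i j \<noteq> 0} \<subseteq> {(i, j). a i j \<noteq> 0} \<union> {(i, j). b i j \<noteq> 0}" by auto
  then show ?thesis using a b finite_subset by (fastforce simp: matrices_iff corner_add)
qed

lemma M_entrywise: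
  assumes a: "a \<in> M" and f: "\<And>i j. corner i j (a i j) \<Longrightarrow> corner i j (f i j (a i j))" "\<And>i j. f i j 0 = 0"
  shows "(\<lambda>i j. f i j (a i j)) \<in> M"
proof -
  have "{(i, j). f i j (a i j) \<noteq> 0} \<subseteq> {(i, j). a i j \<noteq> 0}" using f(2) by force
  then show ?thesis using a f(1) by (auto simp: matrices_iff dest: finite_subset)
qed

lemma M_scale: "a \<in> M \<Longrightarrow> (\<lambda>i j. c *\<^sub>C a i j) \<in> M"
  by (rule M_entrywise) (auto simp: corner_scale)

lemma M_gauge: "a \<in> M \<Longrightarrow> gauge z a \<in> M"
  unfolding gauge_def by (rule M_entrywise) (auto simp: corner_scale)

lemma M_diag_part: "a \<in> M \<Longrightarrow> diag_part k a \<in> M"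
  unfolding diag_part_def using M_entrywise[of a "\<lambda>i j x. if int j - int i = k then x else 0"]
  by (simp add: corner_zero if_distrib cong: if_cong)

lemma M_star: "a \<in> M \<Longrightarrow> (\<lambda>m n. star (a n m)) \<in> M"
proof -
  assume a: "a \<in> M"
  have "{(i, j). star (a j i) \<noteq> 0} \<subseteq> prod.swap ` {(i, j). a i j \<noteq> 0}" by force
  then show ?thesis using a finite_subset[OF _ finite_imageI] by (auto simp: matrices_iff corner_star)
qed

text \<open>All identities that are additive in a matrix are checked on matrices with one entry.\<close>

lemma matrices_induct [consumes 1, case_names zero single add]:
  assumes a: "a \<in> M" and "P 0"
    and "\<And>i j x. corner i j x \<Longrightarrow> P (single i j x)"
    and "\<And>a b. a \<in> M \<Longrightarrow> b \<in> M \<Longrightarrow> P a \<Longrightarrow> P b \<Longrightarrow> P (a + b)"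
  shows "P a"
proof -
  have "finite S \<Longrightarrow> a \<in> M \<Longrightarrow> {(i, j). a i j \<noteq> 0} \<subseteq> S \<Longrightarrow> P a" for S a
  proof (induction S arbitrary: a rule: finite_induct)
    case empty
    then have "a = 0" by (auto simp: fun_eq_iff)
    with assms(2) show ?case by (simp only:)
  next
    case (insert s S)
    obtain i j where s: "s = (i, j)" by (cases s)
    define b where "b = (\<lambda>m n. if (m, n) = s then 0 else a m n)"
    have b: "b \<in> M"
      unfolding b_def using M_entrywise[OF insert.prems(1), of "\<lambda>m n x. if (m, n) = s then 0 else x"]
      by (simp add: corner_zero)
    have x: "corner i j (a i j)" using insert.prems(1) by (rule M_corner)
    have "{(i, j). b i j \<noteq> 0} \<subseteq> S" using insert.prems(2) by (auto simp: b_def split: if_splits)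
    then have "P b" using insert.IH b by blast
    then have "P (single i j (a i j) + b)" using assms(3,4) M_single x b by blast
    moreover have "single i j (a i j) + b = a" by (auto simp: fun_eq_iff single_def b_def s)
    ultimately show ?case by simp
  qed
  then show ?thesis using a by (auto simp: matrices_iff)
qed

subsection \<open>The product\<close>

lemma Lam_power: "(Lam \<delta> ^^ s) b i k = (if s \<le> i \<and> s \<le> k then (\<delta> ^^ s) (b (i - s) (k - s)) else 0)"
proof (induction s arbitrary: i k)
  case (Suc s)
  have "(Lam \<delta> ^^ Suc s) b i k = (if 1 \<le> i \<and> 1 \<le> k then \<delta> ((Lam \<delta> ^^ s) b (i - 1) (k - 1)) else 0)"
    unfolding funpow.simps comp_apply by (subst Lam_def) (rule refl)
  then show ?case by (cases i; cases k) (auto simp: Suc)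
qed simp

text \<open>The entries of the series \<open>\<Sum>j. \<Lambda>^j b\<close> and \<open>\<Sum>j. \<Lambda>^(j+1) b\<close> that occur in the product.\<close>

definition Lam_sum :: "'a inf_matrix \<Rightarrow> 'a inf_matrix" where
  "Lam_sum b i k = (\<Sum>s\<le>min i k. (\<delta> ^^ s) (b (i - s) (k - s)))"

definition Lam_tail :: "'a inf_matrix \<Rightarrow> 'a inf_matrix" where
  "Lam_tail b i k = (\<Sum>s<min i k. (\<delta> ^^ Suc s) (b (i - Suc s) (k - Suc s)))"

lemma suminf_Lam: "(\<Sum>j. (Lam \<delta> ^^ j) b i k) = Lam_sum b i k"
  unfolding Lam_sum_def by (subst suminf_finite[of "{..min i k}"]) (auto simp: Lam_power intro!: sum.cong)

lemma suminf_Lam_Suc: "(\<Sum>j. (Lam \<delta> ^^ Suc j) b i k) = Lam_tail b i k"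
  unfolding Lam_tail_def by (subst suminf_finite[of "{..<min i k}"]) (auto simp: Lam_power Suc_le_eq intro!: sum.cong simp del: funpow.simps)

abbreviation mprod (infixl \<open>\<star>\<close> 70) where "a \<star> b \<equiv> mat_star_mult \<delta> a b"

lemma mat_star_mult_apply: "(a \<star> b) m n = (\<Sum>k. a m k * Lam_sum b k n) + (\<Sum>k. Lam_tail a m k * b k n)"
  unfolding mat_star_mult_def mat_times_def suminf_Lam suminf_Lam_Suc ..

lemma summable_row:
  assumes "a \<in> M"
  shows "summable (\<lambda>k. a m k * f k)"
proof (rule summable_finite)
  show "finite (snd ` {(i, j). a i j \<noteq> 0})" using assms by (auto simp: matrices_iff)
  fix k assume "k \<notin> snd ` {(i, j). a i j \<noteq> 0}"
  then have "(m, k) \<notin> {(i, j). a i j \<noteq> 0}" by force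
  then show "a m k * f k = 0" by simp
qed

lemma summable_col:
  assumes "b \<in> M"
  shows "summable (\<lambda>k. f k * b k n)"
proof (rule summable_finite)
  show "finite (fst ` {(i, j). b i j \<noteq> 0})" using assms by (auto simp: matrices_iff)
  fix k assume "k \<notin> fst ` {(i, j). b i j \<noteq> 0}"
  then have "(k, n) \<notin> {(i, j). b i j \<noteq> 0}" by force
  then show "f k * b k n = 0" by simp
qed

lemma Lam_sum_add: "Lam_sum (a + b) i k = Lam_sum a i k + Lam_sum b i k" "Lam_tail (a + b) i k = Lam_tail a i k + Lam_tail b i k"
  by (simp_all add: Lam_sum_def Lam_tail_def iter_add endo_add sum.distrib)

lemma mprod_add_left:
  assumes "a \<in> M" "b \<in> M" "c \<in> M"
  shows "(a + b) \<star> c = a \<star> c + b \<star> c"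
proof (intro ext)
  fix m n
  have "(\<Sum>k. (a + b) m k * Lam_sum c k n) = (\<Sum>k. a m k * Lam_sum c k n) + (\<Sum>k. b m k * Lam_sum c k n)"
    unfolding plus_fun_apply distrib_right by (rule suminf_add[symmetric]; rule summable_row; rule assms)
  moreover have "(\<Sum>k. Lam_tail (a + b) m k * c k n) = (\<Sum>k. Lam_tail a m k * c k n) + (\<Sum>k. Lam_tail b m k * c k n)"
    unfolding Lam_sum_add distrib_right by (rule suminf_add[symmetric]; rule summable_col; rule assms)
  ultimately show "((a + b) \<star> c) m n = (a \<star> c + b \<star> c) m n"
    by (simp add: mat_star_mult_apply)
qed

lemma mprod_add_right:
  assumes "a \<in> M" "b \<in> M" "c \<in> M"
  shows "c \<star> (a + b) = c \<star> a + c \<star> b"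
proof (intro ext)
  fix m n
  have "(\<Sum>k. c m k * Lam_sum (a + b) k n) = (\<Sum>k. c m k * Lam_sum a k n) + (\<Sum>k. c m k * Lam_sum b k n)"
    unfolding Lam_sum_add distrib_left by (rule suminf_add[symmetric]; rule summable_row; rule assms)
  moreover have "(\<Sum>k. Lam_tail c m k * (a + b) k n) = (\<Sum>k. Lam_tail c m k * a k n) + (\<Sum>k. Lam_tail c m k * b k n)"
    unfolding plus_fun_apply distrib_left by (rule suminf_add[symmetric]; rule summable_col; rule assms)
  ultimately show "(c \<star> (a + b)) m n = (c \<star> a + c \<star> b) m n"
    by (simp add: mat_star_mult_apply)
qed

lemma Lam_sum_zero: "Lam_sum 0 i k = 0" "Lam_tail 0 i k = 0"
  by (simp_all add: Lam_sum_def Lam_tail_def)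

lemma mprod_zero: "0 \<star> a = 0" "a \<star> 0 = 0"
  by (simp_all add: fun_eq_iff mat_star_mult_apply Lam_sum_zero)

lemma Lam_sum_single:
  "Lam_sum (single k l y) j n = (if k \<le> j \<and> l \<le> n \<and> n - l = j - k then (\<delta> ^^ (j - k)) y else 0)"
proof -
  have "Lam_sum (single k l y) j n
      = (\<Sum>s\<le>min j n. if s = j - k then (if k \<le> j \<and> l \<le> n \<and> n - l = j - k then (\<delta> ^^ (j - k)) y else 0) else 0)"
    unfolding Lam_sum_def
  proof (rule sum.cong[OF refl])
    fix s assume "s \<in> {..min j n}"
    then have "(j - s = k \<and> n - s = l) = (s = j - k \<and> k \<le> j \<and> l \<le> n \<and> n - l = j - k)" by auto
    then show "(\<delta> ^^ s) (single k l y (j - s) (n - s))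
        = (if s = j - k then (if k \<le> j \<and> l \<le> n \<and> n - l = j - k then (\<delta> ^^ (j - k)) y else 0) else 0)"
      by (simp only: single_def) simp
  qed
  then show ?thesis by (auto simp: sum.delta)
qed

lemma Lam_tail_single:
  "Lam_tail (single i j x) m k = (if i < m \<and> j < k \<and> m - i = k - j then (\<delta> ^^ (m - i)) x else 0)"
proof -
  have "Lam_tail (single i j x) m k
      = (\<Sum>s<min m k. if s = m - i - 1 then (if i < m \<and> j < k \<and> m - i = k - j then (\<delta> ^^ (m - i)) x else 0) else 0)"
    unfolding Lam_tail_def
  proof (rule sum.cong[OF refl])
    fix s assume "s \<in> {..<min m k}"
    then have "(m - Suc s = i \<and> k - Suc s = j) = (s = m - i - 1 \<and> i < m \<and> j < k \<and> m - i = k - j)" by auto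
    then show "(\<delta> ^^ Suc s) (single i j x (m - Suc s) (k - Suc s))
        = (if s = m - i - 1 then (if i < m \<and> j < k \<and> m - i = k - j then (\<delta> ^^ (m - i)) x else 0) else 0)"
      by (simp only: single_def) (auto simp: Suc_diff_Suc simp del: funpow.simps)
  qed
  then show ?thesis by (auto simp: sum.delta)
qed

text \<open>The counterpart of \<open>U*^i x U^j U*^k y U^l\<close>, where \<open>U^j U*^k\<close> collapses to a power of \<open>U\<close>
  if \<open>k \<le> j\<close> and to a power of \<open>U*\<close> otherwise, and this power is moved past \<open>y\<close> or \<open>x\<close> by \<open>\<delta>\<close>.\<close>

lemma mprod_single:
  "single i j x \<star> single k l y =
    (if k \<le> j then single i (l + (j - k)) (x * (\<delta> ^^ (j - k)) y) else single (i + (k - j)) l ((\<delta> ^^ (k - j)) x * y))"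
proof (intro ext)
  fix m n
  have 1: "(\<Sum>r. single i j x m r * Lam_sum (single k l y) r n) = single i j x m j * Lam_sum (single k l y) j n"
    by (rule suminf_single) (simp add: single_def)
  have 2: "(\<Sum>r. Lam_tail (single i j x) m r * single k l y r n) = Lam_tail (single i j x) m k * single k l y k n"
    by (rule suminf_single) (simp add: single_def)
  show "(single i j x \<star> single k l y) m n =
    (if k \<le> j then single i (l + (j - k)) (x * (\<delta> ^^ (j - k)) y) else single (i + (k - j)) l ((\<delta> ^^ (k - j)) x * y)) m n"
    unfolding mat_star_mult_apply 1 2 by (simp only: Lam_sum_single Lam_tail_single) (auto simp: single_def)
qed

lemma mprod_single_le: "single i (k + d) x \<star> single k l y = single i (l + d) (x * (\<delta> ^^ d) y)"
  by (simp add: mprod_single)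

lemma mprod_single_ge: "single i j x \<star> single (j + d) l y = single (i + d) l ((\<delta> ^^ d) x * y)"
  by (cases "d = 0") (simp_all add: mprod_single)

text \<open>From here on sums of matrices are kept as sums and not evaluated entrywise.\<close>

declare plus_fun_apply [simp del] zero_fun_apply [simp del]

lemma corner_mprod_le: "corner i (k + d) x \<Longrightarrow> corner k l y \<Longrightarrow> corner i (l + d) (x * (\<delta> ^^ d) y)"
  using corner_iter[of k l y d] by (auto simp: add.commute intro: corner_mult)

lemma corner_mprod_ge: "corner i j x \<Longrightarrow> corner (j + d) l y \<Longrightarrow> corner (i + d) l ((\<delta> ^^ d) x * y)"
  using corner_iter[of i j x d] by (auto simp: add.commute intro: corner_mult)

lemma M_mprod: "a \<in> M \<Longrightarrow> b \<in> M \<Longrightarrow> a \<star> b \<in> M"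
proof (induction a rule: matrices_induct)
  case zero
  then show ?case by (simp add: mprod_zero M_zero)
next
  case (single i j x)
  from single(2) show ?case
  proof (induction b rule: matrices_induct)
    case (single k l y)
    show ?case
    proof (cases k j rule: le_cases)
      case le
      then obtain d where "j = k + d" using le_Suc_ex by blast
      then show ?thesis using single \<open>corner i j x\<close> by (simp add: mprod_single_le M_single corner_mprod_le)
    next
      case ge
      then obtain d where "k = j + d" using le_Suc_ex by blast
      then show ?thesis using single \<open>corner i j x\<close> by (simp add: mprod_single_ge M_single corner_mprod_ge)
    qed
  qed (simp_all add: mprod_zero M_zero mprod_add_right M_add M_single \<open>corner i j x\<close>)
qed (simp add: mprod_add_left M_add)

lemma mprod_assoc_single:
  "single i j x \<star> single k l y \<star> single m n z = single i j x \<star> (single k l y \<star> single m n z)"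
proof (cases k j rule: le_cases)
  case le
  then obtain d where d: "j = k + d" using le_Suc_ex by blast
  show ?thesis
  proof (cases m l rule: le_cases)
    case le
    then obtain e where e: "l = m + e" using le_Suc_ex by blast
    show ?thesis unfolding d e mprod_single_le add.assoc
      by (simp add: iter_mult iter_iter mult.assoc add.commute)
  next
    case ge
    then obtain e where e: "m = l + e" using le_Suc_ex by blast
    show ?thesis
    proof (cases e d rule: le_cases)
      case le
      then obtain f where f: "d = e + f" using le_Suc_ex by blast
      have 1: "single i (k + (e + f)) x \<star> single k l y = single i (l + e + f) (x * (\<delta> ^^ (e + f)) y)"
        by (simp add: mprod_single_le add.assoc)
      have 2: "single i (k + (e + f)) x \<star> single (k + e) n w = single i (n + f) (x * (\<delta> ^^ f) w)" for w
        using mprod_single_le[of i "k + e" f x n w] by (simp add: add.assoc)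
      have 3: "single i (l + e + f) w \<star> single (l + e) n z = single i (n + f) (w * (\<delta> ^^ f) z)" for w
        by (rule mprod_single_le)
      show ?thesis unfolding d e f 1 3 mprod_single_ge 2
        by (simp add: iter_mult iter_iter mult.assoc add.commute)
    next
      case ge
      then obtain f where f: "e = d + f" using le_Suc_ex by blast
      have 1: "single i (l + d) w \<star> single (l + (d + f)) n z = single (i + f) n ((\<delta> ^^ f) w * z)" for w
        using mprod_single_ge[of i "l + d" w f n z] by (simp add: add.assoc)
      have 2: "single i (k + d) x \<star> single (k + (d + f)) n w = single (i + f) n ((\<delta> ^^ f) x * w)" for w
        using mprod_single_ge[of i "k + d" x f n w] by (simp add: add.assoc)
      show ?thesis unfolding d e f mprod_single_le mprod_single_ge 1 2
        by (simp add: iter_mult iter_iter mult.assoc add.commute)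
    qed
  qed
next
  case ge
  then obtain d where d: "k = j + d" using le_Suc_ex by blast
  show ?thesis
  proof (cases m l rule: le_cases)
    case le
    then obtain e where e: "l = m + e" using le_Suc_ex by blast
    show ?thesis unfolding d e mprod_single_ge mprod_single_le by (simp add: mult.assoc)
  next
    case ge
    then obtain e where e: "m = l + e" using le_Suc_ex by blast
    have 1: "single i j x \<star> single (j + d + e) n w = single (i + (d + e)) n ((\<delta> ^^ (d + e)) x * w)" for w
      using mprod_single_ge[of i j x "d + e" n w] by (simp add: add.assoc)
    show ?thesis unfolding d e mprod_single_ge 1
      by (simp add: iter_mult iter_iter mult.assoc add.commute add.left_commute)
  qed
qed

abbreviation sc :: "complex \<Rightarrow> 'a inf_matrix \<Rightarrow> 'a inf_matrix" where "sc c a \<equiv> (\<lambda>i j. c *\<^sub>C a i j)"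
abbreviation st :: "'a inf_matrix \<Rightarrow> 'a inf_matrix" where "st a \<equiv> (\<lambda>m n. star (a n m))"

lemma sc_single: "sc c (single i j x) = single i j (c *\<^sub>C x)"
  by (simp add: single_def fun_eq_iff)

lemma st_single: "st (single i j x) = single j i (star x)"
  by (auto simp add: single_def fun_eq_iff)

lemma sc_add: "sc c (a + b) = sc c a + sc c b"
  by (simp add: fun_eq_iff scaleC_add_right plus_fun_apply)

lemma st_add: "st (a + b) = st a + st b"
  by (simp add: fun_eq_iff star_add plus_fun_apply)

lemma sc_zero: "sc c 0 = 0" and st_zero: "st 0 = 0"
  by (simp_all add: fun_eq_iff zero_fun_apply)

lemma mprod_assoc:
  assumes "a \<in> M" "b \<in> M" "c \<in> M"
  shows "a \<star> b \<star> c = a \<star> (b \<star> c)"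
  using assms(1)
proof (induction a rule: matrices_induct)
  case (single i j x)
  note x = M_single[OF single]
  show ?case
    using assms(2)
  proof (induction b rule: matrices_induct)
    case (single k l y)
    note y = M_single[OF single]
    show ?case
      using assms(3)
    proof (induction c rule: matrices_induct)
      case (single m n z)
      then show ?case by (simp add: mprod_assoc_single)
    qed (simp_all add: mprod_zero mprod_add_right M_mprod x y)
  qed (simp_all add: mprod_zero mprod_add_left mprod_add_right M_mprod x assms)
qed (simp_all add: mprod_zero mprod_add_left M_mprod assms)

lemma mprod_scale:
  assumes "a \<in> M" "b \<in> M"
  shows "sc c a \<star> sc d b = sc (c * d) (a \<star> b)"
  using assms(1)
proof (induction a rule: matrices_induct)
  case (single i j x)
  note x = M_single[OF single]
  have x': "single i j (c *\<^sub>C x) \<in> M" using single by (intro M_single corner_scale)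
  show ?case
    using assms(2)
  proof (induction b rule: matrices_induct)
    case (single k l y)
    show ?case
      unfolding sc_single mprod_single
      by (simp add: sc_single iter_scale mult_scaleC_left mult_scaleC_right scaleC_scaleC mult.commute[of d c])
  qed (simp_all add: mprod_zero mprod_add_right M_mprod x x' sc_add sc_zero M_scale sc_single)
qed (simp_all add: mprod_zero mprod_add_left M_mprod assms sc_add sc_zero M_scale)

lemma mprod_star:
  assumes "a \<in> M" "b \<in> M"
  shows "st (a \<star> b) = st b \<star> st a"
  using assms(1)
proof (induction a rule: matrices_induct)
  case (single i j x)
  note x = M_single[OF single]
  have x': "single j i (star x) \<in> M" using single by (intro M_single corner_star)
  show ?case
    using assms(2)
  proof (induction b rule: matrices_induct)
    case (single k l y)
    show ?case
    proof (cases k j rule: le_cases)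
      case le
      then obtain d where "j = k + d" using le_Suc_ex by blast
      then show ?thesis by (simp add: mprod_single_le mprod_single_ge st_single star_mult iter_star)
    next
      case ge
      then obtain d where "k = j + d" using le_Suc_ex by blast
      then show ?thesis by (simp add: mprod_single_le mprod_single_ge st_single star_mult iter_star)
    qed
  qed (simp_all add: mprod_zero mprod_add_left mprod_add_right M_mprod x x' st_add st_zero M_star st_single)
qed (simp_all add: mprod_zero mprod_add_left mprod_add_right M_mprod assms st_add st_zero M_star)

lemma corner_one: "corner 0 0 x"
  by (simp add: corner_def)

lemma mprod_unit:
  assumes "a \<in> M"
  shows "single 0 0 1 \<star> a = a" "a \<star> single 0 0 1 = a"
  using assms
proof (induction a rule: matrices_induct)
  case (single i j x)
  case 1
  show ?case using mprod_single_ge[of 0 0 1 i j x] single by (simp add: corner_def)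
  case 2
  show ?case using mprod_single_le[of i 0 j x 0 1] single by (simp add: corner_def)
qed (simp_all add: mprod_zero mprod_add_left mprod_add_right M_single corner_one)

lemma unital_star_algebra_matrices: "unital_star_algebra (matrix_algebra \<delta> J) (single 0 0 1)"
proof
  fix c d :: complex and x y z :: "'a inf_matrix"
  show "alg_add (matrix_algebra \<delta> J) = (+)"
    by (simp add: matrix_algebra_def fun_eq_iff plus_fun_apply)
  show "alg_scale (matrix_algebra \<delta> J) c (x + y) = alg_scale (matrix_algebra \<delta> J) c x + alg_scale (matrix_algebra \<delta> J) c y"
    by (simp add: matrix_algebra_def sc_add)
  show "alg_scale (matrix_algebra \<delta> J) (c + d) x = alg_scale (matrix_algebra \<delta> J) c x + alg_scale (matrix_algebra \<delta> J) d x"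
    by (simp add: matrix_algebra_def fun_eq_iff scaleC_add_left plus_fun_apply)
  assume x: "x \<in> alg_carrier (matrix_algebra \<delta> J)"
  show "alg_star (matrix_algebra \<delta> J) (alg_scale (matrix_algebra \<delta> J) c x)
      = alg_scale (matrix_algebra \<delta> J) (cnj c) (alg_star (matrix_algebra \<delta> J) x)"
    by (simp add: matrix_algebra_def fun_eq_iff star_scaleC)
  assume y: "y \<in> alg_carrier (matrix_algebra \<delta> J)"
  show "alg_mult (matrix_algebra \<delta> J) (alg_scale (matrix_algebra \<delta> J) c x) y
      = alg_scale (matrix_algebra \<delta> J) c (alg_mult (matrix_algebra \<delta> J) x y)"
    using mprod_scale[of x y c 1] x y by (simp add: matrix_algebra_def)
  show "alg_mult (matrix_algebra \<delta> J) x (alg_scale (matrix_algebra \<delta> J) c y)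
      = alg_scale (matrix_algebra \<delta> J) c (alg_mult (matrix_algebra \<delta> J) x y)"
    using mprod_scale[of x y 1 c] x y by (simp add: matrix_algebra_def)
qed (simp_all add: matrix_algebra_def M_zero M_add M_scale M_mprod M_star M_single corner_one scaleC_scaleC
    mprod_assoc mprod_add_left mprod_add_right st_add mprod_star star_star mprod_unit)

subsection \<open>Diagonals and the gauge action\<close>

lemma diags_in_Lam_sum:
  assumes "diags_in K a" "int k - int i \<notin> K"
  shows "Lam_sum a i k = 0" "Lam_tail a i k = 0"
proof -
  have "a (i - s) (k - s) = 0" if "s \<le> i" "s \<le> k" for s
  proof (rule ccontr)
    assume "a (i - s) (k - s) \<noteq> 0"
    then have "int (k - s) - int (i - s) \<in> K" using assms(1) unfolding diags_in_def by blast
    then show False using that assms(2) by (simp add: of_nat_diff)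
  qed
  then show "Lam_sum a i k = 0" "Lam_tail a i k = 0" by (auto simp: Lam_sum_def Lam_tail_def intro!: sum.neutral simp del: funpow.simps)
qed

lemma diags_in_mprod:
  assumes a: "diags_in K a" and b: "diags_in L b"
  shows "diags_in {k + l |k l. k \<in> K \<and> l \<in> L} (a \<star> b)"
  unfolding diags_in_def
proof (intro allI impI, rule ccontr)
  fix m n assume ne: "(a \<star> b) m n \<noteq> 0" and no: "int n - int m \<notin> {k + l |k l. k \<in> K \<and> l \<in> L}"
  have split: "int r - int m \<notin> K \<or> int n - int r \<notin> L" for r :: nat
  proof (rule ccontr)
    assume "\<not> ?thesis"
    then have "(int r - int m) + (int n - int r) \<in> {k + l |k l. k \<in> K \<and> l \<in> L}" by blast
    then show False using no by simp
  qed
  have "a m r * Lam_sum b r n = 0" for r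
    using split[of r] a diags_in_Lam_sum(1)[OF b, of n r] unfolding diags_in_def by (metis mult_zero_left mult_zero_right)
  moreover have "Lam_tail a m r * b r n = 0" for r
    using split[of r] b diags_in_Lam_sum(2)[OF a, of r m] unfolding diags_in_def by (metis mult_zero_left mult_zero_right)
  ultimately show False using ne by (simp add: mat_star_mult_apply)
qed

lemma diag_part_zero: "diag_part k (0 :: 'a inf_matrix) = 0"
  by (auto simp: diag_part_def fun_eq_iff zero_fun_apply)

lemma diag_part_add: "diag_part k (a + b :: 'a inf_matrix) = diag_part k a + diag_part k b"
  by (auto simp: diag_part_def fun_eq_iff plus_fun_apply)

lemma diag_part_sum: "diag_part k (\<Sum>i\<in>A. f i :: 'a inf_matrix) = (\<Sum>i\<in>A. diag_part k (f i))"
  by (induction A rule: infinite_finite_induct) (auto simp: diag_part_add diag_part_zero)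

lemma diags_in_diag_part: "diags_in {k} (diag_part k a)"
  by (simp add: diags_in_def diag_part_def)

lemma diag_part_of_homogeneous: "diags_in {l} a \<Longrightarrow> diag_part k a = (if k = l then a else 0)"
  by (auto simp: diags_in_def diag_part_def fun_eq_iff zero_fun_apply)

lemma diags_in_star: "diags_in K a \<Longrightarrow> diags_in (uminus ` K) (st a)"
  unfolding diags_in_def by (metis image_eqI minus_diff_eq star_zero_type)

lemma ex_band: "a \<in> M \<Longrightarrow> \<exists>N::nat. diags_in {- int N..int N} a"
proof -
  assume "a \<in> M"
  then have "finite ((\<lambda>(i, j). nat \<bar>int j - int i\<bar>) ` {(i, j). a i j \<noteq> 0})" by (auto simp: matrices_iff)
  then obtain N where N: "\<And>v. v \<in> (\<lambda>(i, j). nat \<bar>int j - int i\<bar>) ` {(i, j). a i j \<noteq> 0} \<Longrightarrow> v \<le> N"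
    by (meson finite_nat_set_iff_bounded_le)
  have "int j - int i \<in> {- int N..int N}" if "a i j \<noteq> 0" for i j
    using N[of "nat \<bar>int j - int i\<bar>"] that by force
  then show ?thesis unfolding diags_in_def by blast
qed

lemma sum_diag_parts:
  assumes "diags_in K a" "finite K"
  shows "(\<Sum>k\<in>K. diag_part k a) = a"
proof (intro ext)
  fix i j
  have "(\<Sum>k\<in>A. diag_part k a) i j = (\<Sum>k\<in>A. diag_part k a i j)" for A
    by (induction A rule: infinite_finite_induct) (auto simp: plus_fun_apply zero_fun_apply)
  then show "(\<Sum>k\<in>K. diag_part k a) i j = a i j"
    using assms by (auto simp: diag_part_def diags_in_def sum.delta)
qed

lemma gauge_add: "gauge z (a + b) = gauge z a + gauge z b"
  by (simp add: gauge_def fun_eq_iff scaleC_add_right plus_fun_apply)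

lemma gauge_scale: "gauge z (sc c a) = sc c (gauge z a)"
  by (simp add: gauge_def scaleC_scaleC mult.commute)

lemma gauge_star: "gauge z (st a) = st (gauge z a)"
  by (simp add: gauge_def star_scaleC mult.commute)

lemma gauge_zero: "gauge z 0 = 0"
  by (simp add: gauge_def fun_eq_iff zero_fun_apply)

lemma gauge_single: "gauge z (single i j x) = single i j ((z ^ j * cnj z ^ i) *\<^sub>C x)"
  by (auto simp: gauge_def single_def fun_eq_iff)

lemma gauge_mult:
  assumes z: "cmod z = 1" and a: "a \<in> M" and b: "b \<in> M"
  shows "gauge z (a \<star> b) = gauge z a \<star> gauge z b"
  using a
proof (induction a rule: matrices_induct)
  case (single i j x)
  note x = M_single[OF single]
  have x': "single i j ((z ^ j * cnj z ^ i) *\<^sub>C x) \<in> M" using single by (intro M_single corner_scale)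
  have zz: "z * cnj z = 1" using z by (simp add: complex_norm_square[symmetric])
  then have zk: "z ^ k * cnj z ^ k = 1" for k by (simp flip: power_mult_distrib)
  show ?case
    using b
  proof (induction b rule: matrices_induct)
    case (single k l y)
    show ?case
    proof (cases k j rule: le_cases)
      case le
      then obtain d where d: "j = k + d" using le_Suc_ex by blast
      have "z ^ (l + d) * cnj z ^ i = z ^ (l + d) * cnj z ^ i * (z ^ k * cnj z ^ k)" by (simp add: zk)
      then have w: "(z ^ (k + d) * cnj z ^ i) * (z ^ l * cnj z ^ k) = z ^ (l + d) * cnj z ^ i"
        by (simp only: power_add mult_ac)
      show ?thesis
        by (simp only: d mprod_single_le gauge_single iter_scale mult_scaleC_left mult_scaleC_right scaleC_scaleC
            w w[unfolded mult.commute[of "z ^ (k + d) * cnj z ^ i"]])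
    next
      case ge
      then obtain d where d: "k = j + d" using le_Suc_ex by blast
      have "z ^ l * cnj z ^ (i + d) = z ^ l * cnj z ^ (i + d) * (z ^ j * cnj z ^ j)" by (simp add: zk)
      then have w: "(z ^ j * cnj z ^ i) * (z ^ l * cnj z ^ (j + d)) = z ^ l * cnj z ^ (i + d)"
        by (simp only: power_add mult_ac)
      show ?thesis
        by (simp only: d mprod_single_ge gauge_single iter_scale mult_scaleC_left mult_scaleC_right scaleC_scaleC
            w w[unfolded mult.commute[of "z ^ j * cnj z ^ i"]])
    qed
  qed (simp_all add: mprod_zero mprod_add_right M_mprod x x' gauge_zero gauge_add M_gauge gauge_single)
qed (simp_all add: mprod_zero mprod_add_left M_mprod b gauge_zero gauge_add M_gauge)

text \<open>The entry \<open>(i, j)\<close> is multiplied by the mean of \<open>z^(j - i)\<close> over the roots of unity of order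
  \<open>2 N + 1\<close>, which vanishes for \<open>0 < |j - i| \<le> N\<close>.\<close>

lemma gauge_average:
  assumes "diags_in {- int N..int N} a"
  shows "(\<Sum>l<2 * N + 1. sc (1 / of_nat (2 * N + 1)) (gauge (cis (2 * pi * real l / real (2 * N + 1))) a)) = diag_part 0 a"
proof (intro ext)
  fix i j
  let ?n = "2 * N + 1"
  have ev: "(\<Sum>k\<in>A. f k) i j = (\<Sum>k\<in>A. f k i j)" for A and f :: "nat \<Rightarrow> 'a inf_matrix"
    by (induction A rule: infinite_finite_induct) (auto simp: plus_fun_apply zero_fun_apply)
  have weight: "cis (2 * pi * real l / real ?n) ^ j * cnj (cis (2 * pi * real l / real ?n)) ^ i
      = cis (2 * pi * of_int (int j - int i) * real l / real ?n)" for l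
  proof -
    have "cis w ^ j * cnj (cis w) ^ i = cis (of_int (int j - int i) * w)" for w
      by (simp add: cis_cnj Complex.DeMoivre cis_mult algebra_simps)
    moreover have "2 * pi * of_int (int j - int i) * real l / real ?n = of_int (int j - int i) * (2 * pi * real l / real ?n)"
      by simp
    ultimately show ?thesis by (simp only:)
  qed
  have scs: "(\<Sum>k\<in>A. g k *\<^sub>C x) = (\<Sum>k\<in>A. g k) *\<^sub>C x" for A and g :: "nat \<Rightarrow> complex" and x :: 'a
    by (induction A rule: infinite_finite_induct) (auto simp: scaleC_add_left)
  have "(\<Sum>l<?n. sc (1 / of_nat ?n) (gauge (cis (2 * pi * real l / real ?n)) a)) i j
      = ((1 / of_nat ?n) * (\<Sum>l<?n. cis (2 * pi * of_int (int j - int i) * real l / real ?n))) *\<^sub>C a i j"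
    unfolding ev gauge_def weight scaleC_scaleC scs sum_distrib_left ..
  also have "\<dots> = diag_part 0 a i j"
  proof (cases "a i j = 0")
    case True
    then show ?thesis by (auto simp: diag_part_def)
  next
    case False
    then have band: "int j - int i \<in> {- int N..int N}" using assms by (simp add: diags_in_def)
    have "int ?n dvd (int j - int i) \<longleftrightarrow> int j - int i = 0"
      using band zdvd_not_zless[of "int j - int i" "int ?n"] zdvd_not_zless[of "int i - int j" "int ?n"]
        dvd_diff_commute[of "int ?n" "int i" "int j"] by (cases "int j - int i" "0::int" rule: linorder_cases) auto
    then show ?thesis
      using of_nat_neq_0[of "2 * N", where 'a = complex] by (subst sum_cis_roots_of_unity) (auto simp: diag_part_def)
  qed
  finally show "(\<Sum>l<?n. sc (1 / of_nat ?n) (gauge (cis (2 * pi * real l / real ?n)) a)) i j = diag_part 0 a i j" .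
qed

end

section \<open>Seminorms on a C*-algebra as distances to ideals\<close>

lemma unital_star_algebra_type: "unital_star_algebra (type_algebra :: 'a::unital_cstar_algebra star_algebra) 1"
  by unfold_locales
    (simp_all add: type_algebra_def scaleC_add_right scaleC_add_left scaleC_scaleC mult.assoc distrib_left
      distrib_right mult_scaleC_left mult_scaleC_right star_add star_scaleC star_mult star_star)

interpretation A: cstar_seminormed_algebra "type_algebra :: 'a::unital_cstar_algebra star_algebra" 1 norm
proof (intro cstar_seminormed_algebra.intro unital_star_algebra_type cstar_seminormed_algebra_axioms.intro)
  show "cstar_seminorm_on (type_algebra :: 'a star_algebra) norm"
    by (simp add: cstar_seminorm_on_def type_algebra_def norm_triangle_ineq norm_scaleC norm_mult_ineq cstar_identity)
qed

lemma type_algebra_simps [simp]: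
  "alg_carrier type_algebra = UNIV" "alg_mult type_algebra x y = x * y"
  "alg_scale type_algebra c x = c *\<^sub>C x" "alg_star type_algebra x = star x"
  "alg_add type_algebra x y = x + y" "alg_norm type_algebra x = norm x"
  by (simp_all add: type_algebra_def)

lemma A_cauchy_convergent:
  assumes "A.p_cauchy X"
  obtains x where "X \<longlonglongrightarrow> x"
proof -
  have "Cauchy X" using assms unfolding A.p_cauchy_def Cauchy_def dist_norm by blast
  then show thesis using that Cauchy_convergent_iff convergent_def by blast
qed

lemma left_inverse_one_minus:
  fixes c :: "'a::unital_cstar_algebra"
  assumes "norm c < 1"
  obtains z where "z * (1 - c) = 1"
proof -
  have const: "A.p_cauchy (\<lambda>n. c)" by (rule A.p_cauchy_const) simp
  show thesis
  proof (rule A.geometric_partial_sums[OF const order_refl assms])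
    fix Z assume Z: "A.p_cauchy Z" "(\<lambda>n. norm (alg_mult type_algebra (Z n) (1 - c) - 1)) \<longlonglongrightarrow> 0"
    obtain z where z: "Z \<longlonglongrightarrow> z" using A_cauchy_convergent[OF Z(1)] .
    have "(\<lambda>n. Z n * (1 - c)) \<longlonglongrightarrow> z * (1 - c)" by (intro tendsto_intros z)
    moreover have "(\<lambda>n. Z n * (1 - c)) \<longlonglongrightarrow> 1"
      using Z(2) unfolding type_algebra_simps by (rule LIM_zero_cancel[OF tendsto_norm_zero_cancel])
    ultimately have "z * (1 - c) = 1" by (rule LIMSEQ_unique)
    then show thesis by (rule that)
  qed
qed

text \<open>In a complete algebra the lifting produces \<open>z\<close> with \<open>norm z \<le> r\<close> and \<open>q (z - x) = 0\<close>, so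
  \<open>x - z\<close> is an element of the kernel at distance at most \<open>r\<close> from \<open>x\<close>.\<close>

lemma infdist_seminorm_kernel:
  fixes x :: "'a::unital_cstar_algebra"
  assumes q: "cstar_seminorm_on type_algebra q" and le: "\<And>x. q x \<le> norm x"
  shows "infdist x {b. q b = 0} = q x"
proof (rule antisym)
  interpret q: cstar_seminormed_algebra type_algebra "1::'a" q
    by unfold_locales (rule q)
  have ne: "0 \<in> {b. q b = 0}" by (simp add: q.p_zero)
  show "q x \<le> infdist x {b. q b = 0}"
  proof -
    have nonempty: "{b. q b = 0} \<noteq> {}" using ne by blast
    show ?thesis
      unfolding infdist_notempty[OF nonempty]
    proof (rule cINF_greatest[OF nonempty])
      fix b assume "b \<in> {b. q b = 0}"
      then have "q x \<le> q (x - b)" using q.p_add[of "x - b" b] by simp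
      also have "\<dots> \<le> dist x b" by (simp add: le dist_norm)
      finally show "q x \<le> dist x b" .
    qed
  qed
  show "infdist x {b. q b = 0} \<le> q x"
  proof (rule dense_ge)
    fix r assume r: "q x < r"
    obtain y where y: "A.p_cauchy y" "(\<lambda>n. q (y n - x)) \<longlonglongrightarrow> 0" "\<forall>\<^sub>F n in sequentially. norm (y n) \<le> r"
      using A.approximate_lifting[OF q _ r] by auto
    obtain z where z: "y \<longlonglongrightarrow> z" using A_cauchy_convergent[OF y(1)] .
    have "q (z - x) \<le> norm (y n - z) + q (y n - x)" for n
      using q.p_triangle[of z "y n" x] le[of "z - y n"] by (simp add: norm_minus_commute)
    moreover have "(\<lambda>n. norm (y n - z) + q (y n - x)) \<longlonglongrightarrow> 0 + 0"
      by (intro tendsto_add y(2) tendsto_norm_zero LIM_zero z)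
    ultimately have "q (z - x) \<le> 0" using LIMSEQ_le_const by fastforce
    then have "q (x - z) = 0" using q.p_nonneg[of "x - z"] q.p_diff_commute[of x z] by simp
    then have "infdist x {b. q b = 0} \<le> dist x (x - z)" by (intro infdist_le) simp
    also have "\<dots> = norm z" by (simp add: dist_norm)
    also have "\<dots> \<le> r" by (rule Lim_norm_ubound[OF _ z y(3)]) simp
    finally show "infdist x {b. q b = 0} \<le> r" .
  qed
qed

section \<open>Covariant representations\<close>

lemma comp_id [simp]: "T o\<^sub>L id_blinfun = T" "id_blinfun o\<^sub>L T = T"
  by (simp_all add: blinfun_eqI)

lemma comp_assoc: "(R o\<^sub>L S) o\<^sub>L T = R o\<^sub>L (S o\<^sub>L T)"
  by (rule blinfun_eqI) simp

lemma comp_add_left: "(R + S) o\<^sub>L T = (R o\<^sub>L T) + (S o\<^sub>L T)"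
  and comp_add_right: "T o\<^sub>L (R + S) = (T o\<^sub>L R) + (T o\<^sub>L S)"
  and comp_diff_left: "(R - S) o\<^sub>L T = (R o\<^sub>L T) - (S o\<^sub>L T)"
  and comp_diff_right: "T o\<^sub>L (R - S) = (T o\<^sub>L R) - (T o\<^sub>L S)"
  by (rule blinfun_eqI; simp add: blinfun.bilinear_simps)+

lemma comp_zero [simp]: "0 o\<^sub>L T = 0" "T o\<^sub>L 0 = 0"
  by (rule blinfun_eqI; simp add: blinfun.bilinear_simps)+

lemma op_power_0: "op_power T 0 = id_blinfun"
  and op_power_Suc: "op_power T (Suc n) = T o\<^sub>L op_power T n"
  by (simp_all add: op_power_def)

lemma op_power_add: "op_power T (m + n) = op_power T m o\<^sub>L op_power T n"
  by (induction m) (simp_all add: op_power_0 op_power_Suc comp_assoc)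

lemma op_power_Suc_right: "op_power T (Suc n) = op_power T n o\<^sub>L T"
  using op_power_add[of T n 1] by (simp add: op_power_0 op_power_Suc)

lemma op_power_closed: "T \<in> bounded_ops \<Longrightarrow> op_power T n \<in> bounded_ops"
  by (induction n) (auto simp: op_power_0 op_power_Suc op_closed)

lemma adj_op_power: "T \<in> bounded_ops \<Longrightarrow> adj (op_power T n) = op_power (adj T) n"
proof (induction n)
  case (Suc n)
  then have "adj (op_power T (Suc n)) = op_power (adj T) n o\<^sub>L adj T"
    unfolding op_power_Suc by (simp add: adj_comp op_power_closed)
  then show ?case by (simp add: op_power_Suc_right)
qed (simp add: op_power_0 adj_id)

lemma scale_op_comp:
  "S \<in> bounded_ops \<Longrightarrow> S o\<^sub>L scale_op c T = scale_op c (S o\<^sub>L T)"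
  "scale_op c S o\<^sub>L T = scale_op c (S o\<^sub>L T)"
  by (rule blinfun_eqI; simp add: ap_scale_op bounded_opsD)+

lemma scale_op_add: "scale_op c (S + T) = scale_op c S + scale_op c T"
  by (rule blinfun_eqI) (simp add: ap_scale_op blinfun.bilinear_simps scaleC_add_right)

lemma scale_op_zero: "scale_op c 0 = 0"
  by (rule blinfun_eqI) (simp add: ap_scale_op)

locale covariant_system = cstar_dynamics \<delta> for \<delta> :: "'a::unital_cstar_algebra \<Rightarrow> 'a" +
  fixes J :: "'a set" and \<pi> :: "'a \<Rightarrow> 'h::chilbert_space \<Rightarrow>\<^sub>L 'h" and U :: "'h \<Rightarrow>\<^sub>L 'h"
  assumes covariant: "covariant_rep \<delta> \<pi> U"
    and associated: "associated_with \<pi> U J"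
begin

lemma pi_closed: "\<pi> a \<in> bounded_ops"
  and pi_add: "\<pi> (a + b) = \<pi> a + \<pi> b"
  and pi_mult: "\<pi> (a * b) = \<pi> a o\<^sub>L \<pi> b"
  and pi_scale: "\<pi> (c *\<^sub>C a) = scale_op c (\<pi> a)"
  and pi_star: "\<pi> (star a) = adj (\<pi> a)"
  using covariant by (auto simp: covariant_rep_def star_hom_def op_algebra_def)

lemma inj_pi: "inj \<pi>"
  and U_closed: "U \<in> bounded_ops"
  and UUU: "U o\<^sub>L adj U o\<^sub>L U = U"
  and cov: "U o\<^sub>L \<pi> a o\<^sub>L adj U = \<pi> (\<delta> a)"
  and comm: "(adj U o\<^sub>L U) o\<^sub>L \<pi> a = \<pi> a o\<^sub>L (adj U o\<^sub>L U)"
  using covariant by (auto simp: covariant_rep_def partial_isometry_def)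

lemma pi_zero: "\<pi> 0 = 0"
  using pi_add[of 0 0] by simp

lemma pi_diff: "\<pi> (a - b) = \<pi> a - \<pi> b"
  using pi_add[of "a - b" b] by simp

text \<open>The operator \<open>\<pi> 1\<close> fixes all vectors \<open>\<pi> a h\<close>, whose span is dense by non-degeneracy.\<close>

lemma pi_one: "\<pi> 1 = id_blinfun"
proof -
  define F where "F = {x. ap (\<pi> 1) x = x}"
  have "closed F"
    unfolding F_def by (intro closed_Collect_eq continuous_intros)
  moreover have "subspace F"
    by (auto simp: F_def subspace_def ap_add ap_scaleR)
  moreover have "{ap (\<pi> a) h |a h. True} \<subseteq> F"
  proof
    fix y assume "y \<in> {ap (\<pi> a) h |a h. True}"
    then obtain a h where "y = ap (\<pi> a) h" by blast
    then show "y \<in> F" using arg_cong[OF pi_mult[of 1 a], of "\<lambda>T. ap T h"] by (simp add: F_def)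
  qed
  ultimately have "closure (span {ap (\<pi> a) h |a h. True}) \<subseteq> F"
    by (intro closure_minimal span_minimal)
  then have "F = UNIV" using covariant by (auto simp: covariant_rep_def)
  then show ?thesis by (intro blinfun_eqI) (auto simp: F_def)
qed

abbreviation V where "V \<equiv> adj U"
abbreviation Q where "Q \<equiv> V o\<^sub>L U"
abbreviation Up where "Up n \<equiv> op_power U n"
abbreviation Vp where "Vp n \<equiv> op_power V n"

lemma V_closed: "V \<in> bounded_ops"
  by (simp add: U_closed adj_closed)

lemma Up_closed: "Up n \<in> bounded_ops" and Vp_closed: "Vp n \<in> bounded_ops"
  by (simp_all add: op_power_closed U_closed V_closed)

lemma Q_closed: "Q \<in> bounded_ops"
  by (simp add: U_closed V_closed op_closed)

lemma Q_adj: "adj Q = Q"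
  by (simp add: adj_comp U_closed V_closed adj_adj)

lemma UQ: "U o\<^sub>L Q = U"
  using UUU by (simp add: comp_assoc)

lemma QV: "Q o\<^sub>L V = V"
proof -
  have "adj (U o\<^sub>L Q) = Q o\<^sub>L V"
    by (simp add: adj_comp U_closed V_closed op_closed adj_adj)
  then show ?thesis by (simp add: UQ)
qed

lemma QQ: "Q o\<^sub>L Q = Q"
  by (metis UQ comp_assoc)

lemma norm_U: "norm U \<le> 1"
proof -
  have "norm Q = (norm Q)\<^sup>2" using norm_adj_comp[OF Q_closed] by (simp add: Q_adj QQ)
  then have "norm Q \<le> 1" by (metis mult_cancel_left1 order_refl power2_eq_square zero_le_one)
  then have "(norm U)\<^sup>2 \<le> 1\<^sup>2" by (simp add: norm_adj_comp U_closed)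
  then show ?thesis by (rule power2_le_imp_le) simp
qed

lemma norm_V: "norm V \<le> 1"
  by (simp add: norm_adj U_closed norm_U)

lemma norm_comp_contractions:
  assumes "norm S \<le> 1"
  shows "norm (S o\<^sub>L T) \<le> norm T" "norm (T o\<^sub>L S) \<le> norm T"
  using order.trans[OF norm_comp_le mult_right_mono[OF assms norm_ge_zero[of T]]]
    order.trans[OF norm_comp_le mult_left_mono[OF assms norm_ge_zero[of T]]] by auto

lemma norm_Up: "norm (Up n) \<le> 1" and norm_Vp: "norm (Vp n) \<le> 1"
proof -
  have "norm (op_power S n) \<le> 1" if "norm S \<le> 1" for S :: "'h \<Rightarrow>\<^sub>L 'h"
  proof (induction n)
    case 0
    show ?case unfolding op_power_0 by (rule op_norm_le) auto
  next
    case (Suc n)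
    then show ?case unfolding op_power_Suc using norm_comp_contractions(1)[OF that] order.trans by blast
  qed
  then show "norm (Up n) \<le> 1" "norm (Vp n) \<le> 1" using norm_U norm_V by blast+
qed

lemma U_pi: "U o\<^sub>L \<pi> a = \<pi> (\<delta> a) o\<^sub>L U"
proof -
  have "U o\<^sub>L \<pi> a = U o\<^sub>L (Q o\<^sub>L \<pi> a)" by (metis UQ comp_assoc)
  also have "\<dots> = U o\<^sub>L \<pi> a o\<^sub>L V o\<^sub>L U" unfolding comm by (simp only: comp_assoc)
  finally show ?thesis by (simp add: cov)
qed

lemma pi_V: "\<pi> a o\<^sub>L V = V o\<^sub>L \<pi> (\<delta> a)"
proof -
  have "adj (U o\<^sub>L \<pi> (star a)) = adj (\<pi> (\<delta> (star a)) o\<^sub>L U)" by (simp add: U_pi)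
  then show ?thesis
    by (simp add: adj_comp U_closed pi_closed endo_star star_star flip: pi_star)
qed

lemma Up_pi: "Up n o\<^sub>L \<pi> a = \<pi> ((\<delta> ^^ n) a) o\<^sub>L Up n"
proof (induction n)
  case (Suc n)
  have "Up (Suc n) o\<^sub>L \<pi> a = U o\<^sub>L (Up n o\<^sub>L \<pi> a)" by (simp add: op_power_Suc comp_assoc)
  also have "\<dots> = (U o\<^sub>L \<pi> ((\<delta> ^^ n) a)) o\<^sub>L Up n" by (simp add: Suc comp_assoc)
  finally show ?case by (simp add: U_pi op_power_Suc comp_assoc)
qed (simp add: op_power_0)

lemma pi_Vp: "\<pi> a o\<^sub>L Vp n = Vp n o\<^sub>L \<pi> ((\<delta> ^^ n) a)"
proof (induction n)
  case (Suc n)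
  have "\<pi> a o\<^sub>L Vp (Suc n) = (\<pi> a o\<^sub>L Vp n) o\<^sub>L V" by (simp add: op_power_Suc_right comp_assoc)
  also have "\<dots> = Vp n o\<^sub>L (\<pi> ((\<delta> ^^ n) a) o\<^sub>L V)" by (simp add: Suc comp_assoc)
  finally show ?case by (simp add: pi_V op_power_Suc_right comp_assoc)
qed (simp add: op_power_0)

lemma Up_Vp: "Up n o\<^sub>L Vp n = \<pi> (q n)"
proof (induction n)
  case (Suc n)
  have "Up (Suc n) o\<^sub>L Vp (Suc n) = U o\<^sub>L (Up n o\<^sub>L Vp n) o\<^sub>L V"
    unfolding op_power_Suc[of U] op_power_Suc_right[of V] by (simp add: comp_assoc)
  then show ?case by (simp add: Suc cov)
qed (simp add: op_power_0 pi_one)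

lemma norm_Q_comp: 
  assumes "Q o\<^sub>L T = T o\<^sub>L Q"
  shows "norm (Q o\<^sub>L T) = norm (U o\<^sub>L T o\<^sub>L V)"
proof (rule antisym)
  have "Q o\<^sub>L T = Q o\<^sub>L (Q o\<^sub>L T)" by (metis QQ comp_assoc)
  also have "\<dots> = V o\<^sub>L ((U o\<^sub>L T o\<^sub>L V) o\<^sub>L U)" unfolding assms by (simp add: comp_assoc)
  also have "norm \<dots> \<le> norm (U o\<^sub>L T o\<^sub>L V)"
    using norm_comp_contractions(1)[OF norm_V] norm_comp_contractions(2)[OF norm_U] order.trans by blast
  finally show "norm (Q o\<^sub>L T) \<le> norm (U o\<^sub>L T o\<^sub>L V)" .
  have "U o\<^sub>L T o\<^sub>L V = U o\<^sub>L (Q o\<^sub>L T) o\<^sub>L V" by (metis UQ comp_assoc)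
  then show "norm (U o\<^sub>L T o\<^sub>L V) \<le> norm (Q o\<^sub>L T)"
    using norm_comp_contractions(1)[OF norm_U, of "Q o\<^sub>L T"] norm_comp_contractions(2)[OF norm_V, of "U o\<^sub>L (Q o\<^sub>L T)"]
    by simp
qed

subsection \<open>Distances computed in the representation\<close>

text \<open>If a self-adjoint \<open>x\<close> had \<open>norm x < norm (\<pi> x)\<close>, then \<open>1 - c\<close> would be invertible for
  \<open>c = x x / (norm (\<pi> x))\<^sup>2\<close> by the geometric series, and so would be its image under \<open>\<pi>\<close>.\<close>

lemma pi_contractive: "norm (\<pi> x) \<le> norm x"
proof -
  have self_adjoint: "norm (\<pi> x) \<le> norm x" if x: "star x = x" for x
  proof (rule ccontr)
    assume "\<not> norm (\<pi> x) \<le> norm x"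
    then have less: "norm x < norm (\<pi> x)" and pos: "0 < norm (\<pi> x)"
      using norm_ge_zero[of x] by linarith+
    define c where "c = of_real (1 / (norm (\<pi> x))\<^sup>2) *\<^sub>C (x * x)"
    have "norm (x * x) = (norm x)\<^sup>2" using cstar_identity[of x] x by simp
    then have "norm c = (norm x)\<^sup>2 / (norm (\<pi> x))\<^sup>2"
      unfolding c_def norm_scaleC by (simp add: norm_power norm_divide)
    also have "\<dots> < 1" using less pos by (simp add: power_strict_mono)
    finally obtain z where z: "z * (1 - c) = 1" using left_inverse_one_minus by blast
    have "\<pi> z o\<^sub>L (id_blinfun - scale_op (of_real (1 / (norm (\<pi> x))\<^sup>2)) (\<pi> x o\<^sub>L \<pi> x)) = \<pi> (z * (1 - c))"
      unfolding c_def pi_mult pi_diff pi_scale pi_one ..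
    then have "\<pi> z o\<^sub>L (id_blinfun - scale_op (of_real (1 / (norm (\<pi> x))\<^sup>2)) (\<pi> x o\<^sub>L \<pi> x)) = id_blinfun"
      unfolding z pi_one .
    then show False
      using no_left_inverse_at_norm[OF pi_closed _ pos] pi_star[of x] x by simp
  qed
  have "(norm (\<pi> x))\<^sup>2 = norm (\<pi> (star x * x))"
    by (simp add: pi_mult pi_star norm_adj_comp pi_closed)
  also have "\<dots> \<le> norm (star x * x)" by (rule self_adjoint) (simp add: star_mult star_star)
  finally have "(norm (\<pi> x))\<^sup>2 \<le> (norm x)\<^sup>2" by (simp add: cstar_identity)
  then show ?thesis by (rule power2_le_imp_le) simp
qed

text \<open>By injectivity the kernel is \<open>{0}\<close>, and the distance to 0 is the norm.\<close>

lemma norm_pi: "norm (\<pi> x) = norm x"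
proof -
  have "cstar_seminorm_on type_algebra (\<lambda>x. norm (\<pi> x))"
    by (simp add: cstar_seminorm_on_def pi_add pi_mult pi_scale pi_star norm_triangle_ineq norm_scale_op
        norm_comp_le norm_adj_comp pi_closed)
  from infdist_seminorm_kernel[OF this pi_contractive, of x]
  have "infdist x {b. \<pi> b = 0} = norm (\<pi> x)" by simp
  moreover have "{b. \<pi> b = 0} = {0}" using inj_pi pi_zero by (auto dest: injD[of \<pi> _ 0])
  ultimately show ?thesis by simp
qed

lemma norm_endo: "norm (\<delta> x) = norm (Q o\<^sub>L \<pi> x)"
  using norm_Q_comp[OF comm] by (simp add: cov norm_pi)

lemma infdist_kernel: "infdist x (Ker \<delta>) = norm (\<delta> x)"
proof -
  have "cstar_seminorm_on type_algebra (\<lambda>x. norm (\<delta> x))"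
    by (simp add: cstar_seminorm_on_def endo_add endo_mult endo_scale endo_star norm_triangle_ineq norm_scaleC
        norm_mult_ineq cstar_identity)
  moreover have "norm (\<delta> x) \<le> norm x" for x
    using norm_max_projection[OF Q_closed Q_adj QQ pi_closed comm, of x] by (simp add: norm_endo norm_pi)
  ultimately have "infdist x {b. norm (\<delta> b) = 0} = norm (\<delta> x)" by (rule infdist_seminorm_kernel)
  then show ?thesis by (simp add: Ker_def)
qed

text \<open>\<open>J\<close> is the kernel of the *-homomorphism \<open>a \<mapsto> (1 - Q) \<pi>(a)\<close>.\<close>

lemma infdist_ideal: "infdist x J = norm ((id_blinfun - Q) o\<^sub>L \<pi> x)"
proof -
  define R where "R = id_blinfun - Q"
  have R: "R \<in> bounded_ops" "adj R = R" "R o\<^sub>L R = R" "R o\<^sub>L \<pi> a = \<pi> a o\<^sub>L R" for a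
    using comm[of a] by (auto simp: R_def op_closed Q_closed adj_diff adj_id Q_adj comp_diff_left
        comp_diff_right QQ)
  have RR: "R o\<^sub>L \<pi> a o\<^sub>L (R o\<^sub>L \<pi> b) = R o\<^sub>L (\<pi> a o\<^sub>L \<pi> b)" for a b
    by (metis R(3,4) comp_assoc)
  have "cstar_seminorm_on type_algebra (\<lambda>x. norm (R o\<^sub>L \<pi> x))"
    unfolding cstar_seminorm_on_def
  proof (intro conjI ballI allI)
    fix a b :: 'a and c
    show "norm (R o\<^sub>L \<pi> (alg_add type_algebra a b)) \<le> norm (R o\<^sub>L \<pi> a) + norm (R o\<^sub>L \<pi> b)"
      by (simp add: pi_add comp_add_right norm_triangle_ineq)
    show "norm (R o\<^sub>L \<pi> (alg_scale type_algebra c a)) = cmod c * norm (R o\<^sub>L \<pi> a)"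
      by (simp add: pi_scale scale_op_comp R norm_scale_op)
    show "norm (R o\<^sub>L \<pi> (alg_mult type_algebra a b)) \<le> norm (R o\<^sub>L \<pi> a) * norm (R o\<^sub>L \<pi> b)"
      using norm_comp_le[of "R o\<^sub>L \<pi> a" "R o\<^sub>L \<pi> b"] by (simp add: RR pi_mult)
    have "adj (R o\<^sub>L \<pi> a) o\<^sub>L (R o\<^sub>L \<pi> a) = R o\<^sub>L \<pi> (star a) o\<^sub>L (R o\<^sub>L \<pi> a)"
      by (simp add: adj_comp R pi_closed flip: pi_star)
    then have "R o\<^sub>L (\<pi> (star a) o\<^sub>L \<pi> a) = adj (R o\<^sub>L \<pi> a) o\<^sub>L (R o\<^sub>L \<pi> a)" by (simp only: RR)
    then show "norm (R o\<^sub>L \<pi> (alg_mult type_algebra (alg_star type_algebra a) a)) = (norm (R o\<^sub>L \<pi> a))\<^sup>2"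
      by (simp only: type_algebra_simps pi_mult norm_adj_comp[OF bounded_ops_closed(5)[OF R(1) pi_closed]])
  qed simp
  moreover have "norm (R o\<^sub>L \<pi> x) \<le> norm x" for x
    using norm_max_projection[OF Q_closed Q_adj QQ pi_closed comm, of x] by (simp add: R_def norm_pi)
  ultimately have "infdist x {b. norm (R o\<^sub>L \<pi> b) = 0} = norm (R o\<^sub>L \<pi> x)" by (rule infdist_seminorm_kernel)
  moreover have "{b. norm (R o\<^sub>L \<pi> b) = 0} = J"
    using associated by (auto simp: associated_with_def R_def comp_diff_left)
  ultimately show ?thesis by (simp add: R_def)
qed

subsection \<open>Norms of diagonal elements\<close>

definition diag_op :: "(nat \<Rightarrow> 'a) \<Rightarrow> nat \<Rightarrow> ('h \<Rightarrow>\<^sub>L 'h)" where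
  "diag_op d n = (\<Sum>j\<le>n. Vp j o\<^sub>L \<pi> (d j) o\<^sub>L Up j)"

definition partial_sum :: "(nat \<Rightarrow> 'a) \<Rightarrow> nat \<Rightarrow> 'a" where
  "partial_sum d i = (\<Sum>j\<le>i. (\<delta> ^^ (i - j)) (d j))"

text \<open>The diagonal sum \<open>diag_op d (Suc n)\<close> conjugated by \<open>U\<close> is \<open>diag_op (diag_shift d) n\<close>: the term \<open>d 0\<close>
  becomes \<open>\<delta> (d 0)\<close> and joins \<open>d 1\<close>, all other terms move down by one.\<close>

definition diag_shift :: "(nat \<Rightarrow> 'a) \<Rightarrow> nat \<Rightarrow> 'a" where
  "diag_shift d j = (if j = 0 then \<delta> (d 0) + d 1 else d (Suc j))"

lemma partial_sum_shift: "partial_sum (diag_shift d) i = partial_sum d (Suc i)"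
proof -
  have "partial_sum d (Suc i) = (\<delta> ^^ Suc i) (d 0) + (\<Sum>j\<le>i. (\<delta> ^^ (i - j)) (d (Suc j)))"
    unfolding partial_sum_def by (subst sum.atMost_Suc_shift) simp
  also have "(\<delta> ^^ Suc i) (d 0) = (\<delta> ^^ i) (\<delta> (d 0))" by (simp add: funpow_swap1)
  also have "(\<delta> ^^ i) (\<delta> (d 0)) + (\<Sum>j\<le>i. (\<delta> ^^ (i - j)) (d (Suc j)))
      = (\<Sum>j\<le>i. (\<delta> ^^ (i - j)) ((if j = 0 then \<delta> (d 0) else 0) + d (Suc j)))"
    by (simp add: iter_add sum.distrib if_distrib[of "\<delta> ^^ _"] sum.delta cong: if_cong)
  also have "\<dots> = partial_sum (diag_shift d) i"
    unfolding partial_sum_def by (rule sum.cong) (auto simp: diag_shift_def)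
  finally show ?thesis by simp
qed

text \<open>In \<open>diag_op d (Suc n) = \<pi> (d 0) + S\<close> every term of \<open>S\<close> begins with \<open>U*\<close> and ends with \<open>U\<close>, hence is unchanged by
  \<open>Q\<close> on either side. So \<open>1 - Q\<close> sees only \<open>\<pi> (d 0)\<close>, while on the range of \<open>Q\<close> conjugation
  by \<open>U\<close> is isometric. That the conjugated sum is again of the same form uses \<open>d j \<in> \<delta>^j(1) A \<delta>^j(1)\<close>.\<close>

lemma norm_diag_op_Suc:
  assumes d: "\<And>j. corner j j (d j)"
  shows "norm (diag_op d (Suc n)) = max (infdist (d 0) J) (norm (diag_op (diag_shift d) n))"
proof -
  define S where "S = (\<Sum>j\<le>n. Vp (Suc j) o\<^sub>L \<pi> (d (Suc j)) o\<^sub>L Up (Suc j))"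
  have T: "diag_op d (Suc n) = \<pi> (d 0) + S"
    unfolding diag_op_def S_def by (subst sum.atMost_Suc_shift) (simp add: op_power_0)
  have comp_sum: "R o\<^sub>L (\<Sum>j\<in>A. f j) = (\<Sum>j\<in>A. R o\<^sub>L f j)" "(\<Sum>j\<in>A. f j) o\<^sub>L R = (\<Sum>j\<in>A. f j o\<^sub>L R)"
    for R and f :: "nat \<Rightarrow> 'h \<Rightarrow>\<^sub>L 'h" and A
    by (induction A rule: infinite_finite_induct) (auto simp: comp_add_left comp_add_right)
  have QVp: "Q o\<^sub>L Vp (Suc j) = Vp (Suc j)" and UpQ: "Up (Suc j) o\<^sub>L Q = Up (Suc j)" for j
  proof -
    have "Q o\<^sub>L Vp (Suc j) = (Q o\<^sub>L V) o\<^sub>L Vp j" by (simp only: op_power_Suc comp_assoc)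
    then show "Q o\<^sub>L Vp (Suc j) = Vp (Suc j)" by (simp only: QV op_power_Suc)
    have "Up (Suc j) o\<^sub>L Q = Up j o\<^sub>L (U o\<^sub>L Q)" by (simp only: op_power_Suc_right comp_assoc)
    then show "Up (Suc j) o\<^sub>L Q = Up (Suc j)" by (simp only: UQ op_power_Suc_right)
  qed
  have QS: "Q o\<^sub>L S = S"
    unfolding S_def comp_sum by (rule sum.cong[OF refl]) (metis QVp comp_assoc)
  have SQ: "S o\<^sub>L Q = S"
    unfolding S_def comp_sum by (rule sum.cong[OF refl]) (metis UpQ comp_assoc)
  have commT: "Q o\<^sub>L diag_op d (Suc n) = diag_op d (Suc n) o\<^sub>L Q"
    unfolding T comp_add_left comp_add_right QS SQ comm ..
  have Tc: "diag_op d (Suc n) \<in> bounded_ops"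
    unfolding diag_op_def by (intro op_sum_closed op_closed Up_closed Vp_closed pi_closed)
  have "norm ((id_blinfun - Q) o\<^sub>L diag_op d (Suc n)) = infdist (d 0) J"
    unfolding T infdist_ideal by (simp add: comp_add_right comp_diff_left QS)
  moreover have "U o\<^sub>L diag_op d (Suc n) o\<^sub>L V = diag_op (diag_shift d) n"
  proof -
    have step: "U o\<^sub>L (Vp (Suc j) o\<^sub>L \<pi> (d (Suc j)) o\<^sub>L Up (Suc j)) o\<^sub>L V = Vp j o\<^sub>L \<pi> (d (Suc j)) o\<^sub>L Up j" for j
    proof -
      have UV: "U o\<^sub>L V = \<pi> (q 1)" using cov[of 1] by (simp add: pi_one)
      have "(U o\<^sub>L Vp (Suc j)) o\<^sub>L \<pi> (d (Suc j)) = \<pi> (q 1) o\<^sub>L Vp j o\<^sub>L \<pi> (d (Suc j))"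
        by (simp only: op_power_Suc UV flip: comp_assoc)
      also have "\<dots> = Vp j o\<^sub>L \<pi> (q (Suc j) * d (Suc j))"
        unfolding pi_Vp pi_mult iter_iter by (simp add: comp_assoc)
      also have "q (Suc j) * d (Suc j) = d (Suc j)" using d[of "Suc j"] by (simp only: corner_def)
      finally have 1: "(U o\<^sub>L Vp (Suc j)) o\<^sub>L \<pi> (d (Suc j)) = Vp j o\<^sub>L \<pi> (d (Suc j))" .
      have "\<pi> (d (Suc j)) o\<^sub>L (Up (Suc j) o\<^sub>L V) = \<pi> (d (Suc j)) o\<^sub>L (Up j o\<^sub>L \<pi> (q 1))"
        by (simp only: op_power_Suc_right UV comp_assoc)
      also have "\<dots> = \<pi> (d (Suc j) * q (Suc j)) o\<^sub>L Up j"
        unfolding Up_pi pi_mult iter_iter by (simp add: comp_assoc)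
      also have "d (Suc j) * q (Suc j) = d (Suc j)" using d[of "Suc j"] by (simp only: corner_def)
      finally have 2: "\<pi> (d (Suc j)) o\<^sub>L (Up (Suc j) o\<^sub>L V) = \<pi> (d (Suc j)) o\<^sub>L Up j" .
      have "U o\<^sub>L (Vp (Suc j) o\<^sub>L \<pi> (d (Suc j)) o\<^sub>L Up (Suc j)) o\<^sub>L V
          = ((U o\<^sub>L Vp (Suc j)) o\<^sub>L \<pi> (d (Suc j))) o\<^sub>L (Up (Suc j) o\<^sub>L V)"
        by (simp only: comp_assoc)
      also have "\<dots> = Vp j o\<^sub>L (\<pi> (d (Suc j)) o\<^sub>L (Up (Suc j) o\<^sub>L V))"
        unfolding 1 by (simp only: comp_assoc)
      finally show ?thesis unfolding 2 by (simp only: comp_assoc)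
    qed
    have "U o\<^sub>L diag_op d (Suc n) o\<^sub>L V = \<pi> (\<delta> (d 0)) + (\<Sum>j\<le>n. Vp j o\<^sub>L \<pi> (d (Suc j)) o\<^sub>L Up j)"
      unfolding T S_def comp_add_left comp_add_right comp_sum cov step ..
    also have "\<pi> (\<delta> (d 0)) = (\<Sum>j\<le>n. if j = 0 then \<pi> (\<delta> (d 0)) else 0)" by (simp add: sum.delta)
    also have "\<dots> + (\<Sum>j\<le>n. Vp j o\<^sub>L \<pi> (d (Suc j)) o\<^sub>L Up j) = diag_op (diag_shift d) n"
      unfolding diag_op_def sum.distrib[symmetric]
      by (rule sum.cong) (auto simp: diag_shift_def op_power_0 pi_add)
    finally show ?thesis .
  qed
  ultimately show ?thesis
    using norm_max_projection[OF Q_closed Q_adj QQ Tc commT] norm_Q_comp[OF commT] by simp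
qed

theorem norm_diag_op:
  assumes "\<And>j. corner j j (d j)"
  shows "norm (diag_op d n)
    = max (Max ((\<lambda>i. infdist (partial_sum d i) J) ` {0..n})) (infdist (partial_sum d n) (Ker \<delta>))"
  using assms
proof (induction n arbitrary: d)
  case 0
  have "norm (diag_op d 0) = norm (\<pi> (d 0))" by (simp add: diag_op_def op_power_0)
  then show ?case
    using norm_max_projection[OF Q_closed Q_adj QQ pi_closed comm, of "d 0"]
    by (simp add: partial_sum_def infdist_kernel infdist_ideal norm_endo)
next
  case (Suc n)
  have d': "corner j j (diag_shift d j)" for j
    using corner_mono[OF Suc.prems[of "Suc j"], of j j] corner_one by (cases j) (auto simp: diag_shift_def)
  have "{0..Suc n} = insert 0 (Suc ` {0..n})" by (auto simp: image_iff) 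
  then have "Max ((\<lambda>i. infdist (partial_sum d i) J) ` {0..Suc n})
      = max (infdist (partial_sum d 0) J) (Max ((\<lambda>i. infdist (partial_sum d (Suc i)) J) ` {0..n}))"
    by (simp only: image_insert image_image) (rule Max_insert; simp)
  then show ?case
    unfolding norm_diag_op_Suc[of d, OF Suc.prems] Suc.IH[of "diag_shift d", OF d'] partial_sum_shift
    by (simp add: partial_sum_def[of d 0] max.assoc)
qed

subsection \<open>The representation of the matrix algebra\<close>

definition Phi :: "'a inf_matrix \<Rightarrow> ('h \<Rightarrow>\<^sub>L 'h)" where
  "Phi a = (\<Sum>m. \<Sum>n. Vp m o\<^sub>L \<pi> (a m n) o\<^sub>L Up n)"

lemma Phi_zero: "Phi 0 = 0"
  by (simp add: Phi_def pi_zero zero_fun_apply)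

lemma Phi_single: "Phi (single i j x) = Vp i o\<^sub>L \<pi> x o\<^sub>L Up j"
proof -
  have "(\<Sum>n. Vp m o\<^sub>L \<pi> (single i j x m n) o\<^sub>L Up n) = (if m = i then Vp i o\<^sub>L \<pi> x o\<^sub>L Up j else 0)" for m
    by (subst suminf_single[of j]) (auto simp: single_def pi_zero)
  then show ?thesis unfolding Phi_def by (subst suminf_single[of i]) auto
qed

lemma Phi_add:
  assumes a: "a \<in> M" and b: "b \<in> M"
  shows "Phi (a + b) = Phi a + Phi b"
proof -
  have row: "summable (\<lambda>n. Vp m o\<^sub>L \<pi> (a m n) o\<^sub>L Up n)" if "a \<in> M" for a m
  proof (rule summable_finite)
    show "finite (snd ` {(i, j). a i j \<noteq> 0})" using that by (auto simp: matrices_iff)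
    fix n assume "n \<notin> snd ` {(i, j). a i j \<noteq> 0}"
    then have "(m, n) \<notin> {(i, j). a i j \<noteq> 0}" by force
    then show "Vp m o\<^sub>L \<pi> (a m n) o\<^sub>L Up n = 0" by (simp add: pi_zero)
  qed
  have col: "summable (\<lambda>m. \<Sum>n. Vp m o\<^sub>L \<pi> (a m n) o\<^sub>L Up n)" if "a \<in> M" for a
  proof (rule summable_finite)
    show "finite (fst ` {(i, j). a i j \<noteq> 0})" using that by (auto simp: matrices_iff)
    fix m assume "m \<notin> fst ` {(i, j). a i j \<noteq> 0}"
    then have "(m, n) \<notin> {(i, j). a i j \<noteq> 0}" for n by force
    then show "(\<Sum>n. Vp m o\<^sub>L \<pi> (a m n) o\<^sub>L Up n) = 0" by (simp add: pi_zero)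
  qed
  have "(\<Sum>n. Vp m o\<^sub>L \<pi> ((a + b) m n) o\<^sub>L Up n)
      = (\<Sum>n. Vp m o\<^sub>L \<pi> (a m n) o\<^sub>L Up n) + (\<Sum>n. Vp m o\<^sub>L \<pi> (b m n) o\<^sub>L Up n)" for m
    unfolding plus_fun_apply pi_add comp_add_left comp_add_right
    by (rule suminf_add[symmetric]; rule row; rule a b)
  then show ?thesis unfolding Phi_def by (simp only: suminf_add[symmetric, OF col[OF a] col[OF b]])
qed

lemma Phi_closed: "a \<in> M \<Longrightarrow> Phi a \<in> bounded_ops"
  by (induction a rule: matrices_induct)
    (auto simp: Phi_zero Phi_single Phi_add op_closed Up_closed Vp_closed pi_closed)

lemma Phi_scale: "a \<in> M \<Longrightarrow> Phi (sc c a) = scale_op c (Phi a)"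
proof (induction a rule: matrices_induct)
  case (add a b)
  then show ?case unfolding sc_add by (simp add: Phi_add M_scale scale_op_add)
next
  case (single i j x)
  show ?case unfolding sc_single Phi_single pi_scale by (simp add: scale_op_comp Vp_closed)
qed (simp_all add: sc_zero Phi_zero scale_op_zero)

lemma Phi_star: "a \<in> M \<Longrightarrow> Phi (st a) = adj (Phi a)"
proof (induction a rule: matrices_induct)
  case (add a b)
  then show ?case unfolding st_add by (simp add: Phi_add M_star adj_add Phi_closed)
next
  case (single i j x)
  show ?case
    unfolding st_single Phi_single pi_star
    by (simp add: adj_comp op_closed Up_closed Vp_closed pi_closed adj_op_power U_closed V_closed adj_adj
        comp_assoc)
qed (simp_all add: st_zero Phi_zero adj_zero)

lemma Phi_mult:
  assumes a: "a \<in> M" and b: "b \<in> M"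
  shows "Phi (a \<star> b) = Phi a o\<^sub>L Phi b"
  using a
proof (induction a rule: matrices_induct)
  case (single i j x)
  note x = single
  show ?case
    using b
  proof (induction b rule: matrices_induct)
    case (single k l y)
    show ?case
    proof (cases k j rule: le_cases)
      case le
      then obtain d where "j = d + k" using le_Suc_ex by (metis add.commute)
      have "Up d o\<^sub>L Up k o\<^sub>L Vp k o\<^sub>L \<pi> y = Up d o\<^sub>L \<pi> (q k * y)"
        by (simp add: comp_assoc pi_mult flip: Up_Vp)
      also have "\<dots> = \<pi> ((\<delta> ^^ d) y) o\<^sub>L Up d" using single by (simp add: corner_def Up_pi)
      finally have key: "Up d o\<^sub>L Up k o\<^sub>L Vp k o\<^sub>L \<pi> y = \<pi> ((\<delta> ^^ d) y) o\<^sub>L Up d" .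
      have "Phi (single i j x) o\<^sub>L Phi (single k l y) = Vp i o\<^sub>L \<pi> x o\<^sub>L (Up d o\<^sub>L Up k o\<^sub>L Vp k o\<^sub>L \<pi> y) o\<^sub>L Up l"
        unfolding Phi_single \<open>j = d + k\<close> op_power_add by (simp only: comp_assoc)
      also have "\<dots> = Vp i o\<^sub>L \<pi> (x * (\<delta> ^^ d) y) o\<^sub>L Up (d + l)"
        unfolding key op_power_add pi_mult by (simp only: comp_assoc)
      finally show ?thesis
        using mprod_single_le[of i k d x l y] by (simp add: \<open>j = d + k\<close> Phi_single add.commute)
    next
      case ge
      then obtain d where "k = j + d" using le_Suc_ex by blast
      have "\<pi> x o\<^sub>L (Up j o\<^sub>L Vp j) o\<^sub>L Vp d = \<pi> (x * q j) o\<^sub>L Vp d"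
        by (simp add: pi_mult Up_Vp)
      also have "\<dots> = Vp d o\<^sub>L \<pi> ((\<delta> ^^ d) x)" using x by (simp add: corner_def pi_Vp)
      finally have key: "\<pi> x o\<^sub>L (Up j o\<^sub>L Vp j) o\<^sub>L Vp d = Vp d o\<^sub>L \<pi> ((\<delta> ^^ d) x)" .
      have "Phi (single i j x) o\<^sub>L Phi (single k l y) = Vp i o\<^sub>L (\<pi> x o\<^sub>L (Up j o\<^sub>L Vp j) o\<^sub>L Vp d) o\<^sub>L \<pi> y o\<^sub>L Up l"
        unfolding Phi_single \<open>k = j + d\<close> op_power_add by (simp only: comp_assoc)
      also have "\<dots> = Vp (i + d) o\<^sub>L \<pi> ((\<delta> ^^ d) x * y) o\<^sub>L Up l"
        unfolding key op_power_add pi_mult by (simp only: comp_assoc)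
      finally show ?thesis
        using mprod_single_ge[of i j x d l y] by (simp add: \<open>k = j + d\<close> Phi_single)
    qed
  qed (simp_all add: mprod_zero Phi_zero mprod_add_right M_mprod M_single x Phi_add comp_add_right)
qed (simp_all add: mprod_zero Phi_zero mprod_add_left M_mprod b Phi_add comp_add_left)

lemma Phi_sum: "(\<And>k. k \<in> A \<Longrightarrow> f k \<in> M) \<Longrightarrow> Phi (\<Sum>k\<in>A. f k) = (\<Sum>k\<in>A. Phi (f k)) \<and> (\<Sum>k\<in>A. f k) \<in> M"
  by (induction A rule: infinite_finite_induct) (auto simp: Phi_zero Phi_add M_zero M_add)

lemma Phi_diff: "a \<in> M \<Longrightarrow> b \<in> M \<Longrightarrow> Phi (a - b) = Phi a - Phi b"
proof -
  assume a: "a \<in> M" and b: "b \<in> M"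
  have eq: "a - b = a + sc (-1) b" by (simp add: fun_eq_iff plus_fun_apply scaleC_minus_one)
  have "scale_op (-1) (Phi b) = - Phi b"
    by (rule blinfun_eqI) (simp add: ap_scale_op scaleC_minus_one blinfun.bilinear_simps)
  then show ?thesis unfolding eq by (simp add: Phi_add a b M_scale Phi_scale)
qed

subsection \<open>Comparison with the matrix seminorm\<close>

lemma ex_size: "a \<in> M \<Longrightarrow> \<exists>N. \<forall>i j. a i j \<noteq> 0 \<longrightarrow> i \<le> N \<and> j \<le> N"
proof -
  assume "a \<in> M"
  then have "finite ((\<lambda>(i, j). max i j) ` {(i, j). a i j \<noteq> 0})" by (auto simp: matrices_iff)
  then obtain N where "\<And>v. v \<in> (\<lambda>(i, j). max i j) ` {(i, j). a i j \<noteq> 0} \<Longrightarrow> v \<le> N"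
    by (meson finite_nat_set_iff_bounded_le)
  then have "max i j \<le> N" if "a i j \<noteq> 0" for i j using that by force
  then show ?thesis by (meson max.boundedE)
qed

lemma corner_diag_entry: "a \<in> M \<Longrightarrow> corner j j (diag_entry a k j)"
  unfolding diag_entry_def using corner_mono[OF M_corner] by auto

lemma diag_entry_zero:
  assumes "\<forall>i j. a i j \<noteq> 0 \<longrightarrow> i \<le> N \<and> j \<le> N" "N < n"
  shows "diag_entry a k n = 0"
  using assms unfolding diag_entry_def by (metis leD)

lemma diag_op_stable:
  assumes "\<And>j. N < j \<Longrightarrow> d j = 0" "N \<le> n"
  shows "diag_op d n = diag_op d N"
  unfolding diag_op_def using assms by (intro sum.mono_neutral_right) (auto simp: pi_zero)

text \<open>Beyond the support the sequence in the definition is constant, since by \<open>norm_diag_op\<close> it is the norm of a diagonal sum to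
  which only zero terms are added.\<close>

lemma mat_seminorm_eq:
  assumes a: "a \<in> M" and N: "\<forall>i j. a i j \<noteq> 0 \<longrightarrow> i \<le> N \<and> j \<le> N"
  shows "mat_seminorm \<delta> J a = (\<Sum>k\<in>{- int N..int N}. norm (diag_op (diag_entry a k) N))"
proof -
  have lim: "lim (\<lambda>n. max (Max ((\<lambda>i. infdist (\<Sum>j\<le>i. (\<delta> ^^ (i - j)) (diag_entry a k j)) J) ` {0..n}))
      (infdist (\<Sum>j\<le>n. (\<delta> ^^ (n - j)) (diag_entry a k j)) (Ker \<delta>))) = norm (diag_op (diag_entry a k) N)" for k
  proof -
    have "(\<lambda>n. norm (diag_op (diag_entry a k) n)) \<longlonglongrightarrow> norm (diag_op (diag_entry a k) N)"
    proof (rule tendsto_eventually, unfold eventually_sequentially, intro exI allI impI)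
      fix n assume "N \<le> n"
      then show "norm (diag_op (diag_entry a k) n) = norm (diag_op (diag_entry a k) N)"
        using diag_op_stable[of N "diag_entry a k" n] diag_entry_zero[OF N] by metis
    qed
    then show ?thesis
      unfolding norm_diag_op[of "diag_entry a k", OF corner_diag_entry[OF a]] partial_sum_def by (rule limI)
  qed
  have zero: "norm (diag_op (diag_entry a k) N) = 0" if "k \<notin> {- int N..int N}" for k
  proof -
    have "diag_entry a k j = 0" for j
    proof (rule ccontr)
      assume "diag_entry a k j \<noteq> 0"
      then show False using that N[rule_format, of j "j + nat k"] N[rule_format, of "j + nat (- k)" j] by (auto simp: diag_entry_def split: if_splits)
    qed
    then show ?thesis by (simp add: diag_op_def pi_zero)
  qed
  have "mat_seminorm \<delta> J a = (\<Sum>\<^sub>\<infinity>k\<in>UNIV. norm (diag_op (diag_entry a k) N))"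
    unfolding mat_seminorm_def lim ..
  also have "\<dots> = (\<Sum>\<^sub>\<infinity>k\<in>{- int N..int N}. norm (diag_op (diag_entry a k) N))"
    using zero by (intro infsum_cong_neutral) auto
  finally show ?thesis by simp
qed

lemma mat_seminorm_nonneg: "a \<in> M \<Longrightarrow> 0 \<le> mat_seminorm \<delta> J a"
  using ex_size[of a] mat_seminorm_eq[of a] by (metis norm_ge_zero sum_nonneg)

text \<open>The operator \<open>U*^m \<pi>(a) U^n\<close> equals \<open>(U*^m \<pi>(a) U^m) U^(n - m)\<close> for \<open>m \<le> n\<close>, and symmetrically for \<open>n \<le> m\<close>.\<close>

lemma Phi_diag_part:
  assumes a: "a \<in> M" and N: "\<forall>i j. a i j \<noteq> 0 \<longrightarrow> i \<le> N \<and> j \<le> N"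
  shows "Phi (diag_part k a) =
    (if 0 \<le> k then diag_op (diag_entry a k) N o\<^sub>L Up (nat k) else Vp (nat (- k)) o\<^sub>L diag_op (diag_entry a k) N)"
proof -
  have comp_sum: "R o\<^sub>L (\<Sum>j\<in>A. f j) = (\<Sum>j\<in>A. R o\<^sub>L f j)" "(\<Sum>j\<in>A. f j) o\<^sub>L R = (\<Sum>j\<in>A. f j o\<^sub>L R)"
    for R and f :: "nat \<Rightarrow> 'h \<Rightarrow>\<^sub>L 'h" and A
    by (induction A rule: infinite_finite_induct) (auto simp: comp_add_left comp_add_right)
  have ev: "(\<Sum>k\<in>A. f k) i j = (\<Sum>k\<in>A. f k i j)" for A i j and f :: "nat \<Rightarrow> 'a inf_matrix"
    by (induction A rule: infinite_finite_induct) (auto simp: plus_fun_apply zero_fun_apply)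
  show ?thesis
  proof (cases "0 \<le> k")
    case True
    then obtain r where r: "k = int r" using nonneg_int_cases by blast
    have "diag_part k a = (\<Sum>j\<le>N. single j (j + r) (a j (j + r)))"
    proof (intro ext)
      fix m n
      have "(\<Sum>j\<le>N. single j (j + r) (a j (j + r)) m n) = (\<Sum>j\<le>N. if j = m then (if n = m + r then a m n else 0) else 0)"
        by (rule sum.cong) (auto simp: single_def)
      then show "diag_part k a m n = (\<Sum>j\<le>N. single j (j + r) (a j (j + r))) m n"
        unfolding ev using N[rule_format, of m n] by (auto simp: diag_part_def r sum.delta)
    qed
    then have "Phi (diag_part k a) = (\<Sum>j\<le>N. Phi (single j (j + r) (a j (j + r))))"
      using Phi_sum[of "{..N}" "\<lambda>j. single j (j + r) (a j (j + r))"] by (simp add: M_single M_corner a)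
    also have "\<dots> = diag_op (diag_entry a k) N o\<^sub>L Up r"
      unfolding diag_op_def comp_sum Phi_single
      by (rule sum.cong) (simp_all add: diag_entry_def r op_power_add comp_assoc)
    finally show ?thesis by (simp add: r)
  next
    case False
    then obtain r where r: "k = - int r" "0 < r" by (metis neg_int_cases not_le)
    have "diag_part k a = (\<Sum>j\<le>N. single (j + r) j (a (j + r) j))"
    proof (intro ext)
      fix m n
      have "(\<Sum>j\<le>N. single (j + r) j (a (j + r) j) m n) = (\<Sum>j\<le>N. if j = n then (if m = n + r then a m n else 0) else 0)"
        by (rule sum.cong) (auto simp: single_def)
      then show "diag_part k a m n = (\<Sum>j\<le>N. single (j + r) j (a (j + r) j)) m n"
        unfolding ev using N[rule_format, of m n] by (auto simp: diag_part_def r sum.delta)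
    qed
    then have "Phi (diag_part k a) = (\<Sum>j\<le>N. Phi (single (j + r) j (a (j + r) j)))"
      using Phi_sum[of "{..N}" "\<lambda>j. single (j + r) j (a (j + r) j)"] by (simp add: M_single M_corner a)
    also have "\<dots> = Vp r o\<^sub>L diag_op (diag_entry a k) N"
      unfolding diag_op_def comp_sum Phi_single
    proof (rule sum.cong[OF refl])
      fix j
      show "Vp (j + r) o\<^sub>L \<pi> (a (j + r) j) o\<^sub>L Up j = Vp r o\<^sub>L (Vp j o\<^sub>L \<pi> (diag_entry a k j) o\<^sub>L Up j)"
        using r op_power_add[of V r j] by (simp add: diag_entry_def comp_assoc add.commute)
    qed
    finally show ?thesis using r by simp
  qed
qed

lemma norm_Phi_le_mat_seminorm:
  assumes a: "a \<in> M"
  shows "norm (Phi a) \<le> mat_seminorm \<delta> J a"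
proof -
  obtain N where N: "\<forall>i j. a i j \<noteq> 0 \<longrightarrow> i \<le> N \<and> j \<le> N" using ex_size[OF a] by blast
  have "diags_in {- int N..int N} a" unfolding diags_in_def using N by fastforce
  then have "Phi a = (\<Sum>k\<in>{- int N..int N}. Phi (diag_part k a))"
    using sum_diag_parts[of "{- int N..int N}" a] Phi_sum[of "{- int N..int N}" "\<lambda>k. diag_part k a"]
    by (simp add: M_diag_part a)
  also have "norm \<dots> \<le> (\<Sum>k\<in>{- int N..int N}. norm (diag_op (diag_entry a k) N))"
  proof (intro order.trans[OF norm_sum] sum_mono)
    fix k
    show "norm (Phi (diag_part k a)) \<le> norm (diag_op (diag_entry a k) N)"
      unfolding Phi_diag_part[OF a N]
      using norm_comp_contractions(2)[OF norm_Up] norm_comp_contractions(1)[OF norm_Vp] by simp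
  qed
  also have "\<dots> = mat_seminorm \<delta> J a" using mat_seminorm_eq[OF a N] by simp
  finally show ?thesis .
qed

lemma mat_seminorm_diagonal:
  assumes a: "a \<in> M" and diag: "diags_in {0} a"
  shows "mat_seminorm \<delta> J a = norm (Phi a)"
proof -
  obtain N where N: "\<forall>i j. a i j \<noteq> 0 \<longrightarrow> i \<le> N \<and> j \<le> N" using ex_size[OF a] by blast
  have "diag_op (diag_entry a k) N = 0" if "k \<noteq> 0" for k
  proof -
    have "diag_entry a k j = 0" for j
    proof (rule ccontr)
      assume "diag_entry a k j \<noteq> 0"
      then show False using that diag by (force simp: diag_entry_def diags_in_def split: if_splits)
    qed
    then show ?thesis by (simp add: diag_op_def pi_zero)
  qed
  then have "mat_seminorm \<delta> J a = (\<Sum>k\<in>{- int N..int N}. if k = 0 then norm (diag_op (diag_entry a 0) N) else 0)"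
    unfolding mat_seminorm_eq[OF a N] by (intro sum.cong) auto
  also have "\<dots> = norm (diag_op (diag_entry a 0) N)" by (simp add: sum.delta)
  also have "diag_op (diag_entry a 0) N = Phi (diag_part 0 a)"
    using Phi_diag_part[OF a N, of 0] by (simp add: op_power_0)
  also have "diag_part 0 a = a" using diag_part_of_homogeneous[OF diag, of 0] by simp
  finally show ?thesis .
qed

lemma Phi_diagonal_series:
  assumes a: "a \<in> M"
  shows "(\<Sum>m. Vp m o\<^sub>L \<pi> (a m m) o\<^sub>L Up m) = Phi (diag_part 0 a)"
proof -
  obtain N where N: "\<forall>i j. a i j \<noteq> 0 \<longrightarrow> i \<le> N \<and> j \<le> N" using ex_size[OF a] by blast
  have "(\<Sum>m. Vp m o\<^sub>L \<pi> (a m m) o\<^sub>L Up m) = (\<Sum>m\<le>N. Vp m o\<^sub>L \<pi> (a m m) o\<^sub>L Up m)"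
  proof (rule suminf_finite)
    fix m assume "m \<notin> {..N}"
    then have "a m m = 0" using N[rule_format, of m m] by auto
    then show "Vp m o\<^sub>L \<pi> (a m m) o\<^sub>L Up m = 0" by (simp add: pi_zero)
  qed simp
  also have "\<dots> = Phi (diag_part 0 a)"
    using Phi_diag_part[OF a N, of 0] by (simp add: op_power_0 diag_op_def diag_entry_def)
  finally show ?thesis .
qed

end

context covariant_system
begin

section \<open>The induced representation of the crossed product\<close>

sublocale X: enveloping "matrix_algebra \<delta> J" "single 0 0 1"
proof (intro enveloping.intro unital_star_algebra_matrices enveloping_axioms.intro)
  show "0 \<le> alg_norm (matrix_algebra \<delta> J) a" if "a \<in> alg_carrier (matrix_algebra \<delta> J)" for a
    using that mat_seminorm_nonneg by (simp add: matrix_algebra_def)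
qed

lemma matrix_algebra_simps:
  "alg_carrier (matrix_algebra \<delta> J) = M" "alg_mult (matrix_algebra \<delta> J) a b = a \<star> b"
  "alg_scale (matrix_algebra \<delta> J) c a = sc c a" "alg_star (matrix_algebra \<delta> J) a = st a"
  "alg_norm (matrix_algebra \<delta> J) a = mat_seminorm \<delta> J a" "alg_add (matrix_algebra \<delta> J) a b = a + b"
  by (simp_all add: matrix_algebra_def fun_eq_iff plus_fun_apply)

lemmas ms = matrix_algebra_simps

lemma seminorm_Phi: "cstar_seminorm_on (matrix_algebra \<delta> J) (\<lambda>a. norm (Phi a))"
  unfolding cstar_seminorm_on_def ms
  by (auto simp: Phi_add Phi_scale Phi_mult Phi_star M_star norm_triangle_ineq norm_scale_op norm_comp_le
      norm_adj_comp Phi_closed)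

lemma norm_Phi_le: "a \<in> M \<Longrightarrow> norm (Phi a) \<le> X.P a"
  using X.enveloping_seminorm_upper[of "\<lambda>a. norm (Phi a)" a] seminorm_Phi norm_Phi_le_mat_seminorm
  by (simp add: ms)

lemma P_diagonal: "a \<in> M \<Longrightarrow> diags_in {0} a \<Longrightarrow> X.P a = norm (Phi a)"
  using norm_Phi_le[of a] X.enveloping_seminorm_le_norm[of a] mat_seminorm_diagonal[of a] by (simp add: ms)

abbreviation CP where "CP \<equiv> crossed_product \<delta> J"

lemma CP_eq: "CP = X.E"
  by (simp add: crossed_product_def)

definition rep :: "(nat \<Rightarrow> 'a inf_matrix) set \<Rightarrow> ('h \<Rightarrow>\<^sub>L 'h)" where
  "rep = X.ext Phi"

lemma rep_tendsto: "X.p_cauchy Y \<Longrightarrow> (\<lambda>n. Phi (Y n)) \<longlonglongrightarrow> rep (X.cls Y)"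
  unfolding rep_def by (rule X.ext_tendsto) (simp_all add: ms Phi_diff norm_Phi_le)

lemma cauchy_M: "X.p_cauchy Y \<Longrightarrow> Y n \<in> M"
  using X.p_cauchy_carrier[of Y n] by (simp add: ms)

lemma const_cauchy: "a \<in> M \<Longrightarrow> X.p_cauchy (\<lambda>n. a)"
  by (rule X.p_cauchy_const) (simp add: ms)

lemma rep_const: "a \<in> M \<Longrightarrow> rep (X.cls (\<lambda>n. a)) = Phi a"
  using rep_tendsto[OF const_cauchy] LIMSEQ_unique tendsto_const by blast

lemma cp_embed_eq: "cp_embed \<delta> J a = X.cls (\<lambda>n. single 0 0 a)"
  by (simp add: cp_embed_def X.canonical_map_eq_cls mat_embed_eq_single)

lemma u_hat_eq: "u_hat \<delta> J = X.cls (\<lambda>n. single 0 1 (\<delta> 1))"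
  by (simp add: u_hat_def X.canonical_map_eq_cls mat_u_eq_single)

lemma M_u: "single 0 1 (\<delta> 1) \<in> M"
  by (rule M_single) (simp add: corner_def flip: endo_mult)

lemma M_embed: "single 0 0 a \<in> M"
  by (rule M_single) (rule corner_one)

lemma pi_U: "\<pi> (\<delta> 1) o\<^sub>L U = U"
  using cov[of 1] UUU by (simp add: pi_one)

lemma rep_embed: "rep (cp_embed \<delta> J a) = \<pi> a"
  unfolding cp_embed_eq rep_const[OF M_embed] Phi_single by (simp add: op_power_0)

lemma rep_u: "rep (u_hat \<delta> J) = U"
  unfolding u_hat_eq rep_const[OF M_u] Phi_single by (simp add: op_power_0 op_power_Suc pi_U)

subsection \<open>The range of the representation\<close>

abbreviation G where "G \<equiv> generated_cstar (range \<pi> \<union> {U})"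

lemma cstar_subalgebra_closure: "cstar_subalgebra (closure (Phi ` M))"
proof -
  have seq: "\<exists>Y. (\<forall>n. Y n \<in> M) \<and> (\<lambda>n. Phi (Y n)) \<longlonglongrightarrow> T" if "T \<in> closure (Phi ` M)" for T
  proof -
    obtain f where f: "\<And>n. f n \<in> Phi ` M" "f \<longlonglongrightarrow> T" using \<open>T \<in> closure (Phi ` M)\<close> closure_sequential by blast
    then have "\<forall>n. \<exists>a. a \<in> M \<and> f n = Phi a" by blast
    then obtain Y where Y: "\<And>n. Y n \<in> M" "\<And>n. f n = Phi (Y n)" by metis
    then have "f = (\<lambda>n. Phi (Y n))" by blast
    then show ?thesis using f Y by blast
  qed
  have mem: "T \<in> closure (Phi ` M)" if "\<And>n. Y n \<in> M" "(\<lambda>n. Phi (Y n)) \<longlonglongrightarrow> T" for Y T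
    unfolding closure_sequential using that by (intro exI[of _ "\<lambda>n. Phi (Y n)"]) simp
  show ?thesis
    unfolding cstar_subalgebra_def
  proof (intro conjI ballI allI)
    show "closure (Phi ` M) \<subseteq> bounded_ops"
      by (intro closure_minimal closed_bounded_ops) (auto simp: Phi_closed)
    show "0 \<in> closure (Phi ` M)"
      using Phi_zero M_zero closure_subset by (metis image_eqI subsetD)
    fix T assume T: "T \<in> closure (Phi ` M)"
    then have Tb: "T \<in> bounded_ops" using \<open>closure (Phi ` M) \<subseteq> bounded_ops\<close> by blast
    obtain Y where Y: "\<forall>n. Y n \<in> M" "(\<lambda>n. Phi (Y n)) \<longlonglongrightarrow> T" using seq[OF T] by blast
    {
      fix R assume R: "R \<in> closure (Phi ` M)"
      obtain Z where Z: "\<forall>n. Z n \<in> M" "(\<lambda>n. Phi (Z n)) \<longlonglongrightarrow> R" using seq[OF R] by blast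
      show "T + R \<in> closure (Phi ` M)"
        by (rule mem[of "\<lambda>n. Y n + Z n"]) (use Y Z in \<open>auto simp: M_add Phi_add intro: tendsto_add\<close>)
      show "T o\<^sub>L R \<in> closure (Phi ` M)"
        by (rule mem[of "\<lambda>n. Y n \<star> Z n"]) (use Y Z in \<open>auto simp: M_mprod Phi_mult intro: comp_tendsto\<close>)
    }
    show "scale_op c T \<in> closure (Phi ` M)" for c
      by (rule mem[of "\<lambda>n. sc c (Y n)"]) (use Y in \<open>auto simp: M_scale Phi_scale intro: scale_op_tendsto\<close>)
    show "adj T \<in> closure (Phi ` M)"
      by (rule mem[of "\<lambda>n. st (Y n)"])
        (use Y Tb in \<open>auto simp: M_star Phi_star Phi_closed intro: adj_tendsto\<close>)
  qed simp
qed

lemma generated_eq: "G = closure (Phi ` M)"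
proof
  have "\<pi> a = Phi (single 0 0 a)" for a by (simp add: Phi_single op_power_0)
  moreover have "U = Phi (single 0 1 (\<delta> 1))" by (simp add: Phi_single op_power_0 op_power_Suc pi_U)
  ultimately have "range \<pi> \<union> {U} \<subseteq> Phi ` M" using M_embed M_u by (metis (no_types, lifting) Un_least image_subsetI insert_subset empty_subsetI image_eqI)
  then have "range \<pi> \<union> {U} \<subseteq> closure (Phi ` M)" using closure_subset by blast
  then show "G \<subseteq> closure (Phi ` M)"
    unfolding generated_cstar_def using cstar_subalgebra_closure by blast
  show "closure (Phi ` M) \<subseteq> G"
    unfolding generated_cstar_def
  proof (intro Inter_greatest, elim CollectE conjE)
    fix S assume S: "cstar_subalgebra S" "range \<pi> \<union> {U} \<subseteq> S"
    have pS: "\<pi> a \<in> S" and US: "U \<in> S" and VS: "V \<in> S" for a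
      using S by (auto simp: cstar_subalgebra_def)
    have comp: "T o\<^sub>L R \<in> S" if "T \<in> S" "R \<in> S" for T R using that S by (auto simp: cstar_subalgebra_def)
    have right: "T o\<^sub>L op_power R n \<in> S" if "T \<in> S" "R \<in> S" for T R n
    proof (induction n)
      case (Suc n)
      have "T o\<^sub>L op_power R (Suc n) = (T o\<^sub>L op_power R n) o\<^sub>L R" by (simp only: op_power_Suc_right comp_assoc)
      then show ?case using Suc comp that by simp
    qed (simp add: op_power_0 that)
    have left: "op_power R n o\<^sub>L T \<in> S" if "T \<in> S" "R \<in> S" for T R n
    proof (induction n)
      case (Suc n)
      have "op_power R (Suc n) o\<^sub>L T = R o\<^sub>L (op_power R n o\<^sub>L T)" by (simp only: op_power_Suc comp_assoc)
      then show ?case using Suc comp that by simp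
    qed (simp add: op_power_0 that)
    have "Phi a \<in> S" if "a \<in> M" for a
      using that
    proof (induction a rule: matrices_induct)
      case zero
      then show ?case using S by (simp add: Phi_zero cstar_subalgebra_def)
    next
      case (single i j x)
      show ?case unfolding Phi_single by (intro right left pS US VS)
    next
      case (add a b)
      then show ?case using S by (simp add: Phi_add cstar_subalgebra_def)
    qed
    then show "closure (Phi ` M) \<subseteq> S"
      using S by (intro closure_minimal) (auto simp: cstar_subalgebra_def)
  qed
qed

text \<open>Lifting in the dense subalgebra: elements of small image have, up to an arbitrarily small error, a preimage of small
  seminorm.\<close>

lemma bounded_lift:
  assumes a: "a \<in> M" and r: "norm (Phi a) < r" and e: "0 < \<epsilon>"
  obtains b where "b \<in> M" "X.P b \<le> r" "norm (Phi b - Phi a) \<le> \<epsilon>"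
proof (rule X.approximate_lifting[OF seminorm_Phi _ r])
  show "a \<in> alg_carrier (matrix_algebra \<delta> J)" using a by (simp add: ms)
  fix y assume y: "X.p_cauchy y" "(\<lambda>n. norm (Phi (y n - a))) \<longlonglongrightarrow> 0" "\<forall>\<^sub>F n in sequentially. X.P (y n) \<le> r"
  have "\<forall>\<^sub>F n in sequentially. norm (Phi (y n - a)) < \<epsilon>" using order_tendstoD(2)[OF y(2) e] .
  with y(3) have "\<forall>\<^sub>F n in sequentially. X.P (y n) \<le> r \<and> norm (Phi (y n - a)) < \<epsilon>"
    by (rule eventually_conj)
  then obtain n where "X.P (y n) \<le> r" "norm (Phi (y n - a)) < \<epsilon>"
    using eventually_happens'[OF sequentially_bot] by blast
  then show thesis using that[of "y n"] cauchy_M[OF y(1)] a by (simp add: Phi_diff)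
qed

text \<open>Surjectivity by successive approximation: the error \<open>T - Phi (Y n)\<close> is halved in each step by adding a
  correction whose seminorm is bounded by a multiple of the current error, so the corrections are summable.\<close>

lemma cauchy_lift:
  assumes T: "T \<in> closure (Phi ` M)"
  obtains Y where "X.p_cauchy Y" "(\<lambda>n. Phi (Y n)) \<longlonglongrightarrow> T"
proof -
  have approx: "\<exists>b\<in>M. norm (T - Phi b) < \<epsilon>" if "0 < \<epsilon>" for \<epsilon>
    using T that unfolding closure_approachable by (auto simp: dist_norm norm_minus_commute)
  define h where "h n = (1 / 2 :: real) ^ n" for n :: nat
  have h: "0 < h n" "h (Suc n) = h n / 2" for n by (auto simp: h_def)
  have "\<exists>Y. \<forall>n. (Y n \<in> M \<and> norm (T - Phi (Y n)) \<le> h n) \<and> X.P (Y (Suc n) - Y n) \<le> 2 * h n"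
  proof (rule dependent_nat_choice)
    show "\<exists>x. x \<in> M \<and> norm (T - Phi x) \<le> h 0" using approx[OF h(1)[of 0]] less_imp_le by blast
  next
    fix x n assume x: "x \<in> M \<and> norm (T - Phi x) \<le> h n"
    obtain b where b: "b \<in> M" "norm (T - Phi b) < h n / 4" using approx[of "h n / 4"] h(1)[of n] by auto
    have bx: "b - x \<in> M" using X.diff_closed[of b x] b x by (simp add: ms)
    have "norm (Phi (b - x)) = norm ((T - Phi x) - (T - Phi b))" using b x by (simp add: Phi_diff)
    also have "\<dots> \<le> norm (T - Phi x) + norm (T - Phi b)" by (rule norm_triangle_ineq4)
    also have "\<dots> < 2 * h n" using b x h(1)[of n] by linarith
    finally obtain c where c: "c \<in> M" "X.P c \<le> 2 * h n" "norm (Phi c - Phi (b - x)) \<le> h n / 4"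
      using bounded_lift[OF bx, of "2 * h n" "h n / 4"] h(1)[of n] by auto
    have "norm (T - Phi (x + c)) = norm ((T - Phi b) - (Phi c - Phi (b - x)))"
      using b c x by (simp add: Phi_diff Phi_add algebra_simps)
    also have "\<dots> \<le> norm (T - Phi b) + norm (Phi c - Phi (b - x))" by (rule norm_triangle_ineq4)
    also have "\<dots> \<le> h (Suc n)" using b c by (simp add: h)
    finally have "norm (T - Phi (x + c)) \<le> h (Suc n)" .
    then show "\<exists>y. (y \<in> M \<and> norm (T - Phi y) \<le> h (Suc n)) \<and> X.P (y - x) \<le> 2 * h n"
      using c x by (intro exI[of _ "x + c"]) (simp add: M_add)
  qed
  then obtain Y where Y: "\<And>n. Y n \<in> M" "\<And>n. norm (T - Phi (Y n)) \<le> h n" "\<And>n. X.P (Y (Suc n) - Y n) \<le> 2 * h n"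
    by metis
  \<comment> \<open>The sum of the bounds \<open>2 * h\<close> telescopes, as \<open>2 * h i = 4 * h i - 4 * h (Suc i)\<close>.\<close>
  have step: "X.P (Y m - Y (m + k)) \<le> 4 * h m - 4 * h (m + k)" for m k
  proof (induction k)
    case 0
    then show ?case by (simp add: X.p_zero)
  next
    case (Suc k)
    have "X.P (Y m - Y (m + Suc k)) \<le> X.P (Y m - Y (m + k)) + X.P (Y (m + k) - Y (m + Suc k))"
      by (rule X.p_triangle) (simp_all add: ms Y)
    also have "X.P (Y (m + k) - Y (m + Suc k)) \<le> 2 * h (m + k)"
      using Y(3)[of "m + k"] X.p_diff_commute[of "Y (m + k)" "Y (m + Suc k)"] by (simp add: ms Y)
    finally show ?case using Suc h(2)[of "m + k"] unfolding add_Suc_right by linarith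
  qed
  have h0: "h \<longlonglongrightarrow> 0" unfolding h_def by (rule LIMSEQ_power_zero) simp
  have "X.p_cauchy Y"
  proof (rule X.p_cauchyI)
    show "Y n \<in> alg_carrier (matrix_algebra \<delta> J)" for n by (simp add: ms Y)
    show "X.P (Y m - Y n) \<le> 4 * h m" if "m \<le> n" for m n
      using step[of m "n - m"] h(1)[of n] that by simp
    show "(\<lambda>m. 4 * h m) \<longlonglongrightarrow> 0" using tendsto_mult_left[OF h0, of 4] by simp
  qed
  moreover have "(\<lambda>n. norm (Phi (Y n) - T)) \<longlonglongrightarrow> 0"
    by (rule squeeze_to_0[OF norm_ge_zero _ h0]) (use Y(2) in \<open>simp add: norm_minus_commute\<close>)
  then have "(\<lambda>n. Phi (Y n)) \<longlonglongrightarrow> T" by (rule LIM_zero_cancel[OF tendsto_norm_zero_cancel])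
  ultimately show thesis by (rule that)
qed

lemma rep_range: "rep ` alg_carrier CP = G"
proof
  show "rep ` alg_carrier CP \<subseteq> G"
  proof
    fix T assume "T \<in> rep ` alg_carrier CP"
    then obtain Y where Y: "X.p_cauchy Y" "T = rep (X.cls Y)" by (auto simp: CP_eq X.carrier_E)
    have "\<forall>n. Phi (Y n) \<in> Phi ` M" using cauchy_M[OF Y(1)] by blast
    then show "T \<in> G"
      unfolding generated_eq closure_sequential using rep_tendsto[OF Y(1)] Y(2)
      by (intro exI[of _ "\<lambda>n. Phi (Y n)"]) simp
  qed
  show "G \<subseteq> rep ` alg_carrier CP"
  proof
    fix T assume "T \<in> G"
    then have "T \<in> closure (Phi ` M)" by (simp only: generated_eq)
    then obtain Y where Y: "X.p_cauchy Y" "(\<lambda>n. Phi (Y n)) \<longlonglongrightarrow> T" by (rule cauchy_lift)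
    then have "T = rep (X.cls Y)" using rep_tendsto[OF Y(1)] LIMSEQ_unique by blast
    then show "T \<in> rep ` alg_carrier CP" using X.cls_in_carrier[OF Y(1)] by (simp add: CP_eq)
  qed
qed

lemma rep_hom: "star_hom CP (op_algebra G) rep"
  unfolding star_hom_def
proof (intro conjI ballI allI)
  show "rep \<in> alg_carrier CP \<rightarrow> alg_carrier (op_algebra G)"
    using rep_range by (auto simp: op_algebra_def)
  fix C c assume "C \<in> alg_carrier CP"
  then obtain Y where Y: "X.p_cauchy Y" "C = X.cls Y" by (auto simp: CP_eq X.carrier_E)
  have "(\<lambda>n. Phi (sc c (Y n))) \<longlonglongrightarrow> rep (X.cls (\<lambda>n. sc c (Y n)))"
    using rep_tendsto[OF X.p_cauchy_scale[OF Y(1), of c]] by (simp add: ms)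
  then have "rep (X.cls (\<lambda>n. sc c (Y n))) = scale_op c (rep (X.cls Y))"
    using scale_op_tendsto[OF rep_tendsto[OF Y(1)], of c] by (simp add: Phi_scale cauchy_M[OF Y(1)] LIMSEQ_unique)
  then show "rep (alg_scale CP c C) = alg_scale (op_algebra G) c (rep C)"
    using X.scale_cls[OF Y(1), of c] by (simp add: CP_eq Y(2) op_algebra_def ms)
  have bd: "rep (X.cls Y) \<in> bounded_ops" if "X.p_cauchy Y" for Y
    using closed_sequentially[OF closed_bounded_ops _ rep_tendsto[OF that]] Phi_closed cauchy_M[OF that] by blast
  have "(\<lambda>n. Phi (st (Y n))) \<longlonglongrightarrow> rep (X.cls (\<lambda>n. st (Y n)))"
    using rep_tendsto[OF X.p_cauchy_star[OF Y(1)]] by (simp add: ms)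
  moreover have "(\<lambda>n. adj (Phi (Y n))) \<longlonglongrightarrow> adj (rep (X.cls Y))"
    by (rule adj_tendsto[OF Phi_closed[OF cauchy_M[OF Y(1)]] bd[OF Y(1)] rep_tendsto[OF Y(1)]])
  ultimately have "rep (X.cls (\<lambda>n. st (Y n))) = adj (rep (X.cls Y))"
    by (simp add: Phi_star cauchy_M[OF Y(1)] LIMSEQ_unique)
  then show "rep (alg_star CP C) = alg_star (op_algebra G) (rep C)"
    using X.star_cls[OF Y(1)] by (simp add: CP_eq Y(2) op_algebra_def ms)
  fix D assume "D \<in> alg_carrier CP"
  then obtain Z where Z: "X.p_cauchy Z" "D = X.cls Z" by (auto simp: CP_eq X.carrier_E)
  have "(\<lambda>n. Phi (Y n + Z n)) \<longlonglongrightarrow> rep (X.cls (\<lambda>n. Y n + Z n))"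
    using rep_tendsto[OF X.p_cauchy_add[OF Y(1) Z(1)]] .
  then have "rep (X.cls (\<lambda>n. Y n + Z n)) = rep (X.cls Y) + rep (X.cls Z)"
    using tendsto_add[OF rep_tendsto[OF Y(1)] rep_tendsto[OF Z(1)]]
    by (simp add: Phi_add cauchy_M[OF Y(1)] cauchy_M[OF Z(1)] LIMSEQ_unique)
  then show "rep (alg_add CP C D) = alg_add (op_algebra G) (rep C) (rep D)"
    using X.add_cls[OF Y(1) Z(1)] by (simp add: CP_eq Y(2) Z(2) op_algebra_def)
  have "(\<lambda>n. Phi (Y n \<star> Z n)) \<longlonglongrightarrow> rep (X.cls (\<lambda>n. Y n \<star> Z n))"
    using rep_tendsto[OF X.p_cauchy_mult[OF Y(1) Z(1)]] by (simp add: ms)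
  then have "rep (X.cls (\<lambda>n. Y n \<star> Z n)) = rep (X.cls Y) o\<^sub>L rep (X.cls Z)"
    using comp_tendsto[OF rep_tendsto[OF Y(1)] rep_tendsto[OF Z(1)]]
    by (simp add: Phi_mult cauchy_M[OF Y(1)] cauchy_M[OF Z(1)] LIMSEQ_unique)
  then show "rep (alg_mult CP C D) = alg_mult (op_algebra G) (rep C) (rep D)"
    using X.mult_cls[OF Y(1) Z(1)] by (simp add: CP_eq Y(2) Z(2) op_algebra_def ms)
qed

subsection \<open>Uniqueness\<close>

context
  fixes \<psi>
  assumes hom: "star_hom CP (op_algebra G) \<psi>"
    and on_A: "\<And>a. \<psi> (cp_embed \<delta> J a) = \<pi> a" and on_u: "\<psi> (u_hat \<delta> J) = U"
begin

lemma psi_E: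
  "C \<in> alg_carrier X.E \<Longrightarrow> D \<in> alg_carrier X.E \<Longrightarrow> \<psi> (alg_add X.E C D) = \<psi> C + \<psi> D"
  "C \<in> alg_carrier X.E \<Longrightarrow> D \<in> alg_carrier X.E \<Longrightarrow> \<psi> (alg_mult X.E C D) = \<psi> C o\<^sub>L \<psi> D"
  "C \<in> alg_carrier X.E \<Longrightarrow> \<psi> (alg_scale X.E c C) = scale_op c (\<psi> C)"
  "C \<in> alg_carrier X.E \<Longrightarrow> \<psi> (alg_star X.E C) = adj (\<psi> C)"
  using hom by (simp_all add: star_hom_def op_algebra_def CP_eq)

lemma psi_add:
  assumes Y: "X.p_cauchy Y" and Z: "X.p_cauchy Z"
  shows "\<psi> (X.cls (\<lambda>n. Y n + Z n)) = \<psi> (X.cls Y) + \<psi> (X.cls Z)"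
  using psi_E(1)[OF X.cls_in_carrier[OF Y] X.cls_in_carrier[OF Z]] unfolding X.add_cls[OF Y Z] ms .

lemma psi_mult:
  assumes Y: "X.p_cauchy Y" and Z: "X.p_cauchy Z"
  shows "\<psi> (X.cls (\<lambda>n. Y n \<star> Z n)) = \<psi> (X.cls Y) o\<^sub>L \<psi> (X.cls Z)"
  using psi_E(2)[OF X.cls_in_carrier[OF Y] X.cls_in_carrier[OF Z]] unfolding X.mult_cls[OF Y Z] ms .

lemma psi_scale:
  assumes Y: "X.p_cauchy Y"
  shows "\<psi> (X.cls (\<lambda>n. sc c (Y n))) = scale_op c (\<psi> (X.cls Y))"
  using psi_E(3)[OF X.cls_in_carrier[OF Y]] unfolding X.scale_cls[OF Y] ms .

lemma psi_star:
  assumes Y: "X.p_cauchy Y"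
  shows "\<psi> (X.cls (\<lambda>n. st (Y n))) = adj (\<psi> (X.cls Y))"
  using psi_E(4)[OF X.cls_in_carrier[OF Y]] unfolding X.star_cls[OF Y] ms .

lemma psi_closed: "X.p_cauchy Y \<Longrightarrow> \<psi> (X.cls Y) \<in> bounded_ops"
proof -
  assume "X.p_cauchy Y"
  then have "\<psi> (X.cls Y) \<in> G"
    using hom X.cls_in_carrier[of Y] by (auto simp: star_hom_def CP_eq op_algebra_def)
  then show ?thesis using cstar_subalgebra_closure unfolding generated_eq cstar_subalgebra_def by blast
qed

lemma psi_diff:
  assumes Y: "X.p_cauchy Y" and Z: "X.p_cauchy Z"
  shows "\<psi> (X.cls (\<lambda>n. Y n - Z n)) = \<psi> (X.cls Y) - \<psi> (X.cls Z)"
proof -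
  have "\<psi> (X.cls (\<lambda>n. (Y n - Z n) + Z n)) = \<psi> (X.cls (\<lambda>n. Y n - Z n)) + \<psi> (X.cls Z)"
    by (rule psi_add[OF X.p_cauchy_diff[OF Y Z] Z])
  then show ?thesis by simp
qed

text \<open>The matrix with the entry \<open>x\<close> at \<open>(i, j)\<close> is the product \<open>u*^i x u^j\<close>, so \<open>\<psi>\<close> is determined on \<open>M\<close>.\<close>

lemma psi_const: "a \<in> M \<Longrightarrow> \<psi> (X.cls (\<lambda>n. a)) = Phi a"
proof (induction a rule: matrices_induct)
  case zero
  have "\<psi> (X.cls (\<lambda>n. 0)) = scale_op 0 (\<psi> (X.cls (\<lambda>n. 0)))"
    using psi_scale[OF const_cauchy[OF M_zero], of 0] unfolding sc_zero .
  also have "\<dots> = 0" by (rule blinfun_eqI) (simp add: ap_scale_op)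
  finally show ?case by (simp add: Phi_zero)
next
  case (add a b)
  then show ?case using psi_add[OF const_cauchy const_cauchy, of a b] by (simp add: Phi_add)
next
  case (single i j x)
  have corner_q: "corner 0 j (q j)" "corner j 0 (q j)" for j by (simp_all add: corner_def q_absorb)
  have up: "\<psi> (X.cls (\<lambda>n. single 0 j (q j))) = Up j" for j
  proof (induction j)
    case 0
    show ?case using on_A[of 1] by (simp add: cp_embed_eq op_power_0 pi_one)
  next
    case (Suc j)
    have "single 0 j (q j) \<star> single 0 1 (\<delta> 1) = single 0 (Suc j) (q j * q (Suc j))"
      using mprod_single_le[of 0 0 j "q j" 1 "\<delta> 1"] by (simp add: funpow_swap1)
    then have "single 0 j (q j) \<star> single 0 1 (\<delta> 1) = single 0 (Suc j) (q (Suc j))"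
      using q_absorb(1)[of j "Suc j"] by simp
    then show ?case
      using psi_mult[OF const_cauchy[OF M_single[OF corner_q(1)]] const_cauchy[OF M_u], of j] Suc on_u
      by (simp only: u_hat_eq op_power_Suc_right)
  qed
  have down: "\<psi> (X.cls (\<lambda>n. single j 0 (q j))) = Vp j" for j
    using psi_star[OF const_cauchy[OF M_single[OF corner_q(1)]], of j]
    by (simp add: st_single star_q up adj_op_power U_closed)
  have "single i 0 (q i) \<star> single 0 0 x = single i 0 (q i * x)"
    using mprod_single_le[of i 0 0 "q i" 0 x] by simp
  then have "single i 0 (q i) \<star> single 0 0 x \<star> single 0 j (q j) = single i j (q i * x * q j)"
    using mprod_single_le[of i 0 0 "q i * x" j "q j"] by simp
  also have "q i * x * q j = x" using single by (simp add: corner_def)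
  finally have eq: "single i 0 (q i) \<star> single 0 0 x \<star> single 0 j (q j) = single i j x" .
  have c: "X.p_cauchy (\<lambda>n. single i 0 (q i))" "X.p_cauchy (\<lambda>n. single 0 0 x)" "X.p_cauchy (\<lambda>n. single 0 j (q j))"
    by (intro const_cauchy M_single corner_q corner_one)+
  have c': "X.p_cauchy (\<lambda>n. single i 0 (q i) \<star> single 0 0 x)"
    by (intro const_cauchy M_mprod M_single corner_q corner_one)
  show ?case
    using psi_mult[OF c' c(3)] psi_mult[OF c(1,2)] on_A[of x]
    by (simp add: eq up down cp_embed_eq Phi_single)
qed

text \<open>A *-homomorphism on the completion is contractive, which makes \<open>\<psi>\<close> the continuous extension of its
  restriction to \<open>M\<close>. As for \<open>pi_contractive\<close>, the geometric series provides, in the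
  completion, an inverse that contradicts \<open>no_left_inverse_at_norm\<close> for the image \<open>T\<close> of \<open>y* y\<close>.\<close>

lemma psi_bounded:
  assumes Y: "X.p_cauchy Y" and c: "\<And>n. X.P (Y n) \<le> c"
  shows "norm (\<psi> (X.cls Y)) \<le> c"
proof (rule ccontr)
  assume no: "\<not> norm (\<psi> (X.cls Y)) \<le> c"
  have Yc: "Y n \<in> M" for n by (rule cauchy_M[OF Y])
  have c0: "0 \<le> c" using order.trans[OF X.p_nonneg c[of 0]] Yc[of 0] by (simp add: ms)
  define H where "H n = st (Y n) \<star> Y n" for n
  have H: "X.p_cauchy H" unfolding H_def using X.p_cauchy_mult[OF X.p_cauchy_star[OF Y] Y] by (simp add: ms)
  have PH: "X.P (H n) = (X.P (Y n))\<^sup>2" for n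
    unfolding H_def using X.p_cstar[of "Y n"] Yc by (simp add: ms)
  define T where "T = \<psi> (X.cls H)"
  have T: "T = adj (\<psi> (X.cls Y)) o\<^sub>L \<psi> (X.cls Y)"
    unfolding T_def H_def using psi_mult[OF X.p_cauchy_star[OF Y] Y] psi_star[OF Y] by (simp add: ms)
  have Tc: "T \<in> bounded_ops" and T_adj: "adj T = T"
    unfolding T using psi_closed[OF Y] by (simp_all add: op_closed adj_comp adj_adj)
  have l: "norm T = (norm (\<psi> (X.cls Y)))\<^sup>2" unfolding T by (rule norm_adj_comp[OF psi_closed[OF Y]])
  have big: "c\<^sup>2 < norm T" unfolding l using no c0 by (intro power_strict_mono) auto
  then have pos: "0 < norm T" using zero_le_power2[of c] by linarith
  define A where "A n = sc (of_real (1 / (norm T)\<^sup>2)) (H n \<star> H n)" for n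
  have HH: "X.p_cauchy (\<lambda>n. H n \<star> H n)" using X.p_cauchy_mult[OF H H] by (simp add: ms)
  have A: "X.p_cauchy A" unfolding A_def using X.p_cauchy_scale[OF HH] by (simp add: ms)
  define \<rho> where "\<rho> = (c\<^sup>2 / norm T)\<^sup>2"
  have rho: "\<rho> < 1" unfolding \<rho>_def using big pos by (simp add: power_less_one_iff abs_square_less_1)
  have PA: "X.P (A n) \<le> \<rho>" for n
  proof -
    have Hc: "H n \<in> M" by (rule cauchy_M[OF H])
    have le: "X.P (H n) \<le> c\<^sup>2" unfolding PH using c[of n] X.p_nonneg[of "Y n"] Yc by (intro power_mono) (auto simp: ms)
    have "X.P (H n \<star> H n) \<le> X.P (H n) * X.P (H n)" "0 \<le> X.P (H n)"
      using X.p_mult[of "H n" "H n"] X.p_nonneg[of "H n"] Hc by (simp_all add: ms)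
    then have "X.P (H n \<star> H n) \<le> c\<^sup>2 * c\<^sup>2"
      using mult_mono[OF le le zero_le_power2] by linarith
    then have "1 / (norm T)\<^sup>2 * X.P (H n \<star> H n) \<le> 1 / (norm T)\<^sup>2 * (c\<^sup>2 * c\<^sup>2)"
      by (intro mult_left_mono) auto
    moreover have "X.P (A n) = 1 / (norm T)\<^sup>2 * X.P (H n \<star> H n)"
      unfolding A_def using X.p_scale[of "H n \<star> H n" "of_real (1 / (norm T)\<^sup>2)"] M_mprod[OF Hc Hc]
      by (simp add: ms norm_divide norm_power)
    ultimately show ?thesis by (simp add: \<rho>_def power_divide power2_eq_square)
  qed
  show False
  proof (rule X.geometric_partial_sums[OF A PA rho])
    fix Z
    assume Z: "X.p_cauchy Z"
      and lim: "(\<lambda>n. X.P (alg_mult (matrix_algebra \<delta> J) (Z n) (single 0 0 1 - A n) - single 0 0 1)) \<longlonglongrightarrow> 0"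
    have one: "X.p_cauchy (\<lambda>n. single 0 0 1)" by (rule const_cauchy[OF M_embed])
    have oneA: "X.p_cauchy (\<lambda>n. single 0 0 1 - A n)" by (rule X.p_cauchy_diff[OF one A])
    have prod: "X.p_cauchy (\<lambda>n. Z n \<star> (single 0 0 1 - A n))"
      using X.p_cauchy_mult[OF Z oneA] by (simp add: ms)
    have "X.cls (\<lambda>n. Z n \<star> (single 0 0 1 - A n)) = X.cls (\<lambda>n. single 0 0 1)"
      unfolding X.cls_eq_iff[OF prod one] using lim by (simp add: ms)
    then have "\<psi> (X.cls Z) o\<^sub>L \<psi> (X.cls (\<lambda>n. single 0 0 1 - A n)) = id_blinfun"
      using psi_mult[OF Z oneA] on_A[of 1] by (simp add: cp_embed_eq pi_one)
    moreover have "\<psi> (X.cls (\<lambda>n. single 0 0 1 - A n)) = id_blinfun - scale_op (of_real (1 / (norm T)\<^sup>2)) (T o\<^sub>L T)"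
      unfolding psi_diff[OF one A] unfolding A_def psi_scale[OF HH] psi_mult[OF H H] T_def[symmetric]
      using on_A[of 1] by (simp add: cp_embed_eq pi_one)
    ultimately show False using no_left_inverse_at_norm[OF Tc T_adj pos] by simp
  qed
qed

lemma psi_eq_rep:
  assumes Y: "X.p_cauchy Y"
  shows "\<psi> (X.cls Y) = rep (X.cls Y)"
proof -
  have "(\<lambda>n. Phi (Y n)) \<longlonglongrightarrow> \<psi> (X.cls Y)"
  proof (rule LIMSEQ_I)
    fix r :: real assume r: "0 < r"
    obtain N where N: "\<And>m n. m \<ge> N \<Longrightarrow> n \<ge> N \<Longrightarrow> X.P (Y m - Y n) < r / 2"
      using Y r unfolding X.p_cauchy_def by (meson half_gt_zero)
    have "norm (Phi (Y m) - \<psi> (X.cls Y)) < r" if m: "m \<ge> N" for m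
    proof -
      have cm: "X.p_cauchy (\<lambda>n. Y m)" by (rule const_cauchy[OF cauchy_M[OF Y]])
      have shift: "X.p_cauchy (\<lambda>n. Y (n + N))" by (rule X.p_cauchy_shift[OF Y])
      have "(\<lambda>n. X.P (Y (n + N) - Y n)) \<longlonglongrightarrow> 0"
      proof (rule LIMSEQ_I)
        fix s :: real assume "0 < s"
        then obtain K where K: "\<And>m n. m \<ge> K \<Longrightarrow> n \<ge> K \<Longrightarrow> X.P (Y m - Y n) < s"
          using Y unfolding X.p_cauchy_def by meson
        have "norm (X.P (Y (n + N) - Y n) - 0) < s" if "n \<ge> K" for n
          using K[of "n + N" n] that X.p_nonneg[OF X.diff_closed[OF X.p_cauchy_carrier[OF Y] X.p_cauchy_carrier[OF Y]], of "n + N" n] by simp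
        then show "\<exists>no. \<forall>n\<ge>no. norm (X.P (Y (n + N) - Y n) - 0) < s" by blast
      qed
      then have eq: "X.cls (\<lambda>n. Y (n + N)) = X.cls Y" unfolding X.cls_eq_iff[OF shift Y] .
      have "norm (\<psi> (X.cls (\<lambda>n. Y (n + N) - Y m))) \<le> r / 2"
        by (rule psi_bounded[OF X.p_cauchy_diff[OF shift cm]]) (use N m in \<open>simp add: less_imp_le\<close>)
      then have "norm (\<psi> (X.cls Y) - Phi (Y m)) \<le> r / 2"
        unfolding psi_diff[OF shift cm] eq psi_const[OF cauchy_M[OF Y]] .
      then show ?thesis using r by (simp add: norm_minus_commute)
    qed
    then show "\<exists>no. \<forall>n\<ge>no. norm (Phi (Y n) - \<psi> (X.cls Y)) < r" by blast
  qed
  then show ?thesis using rep_tendsto[OF Y] LIMSEQ_unique by blast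
qed

end

subsection \<open>Isomorphism and property (*)\<close>

text \<open>A gauge automorphism multiplies each diagonal by a number of modulus 1, so it preserves the given seminorm and
  permutes the dominated C*-seminorms.\<close>

lemma P_gauge:
  assumes z: "cmod z = 1" and a: "a \<in> M"
  shows "X.P (gauge z a) \<le> X.P a"
proof (rule X.enveloping_seminorm_least)
  fix r assume r: "r \<in> X.dominated_seminorms"
  have zi: "cmod (z ^ j * cnj z ^ i) = 1" for i j using z by (simp add: norm_mult norm_power)
  have norm_gauge: "mat_seminorm \<delta> J (gauge z b) = mat_seminorm \<delta> J b" if b: "b \<in> M" for b
  proof -
    obtain N where N: "\<forall>i j. b i j \<noteq> 0 \<longrightarrow> i \<le> N \<and> j \<le> N" using ex_size[OF b] by blast
    have N': "\<forall>i j. gauge z b i j \<noteq> 0 \<longrightarrow> i \<le> N \<and> j \<le> N" using N unfolding gauge_def by (metis scaleC_zero_right)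
    have "norm (diag_op (diag_entry (gauge z b) k) N) = norm (diag_op (diag_entry b k) N)" for k
    proof -
      obtain w where w: "cmod w = 1" "\<And>n. diag_entry (gauge z b) k n = w *\<^sub>C diag_entry b k n"
      proof (cases "0 \<le> k")
        case True
        have "z ^ (n + nat k) * cnj z ^ n = z ^ nat k" for n
        proof -
          have "z * cnj z = 1" using z by (simp add: complex_norm_square[symmetric])
          then have "z ^ n * cnj z ^ n = 1" by (simp flip: power_mult_distrib)
          then show ?thesis by (simp add: power_add mult.assoc mult.left_commute)
        qed
        then show thesis using True z
          by (intro that[of "z ^ nat k"]) (auto simp: norm_power diag_entry_def gauge_def)
      next
        case False
        have "z ^ n * cnj z ^ (n + nat (- k)) = cnj z ^ nat (- k)" for n
        proof -
          have "z * cnj z = 1" using z by (simp add: complex_norm_square[symmetric])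
          then have "z ^ n * cnj z ^ n = 1" by (simp flip: power_mult_distrib)
          then show ?thesis by (simp add: power_add mult.assoc[symmetric])
        qed
        then show thesis using False z
          by (intro that[of "cnj z ^ nat (- k)"]) (auto simp: norm_power diag_entry_def gauge_def)
      qed
      have "diag_op (diag_entry (gauge z b) k) N = scale_op w (diag_op (diag_entry b k) N)"
        unfolding diag_op_def w(2) pi_scale
        by (induction N) (simp_all add: scale_op_comp Vp_closed scale_op_add)
      then show ?thesis by (simp add: norm_scale_op w)
    qed
    then show ?thesis unfolding mat_seminorm_eq[OF b N] mat_seminorm_eq[OF M_gauge[OF b] N'] by simp
  qed
  have r1: "0 \<le> r x" "r x \<le> mat_seminorm \<delta> J x" "r (sc c x) = cmod c * r x" "r (st x \<star> x) = (r x)\<^sup>2"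
    if "x \<in> M" for x c
    using r that by (auto simp: cstar_seminorm_on_def ms)
  have r2: "r (x + y) \<le> r x + r y" "r (x \<star> y) \<le> r x * r y" if "x \<in> M" "y \<in> M" for x y
    using r that by (auto simp: cstar_seminorm_on_def ms)
  have r3: "r (gauge z x) \<le> mat_seminorm \<delta> J x" if "x \<in> M" for x
    using r1(2)[OF M_gauge[OF that], of z] unfolding norm_gauge[OF that] .
  have "(\<lambda>x. r (gauge z x)) \<in> X.dominated_seminorms"
    unfolding mem_Collect_eq cstar_seminorm_on_def ms
    by (auto simp: M_gauge r1(1,3,4) r2 r3 gauge_add gauge_scale gauge_mult[OF z] M_star gauge_star)
  then show "r (gauge z a) \<le> X.P a"
    using X.enveloping_seminorm_upper[of "\<lambda>x. r (gauge z x)" a] a by (simp add: ms)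
qed

text \<open>The diagonal part is an average of gauge automorphisms.\<close>

lemma P_diag_part_le:
  assumes a: "a \<in> M"
  shows "X.P (diag_part 0 a) \<le> X.P a"
proof -
  obtain N where N: "diags_in {- int N..int N} a" using ex_band[OF a] by blast
  let ?n = "2 * N + 1"
  let ?g = "\<lambda>l. sc (1 / of_nat ?n) (gauge (cis (2 * pi * real l / real ?n)) a)"
  have "X.P (diag_part 0 a) = X.P (\<Sum>l<?n. ?g l)" by (simp only: gauge_average[OF N])
  also have "\<dots> \<le> (\<Sum>l<?n. X.P (?g l))"
    by (rule X.p_sum) (simp add: ms M_scale M_gauge a)
  also have "\<dots> \<le> (\<Sum>l<?n. 1 / real ?n * X.P a)"
  proof (rule sum_mono)
    fix l
    have "X.P (?g l) = 1 / real ?n * X.P (gauge (cis (2 * pi * real l / real ?n)) a)"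
      using X.p_scale[of "gauge (cis (2 * pi * real l / real ?n)) a" "1 / of_nat ?n"] M_gauge[OF a]
      by (simp only: ms norm_divide norm_of_nat norm_one)
    also have "\<dots> \<le> 1 / real ?n * X.P a"
      by (intro mult_left_mono P_gauge a) auto
    finally show "X.P (?g l) \<le> 1 / real ?n * X.P a" .
  qed
  also have "\<dots> = X.P a" by simp
  finally show ?thesis .
qed

lemma property_star_iff:
  "property_star \<delta> \<pi> U \<longleftrightarrow> (\<forall>a\<in>M. norm (Phi (diag_part 0 a)) \<le> norm (Phi a))"
  unfolding property_star_def Phi_def[symmetric] using Phi_diagonal_series by simp

text \<open>The zeroth diagonal of \<open>a a*\<close> is the sum of the products \<open>c c*\<close> over all diagonals \<open>c\<close> of \<open>a\<close>, and the image of
  such a sum dominates the image of each summand.\<close>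

lemma norm_diag_part_le:
  assumes star: "\<And>a. a \<in> M \<Longrightarrow> norm (Phi (diag_part 0 a)) \<le> norm (Phi a)" and a: "a \<in> M"
  shows "norm (Phi (diag_part k a)) \<le> norm (Phi a)"
proof -
  obtain N where N: "diags_in {- int N..int N} a" using ex_band[OF a] by blast
  define K where "K = insert k {- int N..int N}"
  have K: "finite K" "k \<in> K" "diags_in K a" using N by (auto simp: K_def diags_in_def)
  let ?c = "\<lambda>i. diag_part i a"
  have c: "?c i \<in> M" and sc: "st (?c i) \<in> M" for i by (simp_all add: M_diag_part M_star a)
  have sum_a: "a = (\<Sum>i\<in>K. ?c i)" using sum_diag_parts[OF K(3,1)] by simp
  have "st a = (\<Sum>i\<in>K. st (?c i))"
    using X.star_sum[of K ?c] sum_a c by (simp add: ms)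
  then have "a \<star> st a = (\<Sum>i\<in>K. ?c i) \<star> (\<Sum>j\<in>K. st (?c j))" using sum_a by simp
  also have "\<dots> = (\<Sum>i\<in>K. \<Sum>j\<in>K. ?c i \<star> st (?c j))"
    using X.mult_sum_left[of K ?c "\<Sum>j\<in>K. st (?c j)"] X.mult_sum_right[of K "\<lambda>j. st (?c j)"] X.sum_closed[of K "\<lambda>j. st (?c j)"] c sc
    by (simp add: ms)
  finally have "diag_part 0 (a \<star> st a) = (\<Sum>i\<in>K. \<Sum>j\<in>K. diag_part 0 (?c i \<star> st (?c j)))"
    by (simp add: diag_part_sum)
  also have "\<dots> = (\<Sum>i\<in>K. \<Sum>j\<in>K. if j = i then ?c i \<star> st (?c i) else 0)"
  proof (intro sum.cong refl)
    fix i j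
    have "diags_in {k + l |k l. k \<in> {i} \<and> l \<in> uminus ` {j}} (?c i \<star> st (?c j))"
      by (intro diags_in_mprod diags_in_star diags_in_diag_part)
    then have "diags_in {i - j} (?c i \<star> st (?c j))" by simp
    then show "diag_part 0 (?c i \<star> st (?c j)) = (if j = i then ?c i \<star> st (?c i) else 0)"
      using diag_part_of_homogeneous[of "i - j" "?c i \<star> st (?c j)" 0] by auto
  qed
  also have "\<dots> = (\<Sum>i\<in>K. ?c i \<star> st (?c i))" using K(1) by (simp add: sum.delta)
  finally have eq: "diag_part 0 (a \<star> st a) = (\<Sum>i\<in>K. ?c i \<star> st (?c i))" .
  have "Phi (diag_part 0 (a \<star> st a)) = (\<Sum>i\<in>K. Phi (?c i) o\<^sub>L adj (Phi (?c i)))"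
    unfolding eq using Phi_sum[of K "\<lambda>i. ?c i \<star> st (?c i)"] c sc by (simp add: M_mprod Phi_mult Phi_star)
  then have "(norm (Phi (?c k)))\<^sup>2 \<le> norm (Phi (diag_part 0 (a \<star> st a)))"
    using norm_le_norm_sum_adj[of K "\<lambda>i. Phi (?c i)" k] K c by (simp add: Phi_closed)
  also have "\<dots> \<le> norm (Phi (a \<star> st a))" by (intro star M_mprod M_star a)
  also have "\<dots> = norm (adj (adj (Phi a)) o\<^sub>L adj (Phi a))"
    using a by (simp add: Phi_mult Phi_star M_star adj_adj Phi_closed)
  also have "\<dots> = (norm (Phi a))\<^sup>2"
    using a norm_adj_comp[of "adj (Phi a)"] by (simp add: norm_adj Phi_closed adj_closed)
  finally show ?thesis by (rule power2_le_imp_le) simp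
qed

text \<open>For a diagonal \<open>c\<close> of \<open>a\<close> the element \<open>c* c\<close> lies on the zeroth diagonal, where \<open>P\<close> and \<open>norm (Phi _)\<close>
  agree; by the C*-identity they agree on \<open>c\<close>, too.\<close>

lemma P_band_le:
  assumes star: "\<And>a. a \<in> M \<Longrightarrow> norm (Phi (diag_part 0 a)) \<le> norm (Phi a)"
    and a: "a \<in> M" and N: "diags_in {- int N..int N} a"
  shows "X.P a \<le> (2 * real N + 1) * norm (Phi a)"
proof -
  have part: "X.P (diag_part k a) \<le> norm (Phi a)" for k
  proof -
    let ?c = "diag_part k a"
    have c: "?c \<in> M" "st ?c \<in> M" by (simp_all add: M_diag_part M_star a)
    have "diags_in {i + l |i l. i \<in> uminus ` {k} \<and> l \<in> {k}} (st ?c \<star> ?c)"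
      by (intro diags_in_mprod diags_in_star diags_in_diag_part)
    then have "diags_in {0} (st ?c \<star> ?c)" by simp
    then have "X.P (st ?c \<star> ?c) = norm (Phi (st ?c \<star> ?c))" using c by (intro P_diagonal M_mprod)
    also have "\<dots> = (norm (Phi ?c))\<^sup>2" using c by (simp add: Phi_mult Phi_star norm_adj_comp Phi_closed)
    finally have "(X.P ?c)\<^sup>2 = (norm (Phi ?c))\<^sup>2" using X.p_cstar[of ?c] c by (simp add: ms)
    then have "X.P ?c = norm (Phi ?c)" using X.p_nonneg[of ?c] c by (simp add: ms)
    then show ?thesis using norm_diag_part_le[OF star a, of k] by simp
  qed
  have "X.P a = X.P (\<Sum>k\<in>{- int N..int N}. diag_part k a)" by (simp add: sum_diag_parts[OF N])
  also have "\<dots> \<le> (\<Sum>k\<in>{- int N..int N}. X.P (diag_part k a))"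
    by (rule X.p_sum) (simp add: ms M_diag_part a)
  also have "\<dots> \<le> (\<Sum>k\<in>{- int N..int N}. norm (Phi a))" by (intro sum_mono part)
  also have "\<dots> = (2 * real N + 1) * norm (Phi a)" by simp
  finally show ?thesis .
qed

lemma P_le_norm_Phi:
  assumes star: "\<And>a. a \<in> M \<Longrightarrow> norm (Phi (diag_part 0 a)) \<le> norm (Phi a)" and a: "a \<in> M"
  shows "X.P a \<le> norm (Phi a)"
proof -
  define h where "h = st a \<star> a"
  have h: "h \<in> M" "st h = h" using a mprod_star[of "st a" a] by (simp_all add: h_def M_mprod M_star star_star)
  obtain N where N: "diags_in {- int N..int N} h" using ex_band[OF h(1)] by blast
  define f where "f n = ((\<lambda>x. x \<star> x) ^^ n) h" for n
  have f: "f n \<in> M \<and> st (f n) = f n \<and> diags_in {- int (N * 2 ^ n)..int (N * 2 ^ n)} (f n)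
      \<and> X.P (f n) = X.P h ^ (2 ^ n) \<and> norm (Phi (f n)) = norm (Phi h) ^ (2 ^ n)" for n
  proof (induction n)
    case 0
    show ?case using h N by (simp add: f_def)
  next
    case (Suc n)
    have fS: "f (Suc n) = f n \<star> f n" by (simp add: f_def)
    let ?K = "{- int (N * 2 ^ n)..int (N * 2 ^ n)}"
    have "diags_in {k + l |k l. k \<in> ?K \<and> l \<in> ?K} (f (Suc n))" unfolding fS using Suc by (intro diags_in_mprod) auto
    then have d: "diags_in {- int (N * 2 ^ Suc n)..int (N * 2 ^ Suc n)} (f (Suc n))"
      unfolding diags_in_def by fastforce
    have p: "X.P (f (Suc n)) = (X.P (f n))\<^sup>2"
      unfolding fS using X.p_square_self_adjoint[of "f n"] Suc by (simp add: ms)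
    have "Phi (f (Suc n)) = adj (Phi (f n)) o\<^sub>L Phi (f n)"
      unfolding fS using Suc by (metis Phi_mult Phi_star)
    then have q: "norm (Phi (f (Suc n))) = (norm (Phi (f n)))\<^sup>2" using Suc by (simp add: norm_adj_comp Phi_closed)
    have e: "x ^ 2 ^ Suc n = (x ^ 2 ^ n)\<^sup>2" for x :: real by (simp add: power_mult[symmetric] mult.commute)
    have "st (f (Suc n)) = f (Suc n)" unfolding fS using mprod_star[of "f n" "f n"] Suc by simp
    then show ?case using Suc d p q unfolding e by (simp add: fS M_mprod)
  qed
  have "X.P h \<le> norm (Phi h)"
  proof (rule power_trick_le[where C = "2 * real N" and D = 1])
    show "0 \<le> X.P h" using X.p_nonneg[of h] h by (simp add: ms)
    fix n
    show "X.P h ^ (2 ^ n) \<le> (2 * real N * 2 ^ n + 1) * norm (Phi h) ^ (2 ^ n)"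
      using P_band_le[OF star, of "f n" "N * 2 ^ n"] f[of n] by (simp add: mult.assoc)
  qed simp
  moreover have "X.P h = (X.P a)\<^sup>2" using X.p_cstar[of a] a by (simp add: ms h_def)
  moreover have "norm (Phi h) = (norm (Phi a))\<^sup>2"
    using a by (simp add: h_def Phi_mult Phi_star M_star norm_adj_comp Phi_closed)
  ultimately have "(X.P a)\<^sup>2 \<le> (norm (Phi a))\<^sup>2" by simp
  then show ?thesis by (rule power2_le_imp_le) simp
qed

text \<open>The lifted sequence has the same image as \<open>a\<close>; by injectivity it represents \<open>a\<close>, so that \<open>a\<close> inherits the bound
  \<open>r\<close>.\<close>

lemma inj_rep_imp_isometric:
  assumes inj: "inj_on rep (alg_carrier CP)" and a: "a \<in> M"
  shows "X.P a \<le> norm (Phi a)"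
proof (rule dense_ge)
  fix r assume r: "norm (Phi a) < r"
  show "X.P a \<le> r"
  proof (rule X.approximate_lifting[OF seminorm_Phi _ r])
    show "a \<in> alg_carrier (matrix_algebra \<delta> J)" using a by (simp add: ms)
    fix y assume y: "X.p_cauchy y" "(\<lambda>n. norm (Phi (y n - a))) \<longlonglongrightarrow> 0" "\<forall>\<^sub>F n in sequentially. X.P (y n) \<le> r"
    have ac: "X.p_cauchy (\<lambda>n. a)" by (rule const_cauchy[OF a])
    have "(\<lambda>n. norm (Phi (y n) - Phi a)) \<longlonglongrightarrow> 0"
      using y(2) by (simp add: Phi_diff cauchy_M[OF y(1)] a)
    then have "(\<lambda>n. Phi (y n)) \<longlonglongrightarrow> Phi a" by (rule LIM_zero_cancel[OF tendsto_norm_zero_cancel])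
    then have "rep (X.cls y) = rep (X.cls (\<lambda>n. a))"
      unfolding rep_const[OF a] using rep_tendsto[OF y(1)] LIMSEQ_unique by blast
    then have "X.cls y = X.cls (\<lambda>n. a)"
      using inj_onD[OF inj] X.cls_in_carrier[OF y(1)] X.cls_in_carrier[OF ac] by (simp add: CP_eq)
    then have lim: "(\<lambda>n. X.P (y n - a)) \<longlonglongrightarrow> 0" unfolding X.cls_eq_iff[OF y(1) ac] .
    have "\<forall>\<^sub>F n in sequentially. X.P a \<le> r + X.P (y n - a)"
      using y(3)
    proof (rule eventually_mono)
      fix n assume "X.P (y n) \<le> r"
      then show "X.P a \<le> r + X.P (y n - a)"
        using X.p_abs_diff[of "y n" a] cauchy_M[OF y(1)] a by (simp add: ms)
    qed
    then have "X.P a \<le> r + 0"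
      by (intro tendsto_lowerbound[OF tendsto_add[OF tendsto_const lim]]) auto
    then show ?thesis by simp
  qed
qed

theorem isomorphism_iff: "star_isomorphism CP (op_algebra G) rep \<longleftrightarrow> property_star \<delta> \<pi> U"
proof
  assume "star_isomorphism CP (op_algebra G) rep"
  then have inj: "inj_on rep (alg_carrier CP)" by (simp add: star_isomorphism_def bij_betw_def)
  show "property_star \<delta> \<pi> U"
    unfolding property_star_iff
  proof
    fix a assume a: "a \<in> M"
    have "norm (Phi (diag_part 0 a)) \<le> X.P (diag_part 0 a)" by (rule norm_Phi_le[OF M_diag_part[OF a]])
    also have "\<dots> \<le> X.P a" by (rule P_diag_part_le[OF a])
    also have "\<dots> \<le> norm (Phi a)" by (rule inj_rep_imp_isometric[OF inj a])
    finally show "norm (Phi (diag_part 0 a)) \<le> norm (Phi a)" .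
  qed
next
  assume "property_star \<delta> \<pi> U"
  then have le: "X.P a \<le> norm (Phi a)" if "a \<in> M" for a
    using P_le_norm_Phi that unfolding property_star_iff by blast
  have "inj_on rep (alg_carrier CP)"
  proof (rule inj_onI)
    fix C D assume CD: "C \<in> alg_carrier CP" "D \<in> alg_carrier CP" and eq: "rep C = rep D"
    obtain Y Z where Y: "X.p_cauchy Y" "C = X.cls Y" and Z: "X.p_cauchy Z" "D = X.cls Z"
      using CD by (auto simp: CP_eq X.carrier_E)
    have "(\<lambda>n. Phi (Y n) - Phi (Z n)) \<longlonglongrightarrow> rep C - rep D"
      unfolding Y(2) Z(2) by (intro tendsto_diff rep_tendsto Y Z)
    then have lim: "(\<lambda>n. norm (Phi (Y n) - Phi (Z n))) \<longlonglongrightarrow> 0" unfolding eq using tendsto_norm_zero by fastforce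
    have c: "Y n - Z n \<in> M" for n
      using X.diff_closed[OF X.p_cauchy_carrier[OF Y(1)] X.p_cauchy_carrier[OF Z(1)], of n n] by (simp add: ms)
    have "(\<lambda>n. X.P (Y n - Z n)) \<longlonglongrightarrow> 0"
    proof (rule squeeze_to_0)
      show "0 \<le> X.P (Y n - Z n)" for n using X.p_nonneg[of "Y n - Z n"] c by (simp add: ms)
      show "X.P (Y n - Z n) \<le> norm (Phi (Y n) - Phi (Z n))" for n
        using le[OF c] by (simp add: Phi_diff cauchy_M[OF Y(1)] cauchy_M[OF Z(1)])
    qed (rule lim)
    then show "C = D" unfolding Y(2) Z(2) X.cls_eq_iff[OF Y(1) Z(1)] .
  qed
  then show "star_isomorphism CP (op_algebra G) rep"
    using rep_hom rep_range by (simp add: star_isomorphism_def bij_betw_def op_algebra_def)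
qed

end

theorem theorem5p4:
  fixes \<delta> :: "'a::unital_cstar_algebra \<Rightarrow> 'a"
    and J :: "'a set"
    and \<pi> :: "'a \<Rightarrow> ('h::chilbert_space \<Rightarrow>\<^sub>L 'h)"
    and U :: "'h \<Rightarrow>\<^sub>L 'h"
  assumes "cstar_dynamical_system \<delta>"
    and "closed_ideal J"
    and "J \<inter> Ker \<delta> = {0}"
    and "covariant_rep \<delta> \<pi> U"
    and "associated_with \<pi> U J"
  shows "\<exists>\<phi>.
     star_epimorphism (crossed_product \<delta> J) (op_algebra (generated_cstar (range \<pi> \<union> {U}))) \<phi> \<and>
     (\<forall>a. \<phi> (cp_embed \<delta> J a) = \<pi> a) \<and> \<phi> (u_hat \<delta> J) = U \<and>
     (\<forall>\<psi>. star_hom (crossed_product \<delta> J) (op_algebra (generated_cstar (range \<pi> \<union> {U}))) \<psi> \<and>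
           (\<forall>a. \<psi> (cp_embed \<delta> J a) = \<pi> a) \<and> \<psi> (u_hat \<delta> J) = U \<longrightarrow>
           (\<forall>x\<in>alg_carrier (crossed_product \<delta> J). \<psi> x = \<phi> x)) \<and>
     (star_isomorphism (crossed_product \<delta> J) (op_algebra (generated_cstar (range \<pi> \<union> {U}))) \<phi> \<longleftrightarrow>
      property_star \<delta> \<pi> U)"
proof -
  interpret covariant_system \<delta> J \<pi> U
    using assms by unfold_locales
  have "star_epimorphism CP (op_algebra G) rep"
    using rep_hom rep_range by (simp add: star_epimorphism_def op_algebra_def)
  moreover have "\<psi> x = rep x"
    if "star_hom CP (op_algebra G) \<psi>" "\<forall>a. \<psi> (cp_embed \<delta> J a) = \<pi> a" "\<psi> (u_hat \<delta> J) = U" "x \<in> alg_carrier CP"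
    for \<psi> x
  proof -
    note x = that(4)
    obtain Y where Y: "X.p_cauchy Y" "x = X.cls Y" using x by (auto simp: CP_eq X.carrier_E)
    show ?thesis unfolding Y(2) using that(2) by (intro psi_eq_rep[OF that(1) _ that(3) Y(1)]) blast
  qed
  ultimately show ?thesis
    using rep_embed rep_u isomorphism_iff by (intro exI[of _ rep]) blast
qed

end
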